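(* Let $\omega$ be Diophantine with constants $C_{\mathrm{dio}}>0,\tau>1$, let $x_0\in(-1/2,1/2)\setminus(\mathbb Z+1/2+\mathbb Z^d\cdot\omega)$, and suppose that $f$ is $C_{\mathrm{reg}}$-regular at $x_0$ and $D_{\min}(x_0)\ge1$. Consider the operator on $\ell^2(\mathbb Z^d)$ $$(H(x_0)\psi)_{\mathbf n}=\varepsilon\sum_{\mathbf m\in\mathbb Z^d}\varphi_{\mathbf n-\mathbf m}\psi_{\mathbf m}+f(x_0+\mathbf n\cdot\omega)\psi_{\mathbf n},$$ and the Rayleigh--Schr\"odinger perturbation series $\lambda=\lambda_0+\varepsilon\lambda_1+\varepsilon^2\lambda_2+\dots$, $\psi=\psi_0+\varepsilon\psi_1+\varepsilon^2\psi_2+\dots$ with $\lambda_0=f(x_0)$ and $\psi_0=e_{\mathbf 0}$. There exist a constant $C_{\mathrm{dist}}>0$ depending only on the distance function $\mathrm{dist}_\varphi$ and $\gamma=\gamma(\tau,C_{\mathrm{dio}},\mathrm{dist}_\varphi)>0$ such that the terms of the eigenvalue series satisfy $$|\lambda_k|\le C_{\mathrm{reg}}^{k/2}(C_{\mathrm{dist}}\|\varphi\|_\infty)^k\gamma^{-k},\qquad k\ge1.$$ Suppose, in addition, that $0<\varepsilon<C_{\mathrm{reg}}^{-1/2}(C_{\mathrm{dist}}\|\varphi\|_\infty)^{-1}\gamma$. Then the series converge, $$|\psi_{\mathbf n}|=|\langle e_{\mathbf n},\psi\rangle|\le\left(\frac{C_{\mathrm{dist}}\|\varphi\|_\infty\sqrt{C_{\mathrm{reg}}}}{\gamma}\right)^{\mathrm{dist}_\varphi(\mathbf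 n,\mathbf 0)}\varepsilon^{\mathrm{dist}_\varphi(\mathbf n,\mathbf 0)},\qquad\mathbf n\in\mathbb Z^d,$$ and $\psi\in\ell^2(\mathbb Z^d)$ satisfies the eigenvalue equation $H(x_0)\psi=\lambda\psi$.
   Context: Frequency: $\omega\in(-1/2,1/2)^d$ is Diophantine: $\|\mathbf n\cdot\omega\|:=\mathrm{dist}(\mathbf n\cdot\omega,\mathbb Z)\ge C_{\mathrm{dio}}|\mathbf n|^{-\tau}$ for all $\mathbf n\in\mathbb Z^d\setminus\{\mathbf 0\}$. Hopping: $\varphi=\{\varphi_{\mathbf n}\}$ has finite support, $\varphi_{\mathbf 0}=0$, $\varphi_{-\mathbf n}=\overline{\varphi_{\mathbf n}}$, $\|\varphi\|_\infty=\sup_{\mathbf n}|\varphi_{\mathbf n}|$. $\mathrm{dist}_\varphi(\mathbf k,\mathbf k')$ is the smallest $l$ for which there are $\mathbf k=\mathbf k_0,\dots,\mathbf k_l=\mathbf k'$ with $\varphi_{\mathbf k_{j+1}-\mathbf k_j}\ne0$ for all $0\le j\le l-1$ ($+\infty$ if there is none). Regularity: $f\colon(-1/2,1/2)\to\mathbb R$ is continuous with $f(-1/2+0)=-\infty$, $f(1/2-0)=+\infty$, extended $1$-periodically to $\mathbb R\setminus(\mathbb Z+1/2)$. Where a derivative does not exist, bounds on it are required for all derivative numbers (limits of difference quotients along sequences), and infima are taken over all derivative numbers. $f$ is $C_{\mathrm{reg}}$-regular at $x_0\in(-1/2,1/2)$ if: (cr0) $f^{-1}((f(x_0)-2,f(x_0)+2))\cap(-1/2,1/2)$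 is an open interval $(a,b)$, and $f$ maps $(a,b)$ one-to-one onto $(f(x_0)-2,f(x_0)+2)$; (cr1) with $D_{\min}(x_0):=\inf_{x\in(a,b)}f'(x)$, one has $D_{\min}(x_0)\le f'(x)\le C_{\mathrm{reg}}D_{\min}(x_0)$ for all $x\in(a,b)$; (cr2) with $(a_1,b_1)=f^{-1}((f(x_0)-1,f(x_0)+1))\cap(-1/2,1/2)\subset(a,b)$ and $g(x)=\frac1{f(x_0)-f(x)}$ for $x\in(b_1,a_1+1)$, extended by continuity by $g(1/2)=0$, one has $|g'(x)|\le C_{\mathrm{reg}}D_{\min}(x_0)$ on $(b_1,a_1+1)$. Perturbation series: $H(x_0)=V+\varepsilon\Phi$ with $(V\psi)_{\mathbf n}=f(x_0+\mathbf n\cdot\omega)\psi_{\mathbf n}$, $(\Phi\psi)_{\mathbf n}=\sum_{\mathbf m}\varphi_{\mathbf n-\mathbf m}\psi_{\mathbf m}$. The $\lambda_s\in\mathbb R$, $\psi_s\in\ell^2(\mathbb Z^d)$ are uniquely determined by $\lambda_0=f(x_0)$, $\psi_0=e_{\mathbf 0}$, $\psi_s\perp e_{\mathbf 0}$ ($s>0$), and equality at each power of $\varepsilon$ in $(V+\varepsilon\Phi)(\psi_0+\varepsilon\psi_1+\dots)=(\lambda_0+\varepsilon\lambda_1+\dots)(\psi_0+\varepsilon\psi_1+\dots)$. The eigenvector series is understood componentwise. *)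

theory Defs
  imports "HOL-Analysis.Analysis"
begin

text \<open>
  The lattice is the type \<^typ>\<open>int ^ 'd\<close>; elements of the Hilbert space over it are
  functions \<^typ>\<open>int ^ 'd \<Rightarrow> complex\<close> satisfying the predicate \<open>ell2\<close>.
\<close>

definition real_vec :: "int ^ 'd::finite \<Rightarrow> real ^ 'd" where
  "real_vec n = (\<chi> i. real_of_int (n $ i))"

definition lattice_dot :: "int ^ 'd::finite \<Rightarrow> real ^ 'd \<Rightarrow> real" where
  "lattice_dot n \<omega> = real_vec n \<bullet> \<omega>"

text \<open>The length of a lattice vector is its Euclidean norm.\<close>

definition diophantine :: "real \<Rightarrow> real \<Rightarrow> real ^ 'd::finite \<Rightarrow> bool" where
  "diophantine C \<tau> \<omega> \<longleftrightarrow>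
     (\<forall>i. \<omega> $ i \<in> {-1/2<..<1/2}) \<and>
     (\<forall>n. n \<noteq> 0 \<longrightarrow> infdist (lattice_dot n \<omega>) \<int> \<ge> C * norm (real_vec n) powr (- \<tau>))"

definition hopping :: "(int ^ 'd::finite \<Rightarrow> complex) \<Rightarrow> bool" where
  "hopping \<phi> \<longleftrightarrow> finite {n. \<phi> n \<noteq> 0} \<and> \<phi> 0 = 0 \<and> (\<forall>n. \<phi> (- n) = cnj (\<phi> n))"

definition sup_norm :: "('a \<Rightarrow> complex) \<Rightarrow> real" where
  "sup_norm \<phi> = (SUP n. cmod (\<phi> n))"

text \<open>If no path exists, the infimum is over the empty set and equals \<open>\<infinity>\<close>.\<close>

definition hop_dist :: "(int ^ 'd::finite \<Rightarrow> complex) \<Rightarrow> int ^ 'd \<Rightarrow> int ^ 'd \<Rightarrow> enat" where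
  "hop_dist \<phi> k k' =
     Inf {enat l | l. \<exists>p. p 0 = k \<and> p l = k' \<and> (\<forall>j<l. \<phi> (p (Suc j) - p j) \<noteq> 0)}"

text \<open>
  The potential is a function on the whole real line; its values on \<open>\<int> + 1/2\<close>, where the
  mathematical function is undefined, are unconstrained and are never used below.
\<close>

definition sawtooth_potential :: "(real \<Rightarrow> real) \<Rightarrow> bool" where
  "sawtooth_potential f \<longleftrightarrow>
     continuous_on {-1/2<..<1/2} f \<and>
     filterlim f at_bot (at_right (-1/2)) \<and>
     filterlim f at_top (at_left (1/2)) \<and>
     (\<forall>x. x - 1/2 \<notin> \<int> \<longrightarrow> f (x + 1) = f x)"

text \<open>
  Derivative numbers are extended reals: without the value \<open>\<infinity>\<close> a bound on all of
  them would not exclude a vertical tangent.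
\<close>

definition derivative_number :: "(real \<Rightarrow> real) \<Rightarrow> real \<Rightarrow> ereal \<Rightarrow> bool" where
  "derivative_number h x D \<longleftrightarrow>
     (\<exists>y::nat \<Rightarrow> real. (\<forall>k. y k \<noteq> x) \<and> y \<longlonglongrightarrow> x \<and>
        (\<lambda>k. ereal ((h (y k) - h x) / (y k - x))) \<longlonglongrightarrow> D)"

definition level_nbhd :: "(real \<Rightarrow> real) \<Rightarrow> real \<Rightarrow> real \<Rightarrow> real set" where
  "level_nbhd f x0 r = f -` {f x0 - r<..<f x0 + r} \<inter> {-1/2<..<1/2}"

definition D_min :: "(real \<Rightarrow> real) \<Rightarrow> real \<Rightarrow> ereal" where
  "D_min f x0 = Inf {D. \<exists>x\<in>level_nbhd f x0 2. derivative_number f x D}"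

definition recip_gap :: "(real \<Rightarrow> real) \<Rightarrow> real \<Rightarrow> real \<Rightarrow> real" where
  "recip_gap f x0 x = (if x = 1/2 then 0 else 1 / (f x0 - f x))"

text \<open>
  The endpoints \<open>a\<close>, \<open>b\<close>, \<open>a1\<close>, \<open>b1\<close> are determined by the two interval equations,
  since both sets contain \<open>x0\<close>. The interval \<open>(b1, a1 + 1)\<close> contains \<open>1/2\<close>, and the
  part beyond \<open>1/2\<close> uses the periodic extension of \<open>f\<close>.
\<close>

definition regular_at :: "real \<Rightarrow> (real \<Rightarrow> real) \<Rightarrow> real \<Rightarrow> bool" where
  "regular_at C f x0 \<longleftrightarrow>
     (\<exists>a b a1 b1.
        level_nbhd f x0 2 = {a<..<b} \<and>
        bij_betw f {a<..<b} {f x0 - 2<..<f x0 + 2} \<and>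
        (\<forall>x\<in>{a<..<b}. \<forall>D. derivative_number f x D \<longrightarrow>
            D_min f x0 \<le> D \<and> D \<le> ereal C * D_min f x0) \<and>
        level_nbhd f x0 1 = {a1<..<b1} \<and>
        (\<forall>x\<in>{b1<..<a1 + 1}. \<forall>D. derivative_number (recip_gap f x0) x D \<longrightarrow>
            \<bar>D\<bar> \<le> ereal C * D_min f x0))"

definition ell2 :: "('a \<Rightarrow> complex) \<Rightarrow> bool" where
  "ell2 \<psi> \<longleftrightarrow> (\<lambda>n. (cmod (\<psi> n))\<^sup>2) summable_on UNIV"

definition ell2_inner :: "('a \<Rightarrow> complex) \<Rightarrow> ('a \<Rightarrow> complex) \<Rightarrow> complex" where
  "ell2_inner u v = (\<Sum>\<^sub>\<infinity>n. cnj (u n) * v n)"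

definition basis_vec :: "'a \<Rightarrow> 'a \<Rightarrow> complex" where
  "basis_vec m n = (if n = m then 1 else 0)"

definition pot_op ::
  "(real \<Rightarrow> real) \<Rightarrow> real ^ 'd::finite \<Rightarrow> real \<Rightarrow> (int ^ 'd \<Rightarrow> complex) \<Rightarrow> int ^ 'd \<Rightarrow> complex" where
  "pot_op f \<omega> x0 \<psi> n = complex_of_real (f (x0 + lattice_dot n \<omega>)) * \<psi> n"

definition hop_op ::
  "(int ^ 'd::finite \<Rightarrow> complex) \<Rightarrow> (int ^ 'd \<Rightarrow> complex) \<Rightarrow> int ^ 'd \<Rightarrow> complex" where
  "hop_op \<phi> \<psi> n = (\<Sum>\<^sub>\<infinity>m. \<phi> (n - m) * \<psi> m)"

definition hamiltonian ::
  "(real \<Rightarrow> real) \<Rightarrow> real ^ 'd::finite \<Rightarrow> (int ^ 'd \<Rightarrow> complex) \<Rightarrow> real \<Rightarrow> real \<Rightarrow>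
   (int ^ 'd \<Rightarrow> complex) \<Rightarrow> int ^ 'd \<Rightarrow> complex" where
  "hamiltonian f \<omega> \<phi> \<epsilon> x0 \<psi> n =
     complex_of_real \<epsilon> * hop_op \<phi> \<psi> n + pot_op f \<omega> x0 \<psi> n"

text \<open>
  The last conjunct equates the coefficients of the \<open>s\<close>-th power of the coupling in
  \<open>(V + \<epsilon> \<Phi>) (\<Sum>s. \<epsilon>^s \<psi>\<^sub>s) = (\<Sum>s. \<epsilon>^s \<lambda>\<^sub>s) (\<Sum>s. \<epsilon>^s \<psi>\<^sub>s)\<close>.
\<close>

definition RS_series ::
  "(real \<Rightarrow> real) \<Rightarrow> real ^ 'd::finite \<Rightarrow> (int ^ 'd \<Rightarrow> complex) \<Rightarrow> real \<Rightarrow>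
   (nat \<Rightarrow> real) \<Rightarrow> (nat \<Rightarrow> int ^ 'd \<Rightarrow> complex) \<Rightarrow> bool" where
  "RS_series f \<omega> \<phi> x0 lam psi \<longleftrightarrow>
     lam 0 = f x0 \<and> psi 0 = basis_vec 0 \<and>
     (\<forall>s. ell2 (psi s)) \<and>
     (\<forall>s>0. ell2_inner (basis_vec 0) (psi s) = 0) \<and>
     (\<forall>s n. pot_op f \<omega> x0 (psi s) n + (if s = 0 then 0 else hop_op \<phi> (psi (s - 1)) n) =
        (\<Sum>j\<le>s. complex_of_real (lam j) * psi (s - j) n))"

end

theory Submission
  imports Defs "HOL-Computational_Algebra.Formal_Power_Series"
begin

unbundle no vec_syntax
unbundle fps_syntax

text \<open>
  Put \<open>v\<^sub>n = f (x0 + n \<bullet> \<omega>) - f x0\<close> and let \<open>L\<close> be the formal power series of \<open>\<lambda> - \<lambda>\<^sub>0\<close>. All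
  objects are formal power series in the coupling, so every manipulation is legitimate and only
  the size of coefficients has to be estimated. The naive perturbation series divides by small
  \<open>v\<^sub>n\<close> repeatedly at the same site, and its terms grow too fast; monotonicity of the potential
  supplies the cancellation.

  Sites are eliminated one at a time by Gaussian elimination, the most resonant ones (smallest
  \<open>\<bar>v\<bar>\<close>) last. Eliminating \<open>s\<close> replaces the hopping \<open>K\<close> among the other sites by
  \<open>K x y + K x s * d\<^sub>s\<inverse> * K s y\<close>, where \<open>d\<^sub>s = L - v\<^sub>s - K s s\<close> is a renormalised denominator. The
  result is a sum over walks in which a site recurs only after a visit to a site at least as
  resonant. Along such a walk, consecutive visits to the set \<open>\<bar>v\<bar> \<le> \<delta>\<close> are at different sites, and
  the Diophantine condition keeps them \<open>const * \<delta> powr (- 1 / \<tau>)\<close> steps apart. Counting visits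
  at dyadic levels shows that the product of all \<open>1 / \<bar>v\<bar>\<close> along the walk is at most exponential in
  its length (\<open>small_denominators_product\<close>, a Siegel-Brjuno estimate).

  It remains to see that renormalisation does not destroy the denominators: \<open>L - K s s\<close> must be
  at most \<open>\<bar>v\<^sub>s\<bar> / 2\<close> in norm (\<open>denoms_controlled_all\<close>). Eliminating every site except \<open>0\<close> identifies
  \<open>L\<close> with the self-energy \<open>K 0 0\<close> at \<open>0\<close>, so \<open>L - K s s\<close> compares the self-energies of two sites
  whose environments differ by the translation \<open>s\<close>. Where both environments have been eliminated,
  a resolvent identity (\<open>self_energy_difference\<close>) bounds the difference by the change of the
  potential under the translation, and regularity makes that change at most
  \<open>2 * C_reg * \<bar>v\<^sub>s\<bar>\<close> in a scale adapted to walk weights (\<open>potential_shift\<close>). Since this occurs on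
  closed walks with at least two hops, it costs \<open>C_reg\<close> per two powers of the coupling, which is
  the origin of the square root of \<open>C_reg\<close>. The remaining walks reach sites at least as resonant as
  \<open>s\<close>; by the Diophantine condition they are long, and their exponentially small weight beats the
  polynomially small \<open>\<bar>v\<^sub>s\<bar>\<close> (\<open>far_walks_bound\<close>).

  The apparent circularity (walk bounds need denominators and conversely) is resolved by the order
  in the coupling: a loop from \<open>s\<close> that passes a site \<open>q\<close> has spent at least one hop before it needs
  the denominator at \<open>q\<close>. Estimates are therefore stated for norms truncated at order \<open>j\<close> and
  proved by induction on \<open>j\<close>. The eigenvector series is the walk series started at \<open>0\<close>, which gives
  its summability and, because coefficients of order below the hopping distance vanish, its decay.
\<close>

section \<open>Truncated norms of formal power series\<close>

definition trunc_norm :: "nat \<Rightarrow> real \<Rightarrow> complex fps \<Rightarrow> real" where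
  "trunc_norm j r a = (\<Sum>i\<le>j. cmod (a $ i) * r ^ i)"

lemma trunc_norm_nonneg: "0 \<le> r \<Longrightarrow> 0 \<le> trunc_norm j r a"
  by (auto simp: trunc_norm_def intro!: sum_nonneg)

lemma trunc_norm_0 [simp]: "trunc_norm j r 0 = 0"
  by (simp add: trunc_norm_def)

lemma trunc_norm_const [simp]: "trunc_norm j r (fps_const c) = cmod c"
  unfolding trunc_norm_def by (subst sum.remove[of _ 0]) auto

lemma trunc_norm_of_bool: "trunc_norm j r (of_bool P) = of_bool P"
  using trunc_norm_const[of j r 1] by (cases P) (auto simp: fps_const_1_eq_1)

lemma trunc_norm_minus [simp]: "trunc_norm j r (- a) = trunc_norm j r a"
  by (simp add: trunc_norm_def)

lemma trunc_norm_add: "0 \<le> r \<Longrightarrow> trunc_norm j r (a + b) \<le> trunc_norm j r a + trunc_norm j r b"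
  unfolding trunc_norm_def sum.distrib[symmetric] distrib_right[symmetric]
  by (intro sum_mono mult_right_mono) (auto simp: norm_triangle_ineq)

lemma trunc_norm_diff: "0 \<le> r \<Longrightarrow> trunc_norm j r (a - b) \<le> trunc_norm j r a + trunc_norm j r b"
  using trunc_norm_add[of r j a "- b"] by simp

lemma trunc_norm_sum:
  "0 \<le> r \<Longrightarrow> trunc_norm j r (sum f F) \<le> (\<Sum>x\<in>F. trunc_norm j r (f x))"
proof (induction F rule: infinite_finite_induct)
  case (insert x F)
  then show ?case using trunc_norm_add[of r j "f x" "sum f F"] by simp
qed auto

lemma trunc_norm_mono: "0 \<le> r \<Longrightarrow> i \<le> j \<Longrightarrow> trunc_norm i r a \<le> trunc_norm j r a"
  unfolding trunc_norm_def by (intro sum_mono2) auto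

lemma trunc_norm_cong: "(\<And>i. i \<le> j \<Longrightarrow> a $ i = b $ i) \<Longrightarrow> trunc_norm j r a = trunc_norm j r b"
  by (simp add: trunc_norm_def)

lemma trunc_norm_const_mult: "trunc_norm j r (fps_const c * a) = cmod c * trunc_norm j r a"
  by (simp add: trunc_norm_def norm_mult sum_distrib_left mult.assoc)

text \<open>A factor whose lowest coefficients vanish leaves less room for the other factor: the
  second factor is only needed up to the order that remains.\<close>

lemma trunc_norm_mult_le:
  assumes r: "0 \<le> r" and B: "\<And>i. i \<le> j \<Longrightarrow> a $ i \<noteq> 0 \<Longrightarrow> trunc_norm (j - i) r b \<le> B"
  shows "trunc_norm j r (a * b) \<le> trunc_norm j r a * B"
proof -
  have "trunc_norm j r (a * b) \<le> (\<Sum>k\<le>j. \<Sum>i\<le>k. cmod (a $ i) * r ^ i * (cmod (b $ (k - i)) * r ^ (k - i)))"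
    unfolding trunc_norm_def
  proof (intro sum_mono)
    fix k
    have "cmod ((a * b) $ k) * r ^ k \<le> (\<Sum>i\<le>k. cmod (a $ i * b $ (k - i))) * r ^ k"
      unfolding fps_mult_nth atLeast0AtMost using r by (intro mult_right_mono norm_sum) auto
    also have "\<dots> = (\<Sum>i\<le>k. cmod (a $ i) * r ^ i * (cmod (b $ (k - i)) * r ^ (k - i)))"
      unfolding sum_distrib_right
    proof (intro sum.cong refl)
      fix i assume "i \<in> {..k}"
      then have "r ^ k = r ^ i * r ^ (k - i)" by (simp flip: power_add)
      then show "cmod (a $ i * b $ (k - i)) * r ^ k = cmod (a $ i) * r ^ i * (cmod (b $ (k - i)) * r ^ (k - i))"
        by (simp add: norm_mult)
    qed
    finally show "cmod ((a * b) $ k) * r ^ k \<le> (\<Sum>i\<le>k. cmod (a $ i) * r ^ i * (cmod (b $ (k - i)) * r ^ (k - i)))" .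
  qed
  also have "\<dots> = (\<Sum>i\<le>j. \<Sum>k\<in>{i..j}. cmod (a $ i) * r ^ i * (cmod (b $ (k - i)) * r ^ (k - i)))"
    by (subst sum.Sigma, simp, simp, subst sum.Sigma, simp, simp)
       (rule sum.reindex_bij_witness[of _ "\<lambda>(i,k). (k,i)" "\<lambda>(k,i). (i,k)"]; auto)
  also have "\<dots> = (\<Sum>i\<le>j. cmod (a $ i) * r ^ i * trunc_norm (j - i) r b)"
  proof (intro sum.cong refl)
    fix i assume "i \<in> {..j}"
    then have "(\<Sum>k\<in>{i..j}. cmod (b $ (k - i)) * r ^ (k - i)) = trunc_norm (j - i) r b"
      unfolding trunc_norm_def
      by (intro sum.reindex_bij_witness[of _ "\<lambda>l. l + i" "\<lambda>k. k - i"]) auto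
    then show "(\<Sum>k\<in>{i..j}. cmod (a $ i) * r ^ i * (cmod (b $ (k - i)) * r ^ (k - i))) =
        cmod (a $ i) * r ^ i * trunc_norm (j - i) r b"
      by (simp flip: sum_distrib_left)
  qed
  also have "\<dots> \<le> (\<Sum>i\<le>j. cmod (a $ i) * r ^ i * B)"
  proof (intro sum_mono)
    fix i assume "i \<in> {..j}"
    then show "cmod (a $ i) * r ^ i * trunc_norm (j - i) r b \<le> cmod (a $ i) * r ^ i * B"
      using r B[of i] by (cases "a $ i = 0") (auto intro!: mult_left_mono)
  qed
  also have "\<dots> = trunc_norm j r a * B"
    by (simp add: trunc_norm_def sum_distrib_right)
  finally show ?thesis .
qed

lemma trunc_norm_mult: "0 \<le> r \<Longrightarrow> trunc_norm j r (a * b) \<le> trunc_norm j r a * trunc_norm j r b"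
  by (intro trunc_norm_mult_le trunc_norm_mono) auto

lemma trunc_norm_X_mult: 
  assumes r: "0 \<le> r" shows "trunc_norm j r (fps_X * a) \<le> r * trunc_norm j r a"
proof -
  have "trunc_norm j r (fps_X :: complex fps) \<le> r"
  proof (cases "1 \<le> j")
    case True
    then show ?thesis using r unfolding trunc_norm_def fps_X_def
      by (subst sum.remove[of _ 1]) (auto simp: intro!: sum.neutral)
  next
    case False
    then show ?thesis using r by (simp add: trunc_norm_def)
  qed
  then have "trunc_norm j r fps_X * trunc_norm j r a \<le> r * trunc_norm j r a"
    using trunc_norm_nonneg[OF r] by (intro mult_right_mono)
  with trunc_norm_mult[OF r, of j fps_X a] show ?thesis by linarith
qed

text \<open>A perturbation of the constant \<open>- c\<close> by at most half its size has an inverse of norm at most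
  \<open>2 / \<bar>c\<bar>\<close>; truncation keeps this elementary, since the inverse has finite norm from the outset and
  can be absorbed.\<close>
lemma trunc_norm_inverse_le:
  assumes r: "0 \<le> r" and c: "c \<noteq> 0" and e: "trunc_norm j r e \<le> cmod c / 2"
    and i: "(e - fps_const c) * i = 1"
  shows "trunc_norm j r i \<le> 2 / cmod c"
proof -
  have "fps_const c * i = e * i - 1" using i by (simp add: algebra_simps)
  then have "cmod c * trunc_norm j r i = trunc_norm j r (e * i - 1)"
    by (metis trunc_norm_const_mult)
  also have "\<dots> \<le> trunc_norm j r e * trunc_norm j r i + 1"
    using trunc_norm_diff[OF r, of j "e * i" 1] trunc_norm_mult[OF r, of j e i]
      trunc_norm_const[of j r 1] by (simp add: fps_const_1_eq_1)
  also have "\<dots> \<le> cmod c / 2 * trunc_norm j r i + 1"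
    using mult_right_mono[OF e trunc_norm_nonneg[OF r, of j i]] by simp
  finally show ?thesis using c by (simp add: field_simps)
qed

section \<open>Walks\<close>

fun walk :: "'a::ab_group_add set \<Rightarrow> 'a \<Rightarrow> 'a list \<Rightarrow> bool" where
  "walk S x [] \<longleftrightarrow> True"
| "walk S x (y # w) \<longleftrightarrow> y - x \<in> S \<and> walk S y w"

lemma walk_append: "walk S x (u @ s # w) \<longleftrightarrow> walk S x (u @ [s]) \<and> walk S s w"
  by (induction u arbitrary: x) auto

text \<open>The bound is on the number of steps rather than an equality, so that \<open>reach\<close> is monotone in the
  number of steps and describes balls of the hopping distance.\<close>
definition reach :: "'a::ab_group_add set \<Rightarrow> nat \<Rightarrow> 'a \<Rightarrow> 'a \<Rightarrow> bool" where
  "reach S l x y \<longleftrightarrow> (\<exists>w. walk S x w \<and> length w \<le> l \<and> last (x # w) = y)"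

lemma reach_refl [simp]: "reach S l x x"
  unfolding reach_def by (rule exI[of _ "[]"]) auto

lemma reach_0 [simp]: "reach S 0 x y \<longleftrightarrow> x = y"
  unfolding reach_def by auto

lemma reach_mono: "reach S l x y \<Longrightarrow> l \<le> l' \<Longrightarrow> reach S l' x y"
  unfolding reach_def using le_trans by blast

lemma walk_append2: "walk S x (u @ w) \<longleftrightarrow> walk S x u \<and> walk S (last (x # u)) w"
  by (induction u arbitrary: x) auto

lemma reach_trans: 
  assumes "reach S l x y" "reach S l' y z" shows "reach S (l + l') x z"
proof -
  obtain u where u: "walk S x u" "length u \<le> l" "last (x # u) = y" using assms(1) by (auto simp: reach_def)
  obtain w where w: "walk S y w" "length w \<le> l'" "last (y # w) = z" using assms(2) by (auto simp: reach_def)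
  show ?thesis unfolding reach_def
  proof (intro exI[of _ "u @ w"] conjI)
    show "walk S x (u @ w)" using u w by (simp add: walk_append2)
    show "length (u @ w) \<le> l + l'" using u w by simp
    show "last (x # u @ w) = z" using u w by (cases "w = []") auto
  qed
qed

lemma reach_step: "y - x \<in> S \<Longrightarrow> reach S (Suc l) x y"
  unfolding reach_def by (rule exI[of _ "[y]"]) auto

lemma walk_shift: "walk S (p + x) (map ((+) p) w) \<longleftrightarrow> walk S x w"
  by (induction w arbitrary: x) auto

lemma reach_shift: assumes "reach S l x y" shows "reach S l (p + x) (p + y)"
proof -
  obtain w where w: "walk S x w" "length w \<le> l" "last (x # w) = y" using assms by (auto simp: reach_def)
  show ?thesis unfolding reach_def
    by (rule exI[of _ "map ((+) p) w"]) (use w in \<open>auto simp: walk_shift last_map\<close>)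
qed

fun walks_of_length :: "'a::ab_group_add set \<Rightarrow> nat \<Rightarrow> 'a \<Rightarrow> 'a list set" where
  "walks_of_length S 0 x = {[]}"
| "walks_of_length S (Suc l) x = (\<Union>h\<in>S. (\<lambda>w. (x + h) # w) ` walks_of_length S l (x + h))"

lemma walks_of_length: "walks_of_length S l x = {w. walk S x w \<and> length w = l}"
proof (induction l arbitrary: x)
  case (Suc l)
  show ?case
  proof (intro equalityI subsetI)
    fix w assume "w \<in> {w. walk S x w \<and> length w = Suc l}"
    then obtain y w' where w: "w = y # w'" "y - x \<in> S" "walk S y w'" "length w' = l"
      by (cases w) auto
    then show "w \<in> walks_of_length S (Suc l) x"
      by (auto simp: Suc.IH intro!: bexI[of _ "y - x"])
  qed (auto simp: Suc.IH)
qed auto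

lemma card_walks_of_length:
  assumes "finite S"
  shows "finite (walks_of_length S l x) \<and> card (walks_of_length S l x) \<le> card S ^ l"
proof (induction l arbitrary: x)
  case (Suc l)
  have "card (walks_of_length S (Suc l) x) \<le> (\<Sum>h\<in>S. card ((\<lambda>w. (x + h) # w) ` walks_of_length S l (x + h)))"
    using assms by (simp add: card_UN_le)
  also have "\<dots> \<le> (\<Sum>h\<in>S. card S ^ l)"
    using Suc.IH by (intro sum_mono) (meson card_image_le le_trans)
  finally show ?case using Suc.IH assms by auto
qed auto

lemma finite_reach: assumes "finite S" shows "finite {y. reach S l x y}"
proof -
  have "{y. reach S l x y} \<subseteq> (\<Union>k\<le>l. (\<lambda>w. last (x # w)) ` walks_of_length S k x)"
    unfolding reach_def walks_of_length by auto
  then show ?thesis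
    by (rule finite_subset) (use card_walks_of_length[OF assms] in auto)
qed

text \<open>There are at most \<open>card S ^ l\<close> walks of length \<open>l\<close>, so a set of walks with weights exponential in
  the length costs a geometric series starting at its shortest length.\<close>
lemma sum_walks_le:
  assumes S: "finite S" and F: "finite F" "\<And>w. w \<in> F \<Longrightarrow> walk S x w \<and> l0 \<le> length w"
    and k: "0 \<le> k" "real (card S) * k \<le> \<eta>" "\<eta> \<le> 1 / 2"
  shows "(\<Sum>w\<in>F. k ^ length w) \<le> 2 * \<eta> ^ l0"
proof -
  define m where "m = l0 + Max (insert 0 (length ` F))"
  have eta: "0 \<le> \<eta>" using k(1) k(2) by (meson mult_nonneg_nonneg of_nat_0_le_iff order_trans)
  have len: "length w \<le> m" if "w \<in> F" for w
  proof -
    have "length w \<le> Max (insert 0 (length ` F))" using F(1) that by (intro Max_ge) auto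
    then show ?thesis by (simp add: m_def)
  qed
  have fin: "finite (walks_of_length S l x)" for l using card_walks_of_length[OF S] by auto
  have sub: "F \<subseteq> (\<Union>l\<in>{l0..m}. walks_of_length S l x)"
    using F(2) len by (auto simp: walks_of_length)
  have "(\<Sum>w\<in>F. k ^ length w) \<le> (\<Sum>w\<in>(\<Union>l\<in>{l0..m}. walks_of_length S l x). k ^ length w)"
    using sub fin k(1) by (intro sum_mono2) auto
  also have "\<dots> = (\<Sum>l\<in>{l0..m}. \<Sum>w\<in>walks_of_length S l x. k ^ length w)"
    using fin by (intro sum.UNION_disjoint) (auto simp: walks_of_length)
  also have "\<dots> \<le> (\<Sum>l\<in>{l0..m}. \<eta> ^ l)"
  proof (intro sum_mono)
    fix l
    have "(\<Sum>w\<in>walks_of_length S l x. k ^ length w) = real (card (walks_of_length S l x)) * k ^ l"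
      by (simp add: walks_of_length)
    also have "\<dots> \<le> real (card S ^ l) * k ^ l"
      using card_walks_of_length[OF S, of l x] k(1) by (intro mult_right_mono) (auto simp flip: of_nat_power)
    also have "\<dots> = (real (card S) * k) ^ l" by (simp add: power_mult_distrib)
    also have "\<dots> \<le> \<eta> ^ l" using k by (intro power_mono) auto
    finally show "(\<Sum>w\<in>walks_of_length S l x. k ^ length w) \<le> \<eta> ^ l" .
  qed
  also have "\<dots> \<le> 2 * \<eta> ^ l0"
  proof -
    have "(\<Sum>l\<in>{l0..m}. \<eta> ^ l) = \<eta> ^ l0 * (\<Sum>i\<le>m - l0. \<eta> ^ i)"
      by (simp add: sum_distrib_left flip: power_add)
         (rule sum.reindex_bij_witness[of _ "\<lambda>l. l + l0" "\<lambda>k. k - l0"]; auto simp: m_def)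
    moreover have "(\<Sum>i\<le>m - l0. \<eta> ^ i) \<le> 2"
      using k(3) eta by (subst sum_gp0) (auto simp: field_simps add_increasing2)
    ultimately show ?thesis
      by (metis eta mult.commute mult_left_mono zero_le_power)
  qed
  finally show ?thesis .
qed

section \<open>Elimination of sites\<close>

text \<open>The entry of \<open>I + \<Phi> * G\<close> for the hopping \<open>\<Phi>\<close>, with its factor of the coupling, and the Green
  function \<open>G\<close> of the sites in \<open>A\<close>: it collects all walks that start at \<open>x\<close>, whose further sites lie in \<open>A\<close>, and which end at \<open>c\<close>, each further site being weighted by
  its propagator. The head of the list is the site eliminated last. The two sums in the recursive
  equation are the effective hopping \<open>eff_hop\<close> defined next; they are spelled out because
  \<open>eff_hop\<close> is itself defined from \<open>walk_series\<close>.\<close>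
primrec walk_series ::
  "complex fps \<Rightarrow> ('a::ab_group_add \<Rightarrow> real) \<Rightarrow> ('a \<Rightarrow> complex) \<Rightarrow> 'a list \<Rightarrow> 'a \<Rightarrow> 'a \<Rightarrow> complex fps" where
  "walk_series L v h [] x c = of_bool (x = c)"
| "walk_series L v h (s # A) x c = walk_series L v h A x c +
     fps_X * (\<Sum>e\<in>insert x (set A). walk_series L v h A x e * fps_const (h (e - s))) *
     inverse (L - fps_const (of_real (v s)) -
       fps_X * (\<Sum>e\<in>insert s (set A). walk_series L v h A s e * fps_const (h (e - s)))) *
     walk_series L v h A s c"

text \<open>The Schur complement: hopping from \<open>x\<close> to \<open>y\<close> after the sites of \<open>A\<close> have been eliminated. Its
  diagonal entries are the self-energies.\<close>
definition eff_hop ::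
  "complex fps \<Rightarrow> ('a::ab_group_add \<Rightarrow> real) \<Rightarrow> ('a \<Rightarrow> complex) \<Rightarrow> 'a list \<Rightarrow> 'a \<Rightarrow> 'a \<Rightarrow> complex fps" where
  "eff_hop L v h A x y = fps_X * (\<Sum>e\<in>insert x (set A). walk_series L v h A x e * fps_const (h (e - y)))"

definition renorm_denom ::
  "complex fps \<Rightarrow> ('a::ab_group_add \<Rightarrow> real) \<Rightarrow> ('a \<Rightarrow> complex) \<Rightarrow> 'a list \<Rightarrow> 'a \<Rightarrow> complex fps" where
  "renorm_denom L v h A s = L - fps_const (of_real (v s)) - eff_hop L v h A s s"

lemma walk_series_Cons:
  "walk_series L v h (s # A) x c = walk_series L v h A x c +
     eff_hop L v h A x s * inverse (renorm_denom L v h A s) * walk_series L v h A s c"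
  by (simp add: eff_hop_def renorm_denom_def)

declare walk_series.simps(2) [simp del]

lemma walk_series_outside: "c \<notin> set A \<Longrightarrow> walk_series L v h A x c = of_bool (x = c)"
  by (induction A arbitrary: x) (auto simp: walk_series_Cons)

lemma eff_hop_superset:
  assumes "finite F" "insert x (set A) \<subseteq> F"
  shows "eff_hop L v h A x y = fps_X * (\<Sum>e\<in>F. walk_series L v h A x e * fps_const (h (e - y)))"
  unfolding eff_hop_def
  by (rule arg_cong[where f = "\<lambda>z. fps_X * z"], rule sum.mono_neutral_left)
     (use assms in \<open>auto simp: walk_series_outside\<close>)

lemma eff_hop_Nil: "eff_hop L v h [] x y = fps_X * fps_const (h (x - y))"
  by (simp add: eff_hop_def)

text \<open>One step of Gaussian elimination.\<close>
lemma eff_hop_Cons: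
  "eff_hop L v h (s # A) x y = eff_hop L v h A x y +
     eff_hop L v h A x s * inverse (renorm_denom L v h A s) * eff_hop L v h A s y"
proof -
  let ?F = "insert x (set (s # A))"
  have "eff_hop L v h (s # A) x y =
      fps_X * (\<Sum>e\<in>?F. walk_series L v h (s # A) x e * fps_const (h (e - y)))"
    by (rule eff_hop_superset) auto
  also have "\<dots> = fps_X * (\<Sum>e\<in>?F. walk_series L v h A x e * fps_const (h (e - y))) +
      eff_hop L v h A x s * inverse (renorm_denom L v h A s) *
      (fps_X * (\<Sum>e\<in>?F. walk_series L v h A s e * fps_const (h (e - y))))"
    unfolding walk_series_Cons ring_distribs sum.distrib
    by (simp add: sum_distrib_left mult.assoc mult.left_commute del: sum.insert)
  also have "fps_X * (\<Sum>e\<in>?F. walk_series L v h A x e * fps_const (h (e - y))) = eff_hop L v h A x y"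
    by (rule eff_hop_superset[symmetric]) auto
  also have "fps_X * (\<Sum>e\<in>?F. walk_series L v h A s e * fps_const (h (e - y))) = eff_hop L v h A s y"
    by (rule eff_hop_superset[symmetric]) auto
  finally show ?thesis .
qed

lemma eff_hop_nth_0 [simp]: "eff_hop L v h A x y $ 0 = 0"
  by (simp add: eff_hop_def)

lemma renorm_denom_nth_0: "L $ 0 = 0 \<Longrightarrow> renorm_denom L v h A s $ 0 = - of_real (v s)"
  by (simp add: renorm_denom_def)

lemma renorm_denom_inverse:
  assumes "L $ 0 = 0" "v s \<noteq> 0"
  shows "inverse (renorm_denom L v h A s) * renorm_denom L v h A s = 1"
  using assms by (intro inverse_mult_eq_1) (simp add: renorm_denom_nth_0)

text \<open>The row equation of the resolvent on \<open>A\<close>. Together with its transpose it is all that is used of the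
  Green function: the factor \<open>L - v e\<close> undoes the bare propagator of the last site of a walk.\<close>
lemma walk_series_equation:
  assumes L: "L $ 0 = 0" and v: "\<And>s. s \<in> set A \<Longrightarrow> v s \<noteq> 0" and "distinct A" "e \<in> set A"
  shows "(walk_series L v h A x e - of_bool (x = e)) * (L - fps_const (of_real (v e))) = eff_hop L v h A x e"
  using v \<open>distinct A\<close> \<open>e \<in> set A\<close>
proof (induction A arbitrary: x)
  case (Cons s A)
  let ?K = "eff_hop L v h A" and ?i = "inverse (renorm_denom L v h A s)"
  show ?case
  proof (cases "e = s")
    case True
    have s: "s \<notin> set A" using Cons.prems by auto
    have "(walk_series L v h (s # A) x s - of_bool (x = s)) * (L - fps_const (of_real (v s))) =
        ?K x s * ?i * (renorm_denom L v h A s + ?K s s)"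
      using s by (simp add: walk_series_Cons walk_series_outside renorm_denom_def)
    also have "\<dots> = ?K x s * (?i * renorm_denom L v h A s) + ?K x s * ?i * ?K s s"
      by (simp add: algebra_simps)
    also have "?i * renorm_denom L v h A s = 1"
      using Cons.prems L by (intro renorm_denom_inverse) auto
    finally show ?thesis using True by (simp add: eff_hop_Cons)
  next
    case False
    then have e: "e \<in> set A" "s \<noteq> e" using Cons.prems by auto
    have IH: "(walk_series L v h A x e - of_bool (x = e)) * (L - fps_const (of_real (v e))) = ?K x e" for x
      using Cons.IH[of x] Cons.prems e by auto
    have "(walk_series L v h (s # A) x e - of_bool (x = e)) * (L - fps_const (of_real (v e))) =
       (walk_series L v h A x e - of_bool (x = e)) * (L - fps_const (of_real (v e))) +
       ?K x s * ?i * ((walk_series L v h A s e - of_bool (s = e)) * (L - fps_const (of_real (v e))))"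
      using e by (simp add: walk_series_Cons algebra_simps)
    then show ?thesis unfolding IH eff_hop_Cons .
  qed
qed auto

text \<open>Reflecting the hopping reverses walks. Column equations are thereby obtained from row equations of
  the reflected problem.\<close>
lemma eff_hop_transpose: "eff_hop L v (\<lambda>n. h (- n)) A x y = eff_hop L v h A y x"
proof (induction A arbitrary: x y)
  case (Cons s A)
  then show ?case by (simp add: eff_hop_Cons renorm_denom_def mult_ac)
qed (simp add: eff_hop_Nil)

lemma fps_mult_nonzero_nth:
  assumes "(a * b) $ i \<noteq> (0::'a::semiring_0)"
  obtains k where "k \<le> i" "a $ k \<noteq> 0" "b $ (i - k) \<noteq> 0"
  using assms unfolding fps_mult_nth
  by (metis (no_types, lifting) atLeastAtMost_iff mult_not_zero sum.neutral)

text \<open>Each hop carries one power of the coupling.\<close>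
lemma walk_series_reach:
  assumes S: "\<And>n. h n \<noteq> 0 \<Longrightarrow> - n \<in> S"
  shows "walk_series L v h A x c $ i \<noteq> 0 \<Longrightarrow> reach S i x c"
    and "eff_hop L v h A x c $ i \<noteq> 0 \<Longrightarrow> reach S i x c"
proof (induction A arbitrary: x c i)
  have eff: "reach S i x c" if T: "\<And>x c i. walk_series L v h A x c $ i \<noteq> 0 \<Longrightarrow> reach S i x c"
    and K: "eff_hop L v h A x c $ i \<noteq> 0" for A x c i
  proof -
    obtain i' where i: "i = Suc i'" using K by (cases i) auto
    have "(\<Sum>e\<in>insert x (set A). (walk_series L v h A x e * fps_const (h (e - c))) $ i') \<noteq> 0"
      using K unfolding eff_hop_def i by (simp add: fps_sum_nth)
    then obtain e where e: "walk_series L v h A x e $ i' * h (e - c) \<noteq> 0"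
      by (metis (no_types, lifting) fps_mult_right_const_nth sum.neutral)
    then have "reach S i' x e" "c - e \<in> S" using T[of x e i'] S[of "e - c"] by auto
    then show ?thesis using reach_trans[of S i' x e 1 c] reach_step[of c e S 0] i by auto
  qed
  {
    case Nil
    {
      case 1
      then show ?case by (cases "x = c") auto
    next
      case 2
      show ?case by (rule eff[OF _ 2]) (auto simp: of_bool_def split: if_splits)
    }
  next
    case (Cons s A)
    have T: "reach S i x c" if "walk_series L v h (s # A) x c $ i \<noteq> 0" for x c i
    proof (cases "walk_series L v h A x c $ i \<noteq> 0")
      case False
      then have "(eff_hop L v h A x s * (inverse (renorm_denom L v h A s) * walk_series L v h A s c)) $ i \<noteq> 0"
        using that by (simp add: walk_series_Cons mult.assoc)
      then obtain k where k: "k \<le> i" "eff_hop L v h A x s $ k \<noteq> 0"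
          "(inverse (renorm_denom L v h A s) * walk_series L v h A s c) $ (i - k) \<noteq> 0"
        by (rule fps_mult_nonzero_nth)
      obtain l where l: "l \<le> i - k" "walk_series L v h A s c $ (i - k - l) \<noteq> 0"
        using k(3) by (rule fps_mult_nonzero_nth)
      have "reach S (k + (i - k - l)) x c"
        using reach_trans[OF Cons.IH(2)[OF k(2)] Cons.IH(1)[OF l(2)]] .
      then show ?thesis by (rule reach_mono) (use k l in auto)
    qed (use Cons.IH(1) in auto)
    {
      case 1
      then show ?case by (rule T)
    next
      case 2
      show ?case by (rule eff[OF T 2])
    }
  }
qed

text \<open>A resolvent identity for two problems with different diagonals \<open>w\<close>, \<open>w'\<close> and different sets
  \<open>B \<subseteq> A\<close> of eliminated sites. It results from evaluating \<open>x * (L - w - h) * y\<close> in the two possible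
  orders: the difference of the self-energies comes from the change of diagonal on \<open>B\<close> and from walks
  of the larger problem that leave \<open>B\<close>.\<close>
lemma eliminated_difference:
  fixes x y w w' :: "'a::ab_group_add \<Rightarrow> complex fps"
  assumes fin: "finite A" "B \<subseteq> A"
    and x: "\<And>e. e \<in> A \<Longrightarrow> x e * (L - w e) = fps_X * (fps_const (h (- e)) + (\<Sum>c\<in>A. x c * fps_const (h (c - e))))"
    and y: "\<And>c. c \<in> B \<Longrightarrow> y c * (L - w' c) = fps_X * (fps_const (h c) + (\<Sum>e\<in>B. y e * fps_const (h (c - e))))"
  shows "fps_X * (\<Sum>e\<in>B. y e * fps_const (h (- e))) - fps_X * (\<Sum>c\<in>A. x c * fps_const (h c)) =
    (\<Sum>e\<in>B. x e * (w' e - w e) * y e) -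
    (\<Sum>c\<in>A - B. x c * (fps_X * (fps_const (h c) + (\<Sum>e\<in>B. y e * fps_const (h (c - e))))))"
proof -
  let ?b = "\<lambda>c. fps_X * (fps_const (h c) + (\<Sum>e\<in>B. y e * fps_const (h (c - e))))"
  have finB: "finite B" using fin finite_subset by blast
  have "fps_X * (\<Sum>e\<in>B. y e * fps_const (h (- e))) = (\<Sum>e\<in>B. fps_X * fps_const (h (- e)) * y e)"
    by (simp add: sum_distrib_left mult_ac)
  also have "\<dots> = (\<Sum>e\<in>B. x e * (L - w e) * y e) - (\<Sum>e\<in>B. \<Sum>c\<in>A. fps_X * (x c * fps_const (h (c - e))) * y e)"
    unfolding sum_subtractf[symmetric]
  proof (intro sum.cong refl)
    fix e assume "e \<in> B"
    then have "fps_X * fps_const (h (- e)) = x e * (L - w e) - (\<Sum>c\<in>A. fps_X * (x c * fps_const (h (c - e))))"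
      using x[of e] fin by (auto simp: distrib_left sum_distrib_left)
    then show "fps_X * fps_const (h (- e)) * y e =
        x e * (L - w e) * y e - (\<Sum>c\<in>A. fps_X * (x c * fps_const (h (c - e))) * y e)"
      by (simp add: left_diff_distrib sum_distrib_right)
  qed
  also have "(\<Sum>e\<in>B. \<Sum>c\<in>A. fps_X * (x c * fps_const (h (c - e))) * y e) =
      (\<Sum>c\<in>A. x c * (?b c - fps_X * fps_const (h c)))"
    by (subst sum.swap) (simp add: sum_distrib_left algebra_simps)
  also have "\<dots> = (\<Sum>c\<in>A. x c * ?b c) - fps_X * (\<Sum>c\<in>A. x c * fps_const (h c))"
    by (simp only: right_diff_distrib sum_subtractf) (simp add: sum_distrib_left mult_ac)
  also have "(\<Sum>c\<in>A. x c * ?b c) = (\<Sum>c\<in>A - B. x c * ?b c) + (\<Sum>c\<in>B. x c * ?b c)"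
    by (rule sum.subset_diff) (use fin in auto)
  also have "(\<Sum>c\<in>B. x c * ?b c) = (\<Sum>e\<in>B. x e * (y e * (L - w' e)))"
    by (intro sum.cong refl) (simp add: y)
  finally show ?thesis by (simp add: algebra_simps sum_subtractf)
qed

section \<open>Small denominators along reduced walks\<close>

text \<open>The walks produced by unfolding \<open>eff_hop_Cons\<close>: the site eliminated last is visited at most once,
  and the two remaining pieces are of the same kind over the other sites.\<close>
fun reduced_walks :: "'a list \<Rightarrow> 'a list set" where
  "reduced_walks [] = {[]}"
| "reduced_walks (s # A) = reduced_walks A \<union> (\<lambda>(u, w). u @ s # w) ` (reduced_walks A \<times> reduced_walks A)"

lemma finite_reduced_walks [simp]: "finite (reduced_walks A)"
  by (induction A) auto

lemma reduced_walks_subset: "w \<in> reduced_walks A \<Longrightarrow> set w \<subseteq> set A"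
  by (induction A arbitrary: w) fastforce+

lemma Nil_in_reduced_walks [simp]: "[] \<in> reduced_walks A"
  by (induction A) auto

lemma append_Cons_unique:
  assumes "s \<notin> set u" "s \<notin> set w" "s \<notin> set u'" "s \<notin> set w'" "u @ s # w = u' @ s # w'"
  shows "u = u' \<and> w = w'"
  using assms by (metis append_Cons_eq_iff)

text \<open>Between two visits to the same site there is a visit to a site at least as resonant. This is the
  only property of reduced walks that the counting of small denominators needs.\<close>
definition shielded :: "('a \<Rightarrow> real) \<Rightarrow> 'a list \<Rightarrow> bool" where
  "shielded v w \<longleftrightarrow> (\<forall>a q x b. w = a @ q # x @ q # b \<longrightarrow> (\<exists>y\<in>set x. \<bar>v y\<bar> \<le> \<bar>v q\<bar>))"

lemma shieldedD: "shielded v (a @ q # x @ q # b) \<Longrightarrow> \<exists>y\<in>set x. \<bar>v y\<bar> \<le> \<bar>v q\<bar>"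
  unfolding shielded_def by blast

lemma shielded_append_Cons: "shielded v (a @ q # b) \<Longrightarrow> shielded v (q # b)"
  unfolding shielded_def by (metis append.assoc append_Cons)

lemma shielded_Cons_new: 
  assumes "shielded v w" "p \<notin> set w" shows "shielded v (p # w)"
  unfolding shielded_def
proof (intro allI impI)
  fix a q x b assume eq: "p # w = a @ q # x @ q # b"
  then obtain a' where "a = p # a'" using assms(2) by (cases a) auto
  then have "w = a' @ q # x @ q # b" using eq by simp
  then show "\<exists>y\<in>set x. \<bar>v y\<bar> \<le> \<bar>v q\<bar>" using assms(1) shieldedD[of v a' q x b] by simp
qed

text \<open>A repetition inside one of the two pieces is shielded by induction; a repetition across the pieces
  is shielded by the site that joins them, which is the most resonant one.\<close>
lemma reduced_walks_shielded:
  assumes "sorted_wrt (\<lambda>x y. \<bar>v x\<bar> \<le> \<bar>v y\<bar>) A" "distinct A" "w \<in> reduced_walks A"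
  shows "shielded v w"
  using assms
proof (induction A arbitrary: w)
  case Nil
  then show ?case by (auto simp: shielded_def)
next
  case (Cons s A)
  show ?case
  proof (cases "w \<in> reduced_walks A")
    case True
    then show ?thesis using Cons by auto
  next
    case False
    then obtain u u' where w: "w = u @ s # u'" "u \<in> reduced_walks A" "u' \<in> reduced_walks A"
      using Cons.prems by auto
    have s: "s \<notin> set u" "s \<notin> set u'" using w reduced_walks_subset Cons.prems(2) by fastforce+
    have le: "\<bar>v s\<bar> \<le> \<bar>v q\<bar>" if "q \<in> set u \<union> set u'" for q
      using that w reduced_walks_subset Cons.prems(1) by fastforce
    show ?thesis unfolding shielded_def
    proof (intro allI impI)
      fix a q x b assume eq: "w = a @ q # x @ q # b"
      have cnt: "q \<noteq> s"
      proof
        assume "q = s"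
        then have "count_list w s \<ge> 2" using eq by simp
        moreover have "count_list w s = 1" using w s by (simp add: count_notin)
        ultimately show False by simp
      qed
      have ex: "u @ s # u' = a @ q # x @ q # b" using w eq by simp
      consider (l) c where "u = a @ q # x @ q # c" | (r) c where "u' = c @ q # x @ q # b" | (m) "s \<in> set x"
        using ex cnt by (auto simp: append_eq_append_conv2 append_eq_Cons_conv Cons_eq_append_conv)
      then show "\<exists>y\<in>set x. \<bar>v y\<bar> \<le> \<bar>v q\<bar>"
      proof cases
        case l
        have "shielded v u" using Cons w by auto
        then show ?thesis using l shieldedD[of v a q x c] by simp
      next
        case r
        have "shielded v u'" using Cons w by auto
        then show ?thesis using r shieldedD[of v c q x b] by simp
      next
        case m
        have "q \<in> set (u @ s # u')" unfolding ex by simp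
        then have "q \<in> set u \<union> set u'" using cnt by auto
        then show ?thesis using m le by blast
      qed
    qed
  qed
qed

text \<open>The form in which the Diophantine condition enters: two distinct sites that are both resonant are far
  apart in the hopping distance.\<close>
definition gap_condition :: "'a::ab_group_add set \<Rightarrow> ('a \<Rightarrow> real) \<Rightarrow> real \<Rightarrow> real \<Rightarrow> bool" where
  "gap_condition S v c \<tau> \<longleftrightarrow>
     (\<forall>l m n. reach S l m n \<longrightarrow> m \<noteq> n \<longrightarrow> c * real l powr (- \<tau>) \<le> max \<bar>v m\<bar> \<bar>v n\<bar>)"

text \<open>The first visit to the set \<open>\<bar>v\<bar> \<le> \<delta>\<close> after \<open>p\<close> is at a site other than \<open>p\<close>, because a return to \<open>p\<close>
  would be shielded by an even earlier visit. So it costs the length of a gap, and the argument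
  repeats from the visited site.\<close>
lemma resonant_visits_le:
  assumes gap: "gap_condition S v c \<tau>" and c: "c > 0" and t: "\<tau> > 0"
    and "shielded v (p # w)" "walk S p w" "\<bar>v p\<bar> \<le> \<delta>" 
  shows "real (length (filter (\<lambda>q. \<bar>v q\<bar> \<le> \<delta>) w)) * (c / \<delta>) powr (1 / \<tau>) \<le> real (length w)"
  using assms(4-)
proof (induction "length w" arbitrary: p w rule: less_induct)
  case less
  let ?R = "\<lambda>q. \<bar>v q\<bar> \<le> \<delta>"
  show ?case
  proof (cases "\<exists>q\<in>set w. ?R q")
    case False
    then have "filter ?R w = []" by (auto simp: filter_empty_conv)
    then show ?thesis by simp
  next
    case True
    then obtain u q w' where w: "w = u @ q # w'" "?R q" "\<forall>y\<in>set u. \<not> ?R y"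
      using split_list_first_prop[OF True] by blast
    have "p \<noteq> q"
    proof
      assume "p = q"
      then have "\<exists>y\<in>set u. \<bar>v y\<bar> \<le> \<bar>v q\<bar>"
        using less.prems(1) w(1) shieldedD[of v "[]" q u w'] by simp
      then show False using w by force
    qed
    have walks: "walk S p (u @ [q])" "walk S q w'" using less.prems(2) w(1) walk_append[of S p u q w'] by simp_all
    moreover have "length (u @ [q]) \<le> Suc (length u)" "last (p # u @ [q]) = q" by auto
    ultimately have "reach S (Suc (length u)) p q"
      unfolding reach_def by blast
    then have "c * real (Suc (length u)) powr (- \<tau>) \<le> max \<bar>v p\<bar> \<bar>v q\<bar>"
      using gap \<open>p \<noteq> q\<close> unfolding gap_condition_def by blast
    then have le: "c * real (Suc (length u)) powr (- \<tau>) \<le> \<delta>" using w(2) less.prems(3) by auto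
    moreover have "0 < c * real (Suc (length u)) powr (- \<tau>)" using c by simp
    ultimately have d: "0 < \<delta>" by linarith
    have "c / \<delta> \<le> real (Suc (length u)) powr \<tau>"
      using le d by (simp add: powr_minus field_simps)
    then have "(c / \<delta>) powr (1 / \<tau>) \<le> (real (Suc (length u)) powr \<tau>) powr (1 / \<tau>)"
      using c d t by (intro powr_mono2) auto
    then have 1: "(c / \<delta>) powr (1 / \<tau>) \<le> real (Suc (length u))" using t by (simp add: powr_powr)
    have "shielded v (q # w')" using less.prems(1) w(1) shielded_append_Cons[of v "p # u" q w'] by simp
    then have 2: "real (length (filter ?R w')) * (c / \<delta>) powr (1 / \<tau>) \<le> real (length w')"
      using less.hyps[of w' q] w walks by simp
    have "filter ?R w = q # filter ?R w'" using w by (auto simp: filter_empty_conv)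
    then show ?thesis using 1 2 w(1) by (simp add: algebra_simps)
  qed
qed

text \<open>The exponent is the sum over \<open>m\<close> of the densities \<open>(c * 2 ^ m) powr (- 1 / \<tau>)\<close> of visits to the sets
  \<open>\<bar>v\<bar> \<le> 2 ^ (- m)\<close>.\<close>
definition brjuno_const :: "real \<Rightarrow> real \<Rightarrow> real" where
  "brjuno_const c \<tau> = 2 powr (c powr (- 1 / \<tau>) / (1 - 2 powr (- 1 / \<tau>)))"

lemma two_powr_neg_less_1: "\<tau> > 0 \<Longrightarrow> 2 powr (- 1 / \<tau>) < (1::real)"
  using powr_less_mono[of "- 1 / \<tau>" 0 2] by simp

lemma brjuno_const_ge_1: "\<tau> > 0 \<Longrightarrow> 1 \<le> brjuno_const c \<tau>"
  unfolding brjuno_const_def using two_powr_neg_less_1[of \<tau>]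
  by (intro ge_one_powr_ge_zero divide_nonneg_nonneg) auto

text \<open>A Siegel-Brjuno estimate. A factor \<open>1 / \<bar>v q\<bar>\<close> is at most \<open>2\<close> to the number of dyadic levels at which \<open>q\<close>
  is resonant, so the product is \<open>2\<close> to the number of visits counted over all levels. The base point
  is at least as resonant as every site of the walk, so the count starts at every relevant level with a
  full gap and produces no boundary term.\<close>
lemma small_denominators_product:
  assumes gap: "gap_condition S v c \<tau>" and c: "c > 0" and t: "\<tau> > 0"
    and w: "walk S p w" "shielded v w" and p: "\<And>q. q \<in> set w \<Longrightarrow> q \<noteq> p \<and> v q \<noteq> 0 \<and> \<bar>v p\<bar> \<le> \<bar>v q\<bar>"
  shows "prod_list (map (\<lambda>q. max 1 (1 / \<bar>v q\<bar>)) w) \<le> brjuno_const c \<tau> ^ length w"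
proof -
  let ?levels = "\<lambda>q. {m. \<bar>v q\<bar> \<le> (1/2) ^ m}" and ?visits = "\<lambda>m. filter (\<lambda>q. \<bar>v q\<bar> \<le> (1/2) ^ m)"
  define n where "n q = card (?levels q)" for q
  have fin: "finite (?levels q)" if "v q \<noteq> 0" for q
  proof -
    obtain m0 where m0: "(1/2) ^ m0 < \<bar>v q\<bar>" 
      using real_arch_pow_inv[of "\<bar>v q\<bar>" "1/2"] \<open>v q \<noteq> 0\<close> by auto
    have "(?levels q) \<subseteq> {..m0}"
    proof
      fix m assume "m \<in> (?levels q)"
      then have "(1/2::real) ^ m0 < (1/2) ^ m" using m0 less_le_trans by blast
      then have "\<not> m0 \<le> m"
        using power_decreasing[of m0 m "1/2::real"] by auto
      then show "m \<in> {..m0}" by simp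
    qed
    then show ?thesis by (rule finite_subset) simp
  qed
  have u: "max 1 (1 / \<bar>v q\<bar>) \<le> 2 ^ n q" if "v q \<noteq> 0" for q
  proof -
    have "n q \<notin> (?levels q)"
    proof
      assume "n q \<in> (?levels q)"
      then have "\<bar>v q\<bar> \<le> (1/2) ^ m" if "m \<le> n q" for m
        using order_trans[OF _ power_decreasing[OF that, of "1/2::real"]] by auto
      then have "{..n q} \<subseteq> (?levels q)" by auto
      then have "card {..n q} \<le> n q" unfolding n_def using fin[OF that] by (intro card_mono) auto
      then show False by simp
    qed
    then have "(1/2) ^ n q < \<bar>v q\<bar>" by simp
    then have "1 / \<bar>v q\<bar> \<le> 2 ^ n q" using that by (simp add: field_simps power_divide)
    then show ?thesis by simp
  qed
  \<comment> \<open>All levels above m1 are void for the finitely many sites of w.\<close>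
  define m1 where "m1 = Max (\<Union>q\<in>set w. insert 0 (?levels q))"
  have n_eq: "n q = (\<Sum>m\<le>m1. of_bool (\<bar>v q\<bar> \<le> (1/2) ^ m))" if q: "q \<in> set w" for q
  proof -
    have "(?levels q) \<subseteq> {..m1}"
      using q fin p unfolding m1_def by (auto intro!: Max_ge)
    then have "(?levels q) = {m\<in>{..m1}. \<bar>v q\<bar> \<le> (1/2) ^ m}" by auto
    then show ?thesis unfolding n_def by (simp add: sum.If_cases of_bool_def Int_def)
  qed
  have pw: "p \<notin> set w" using p by blast
  have cnt: "real (length (?visits m w)) \<le>
      real (length w) * c powr (- 1 / \<tau>) * (2 powr (- 1 / \<tau>)) ^ m" for m
  proof (cases "\<bar>v p\<bar> \<le> (1/2) ^ m")
    case True
    have "real (length (?visits m w)) * (c / (1/2) ^ m) powr (1 / \<tau>) \<le> real (length w)"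
      by (rule resonant_visits_le[OF gap c t shielded_Cons_new[OF w(2) pw] w(1) True])
    also have "c / (1/2) ^ m = c * 2 powr real m" by (simp add: powr_realpow power_divide)
    also have "(c * 2 powr real m) powr (1 / \<tau>) = c powr (1 / \<tau>) * (2 powr (1 / \<tau>)) ^ m"
      using c by (simp add: powr_mult powr_powr flip: powr_power) (simp add: powr_powr powr_realpow[symmetric] mult.commute)
    finally show ?thesis
      using c by (simp add: powr_minus power_inverse field_simps)
  next
    case False
    then have "?visits m w = []" using p by (force simp: filter_empty_conv)
    then show ?thesis using c by simp
  qed
  let ?b = "2 powr (- 1 / \<tau>) :: real"
  have b: "0 \<le> ?b" "?b < 1" using two_powr_neg_less_1[OF t] by auto
  have "prod_list (map (\<lambda>q. max 1 (1 / \<bar>v q\<bar>)) w) \<le> prod_list (map (\<lambda>q. 2 ^ n q) w)"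
    using p u
  proof (induction w)
    case (Cons q w)
    then show ?case by (auto intro!: mult_mono prod_list_nonneg)
  qed auto
  also have "\<dots> = 2 ^ sum_list (map n w)" by (induction w) (auto simp: power_add)
  also have "\<dots> = 2 powr real (sum_list (map n w))" by (simp add: powr_realpow)
  also have "\<dots> \<le> 2 powr (real (length w) * (c powr (- 1 / \<tau>) / (1 - ?b)))"
  proof (rule powr_mono)
    have "sum_list (map n w) = sum_list (map (\<lambda>q. \<Sum>m\<le>m1. of_bool (\<bar>v q\<bar> \<le> (1/2) ^ m)) w)"
      using n_eq by (intro arg_cong[where f = sum_list] map_cong) auto
    also have "\<dots> = (\<Sum>m\<le>m1. length (?visits m w))"
    proof (induction w)
      case (Cons a w)
      have "length (?visits m (a # w)) =
          of_bool (\<bar>v a\<bar> \<le> (1/2) ^ m) + length (?visits m w)" for m by simp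
      then show ?case by (simp only: list.map sum_list.Cons Cons.IH sum.distrib)
    qed simp
    finally have "real (sum_list (map n w)) = (\<Sum>m\<le>m1. real (length (?visits m w)))"
      by simp
    also have "\<dots> \<le> (\<Sum>m\<le>m1. real (length w) * c powr (- 1 / \<tau>) * ?b ^ m)"
      by (intro sum_mono cnt)
    also have "\<dots> = real (length w) * c powr (- 1 / \<tau>) * (\<Sum>m\<le>m1. ?b ^ m)"
      by (simp add: sum_distrib_left)
    also have "\<dots> \<le> real (length w) * c powr (- 1 / \<tau>) * (1 / (1 - ?b))"
    proof (intro mult_left_mono)
      show "(\<Sum>m\<le>m1. ?b ^ m) \<le> 1 / (1 - ?b)"
        using b by (subst sum_gp0) (auto intro!: divide_right_mono)
    qed simp
    finally show "real (sum_list (map n w)) \<le> real (length w) * (c powr (- 1 / \<tau>) / (1 - ?b))" by simp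
  qed simp
  also have "\<dots> = brjuno_const c \<tau> ^ length w"
    unfolding brjuno_const_def
    by (subst powr_realpow[symmetric]) (simp_all add: powr_powr mult.commute)
  finally show ?thesis .
qed

section \<open>Majorants by walks\<close>

text \<open>The factor \<open>2\<close> is what renormalisation may cost in each propagator.\<close>
definition walk_weight :: "('a \<Rightarrow> real) \<Rightarrow> real \<Rightarrow> 'a list \<Rightarrow> real" where
  "walk_weight v \<rho> w = prod_list (map (\<lambda>q. 2 * \<rho> / \<bar>v q\<bar>) w)"

lemma walk_weight_simps [simp]:
  "walk_weight v \<rho> [] = 1"
  "walk_weight v \<rho> (q # w) = 2 * \<rho> / \<bar>v q\<bar> * walk_weight v \<rho> w"
  "walk_weight v \<rho> (u @ w) = walk_weight v \<rho> u * walk_weight v \<rho> w"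
  by (simp_all add: walk_weight_def)

lemma walk_weight_nonneg: "0 \<le> \<rho> \<Longrightarrow> 0 \<le> walk_weight v \<rho> w"
  by (induction w) auto

definition walks_to :: "'a::ab_group_add set \<Rightarrow> 'a list \<Rightarrow> 'a \<Rightarrow> 'a set \<Rightarrow> 'a list set" where
  "walks_to S A x E = {w \<in> reduced_walks A. walk S x w \<and> last (x # w) \<in> E}"

lemma finite_walks_to [simp]: "finite (walks_to S A x E)"
  by (simp add: walks_to_def)

lemma sum_walks_to:
  "finite E \<Longrightarrow> (\<Sum>e\<in>E. \<Sum>w\<in>walks_to S A x {e}. f w) = (\<Sum>w\<in>walks_to S A x E. f w)"
  by (subst sum.group[of "walks_to S A x E" E "\<lambda>w. last (x # w)" f, symmetric])
     (auto simp: walks_to_def intro!: sum.cong)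

lemma walk_snoc: "walk S x (w @ [y]) \<longleftrightarrow> walk S x w \<and> y - last (x # w) \<in> S"
  by (simp add: walk_append2)

lemma eff_hop_majorant:
  assumes r: "0 \<le> r" and h: "\<And>n. h n \<noteq> 0 \<Longrightarrow> - n \<in> S" "\<And>n. cmod (h n) \<le> M"
    and T: "\<And>c. trunc_norm i r (walk_series L v h A x c) \<le> (\<Sum>w\<in>walks_to S A x {c}. walk_weight v \<rho> w)"
    and rho: "\<rho> = r * M"
  shows "trunc_norm i r (eff_hop L v h A x y) \<le> \<rho> * (\<Sum>w\<in>walks_to S A x {e. y - e \<in> S}. walk_weight v \<rho> w)"
proof -
  let ?G = "\<lambda>e. \<Sum>w\<in>walks_to S A x {e}. walk_weight v \<rho> w"
  let ?E = "insert x (set A)"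
  have M: "0 \<le> M" using h(2)[of 0] norm_ge_zero order_trans by blast
  have rho0: "0 \<le> \<rho>" using rho r M by simp
  have G: "0 \<le> ?G e" for e using walk_weight_nonneg[OF rho0] by (intro sum_nonneg)
  have "trunc_norm i r (eff_hop L v h A x y) \<le>
      r * (\<Sum>e\<in>?E. trunc_norm i r (walk_series L v h A x e * fps_const (h (e - y))))"
    unfolding eff_hop_def
    by (rule order_trans[OF trunc_norm_X_mult[OF r] mult_left_mono[OF trunc_norm_sum[OF r] r]])
  also have "\<dots> \<le> r * (\<Sum>e\<in>?E. if y - e \<in> S then M * ?G e else 0)"
  proof (intro mult_left_mono sum_mono r)
    fix e assume "e \<in> ?E"
    have "trunc_norm i r (walk_series L v h A x e * fps_const (h (e - y))) =
        cmod (h (e - y)) * trunc_norm i r (walk_series L v h A x e)"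
      by (metis mult.commute trunc_norm_const_mult)
    also have "\<dots> \<le> (if y - e \<in> S then M * ?G e else 0)"
    proof (cases "y - e \<in> S")
      case True
      then show ?thesis
        using h(2)[of "e - y"] T[of e] M G[of e] trunc_norm_nonneg[OF r] by (auto intro!: mult_mono)
    next
      case False
      then have "h (e - y) = 0" using h(1)[of "e - y"] by auto
      then show ?thesis using False by simp
    qed
    finally show "trunc_norm i r (walk_series L v h A x e * fps_const (h (e - y))) \<le>
        (if y - e \<in> S then M * ?G e else 0)" .
  qed
  also have "\<dots> = \<rho> * (\<Sum>e\<in>{e\<in>?E. y - e \<in> S}. ?G e)"
    by (simp add: rho sum_distrib_left mult.assoc sum.If_cases Int_def conj_commute del: sum.insert)
  also have "(\<Sum>e\<in>{e\<in>?E. y - e \<in> S}. ?G e) = (\<Sum>w\<in>walks_to S A x {e\<in>?E. y - e \<in> S}. walk_weight v \<rho> w)"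
    by (rule sum_walks_to) simp
  also have "\<dots> \<le> (\<Sum>w\<in>walks_to S A x {e. y - e \<in> S}. walk_weight v \<rho> w)"
    by (intro sum_mono2 walk_weight_nonneg rho0) (auto simp: walks_to_def)
  finally show ?thesis using rho0 by (simp add: mult_left_mono)
qed

text \<open>The coefficients of the walk series are dominated by a sum over reduced walks, provided the
  renormalised denominators are controlled up to the order still available when they are reached: a
  walk that needs \<open>t\<close> hops from the base \<open>p\<close> to \<open>s\<close> leaves only order \<open>j - t\<close> for the propagator at \<open>s\<close>.\<close>
lemma walk_series_majorant:
  assumes r: "0 \<le> r" and h: "\<And>n. h n \<noteq> 0 \<Longrightarrow> - n \<in> S" "\<And>n. cmod (h n) \<le> M"
    and rho: "\<rho> = r * M" and "distinct A"
    and "\<And>pre s B t i. A = pre @ s # B \<Longrightarrow> reach S t p s \<Longrightarrow> t + i \<le> j \<Longrightarrow>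
        trunc_norm i r (inverse (renorm_denom L v h B s)) \<le> 2 / \<bar>v s\<bar>"
    and "reach S t p x" "t + i \<le> j"
  shows "trunc_norm i r (walk_series L v h A x c) \<le> (\<Sum>w\<in>walks_to S A x {c}. walk_weight v \<rho> w)"
  using assms(5-)
proof (induction A arbitrary: t i x c)
  case Nil
  then show ?case by (auto simp: trunc_norm_of_bool walks_to_def Collect_conv_if cong: conj_cong)
next
  case (Cons s A)
  have M: "0 \<le> M" using h(2)[of 0] norm_ge_zero order_trans by blast
  have rho0: "0 \<le> \<rho>" using rho r M by simp
  note nonneg = walk_weight_nonneg[OF rho0]
  have den: "trunc_norm i r (inverse (renorm_denom L v h A s)) \<le> 2 / \<bar>v s\<bar>"
    if "reach S t p s" "t + i \<le> j" for t i using Cons.prems(2)[of "[]" s A] that by simp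
  have IH: "trunc_norm i r (walk_series L v h A x c) \<le> (\<Sum>w\<in>walks_to S A x {c}. walk_weight v \<rho> w)"
    if "reach S t p x" "t + i \<le> j" for t i x c
  proof (rule Cons.IH)
    show "distinct A" using Cons.prems by simp
    show "trunc_norm i r (inverse (renorm_denom L v h B s')) \<le> 2 / \<bar>v s'\<bar>"
      if "A = pre @ s' # B" "reach S t p s'" "t + i \<le> j" for pre s' B t i
      using Cons.prems(2)[of "s # pre" s' B t i] that by simp
  qed fact+
  let ?W = "\<lambda>x E. \<Sum>w\<in>walks_to S A x E. walk_weight v \<rho> w"
  let ?E = "{e. s - e \<in> S}"
  let ?PQ = "walks_to S A x ?E \<times> walks_to S A s {c}"
  let ?J = "(\<lambda>(u, w). u @ s # w) ` ?PQ"
  have K: "trunc_norm i r (eff_hop L v h A x s) \<le> \<rho> * ?W x ?E"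
    by (rule eff_hop_majorant[OF r h IH[OF Cons.prems(3,4)] rho])
  have "trunc_norm i r (walk_series L v h (s # A) x c) \<le> trunc_norm i r (walk_series L v h A x c) +
      trunc_norm i r (eff_hop L v h A x s * (inverse (renorm_denom L v h A s) * walk_series L v h A s c))"
    unfolding walk_series_Cons mult.assoc by (rule trunc_norm_add[OF r])
  also have "\<dots> \<le> ?W x {c} + trunc_norm i r (eff_hop L v h A x s) * (2 / \<bar>v s\<bar> * ?W s {c})"
  proof (intro add_mono IH[OF Cons.prems(3,4)] trunc_norm_mult_le[OF r])
    fix k assume k: "k \<le> i" "eff_hop L v h A x s $ k \<noteq> 0"
    then have "reach S k x s" using walk_series_reach(2)[of h S] h(1) by blast
    then have ps: "reach S (t + k) p s" using Cons.prems(3) reach_trans by blast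
    have "t + k + (i - k) \<le> j" using k Cons.prems(4) by simp
    note b = den[OF ps this] IH[OF ps this, of c]
    have "trunc_norm (i - k) r (inverse (renorm_denom L v h A s) * walk_series L v h A s c) \<le>
        trunc_norm (i - k) r (inverse (renorm_denom L v h A s)) * trunc_norm (i - k) r (walk_series L v h A s c)"
      by (rule trunc_norm_mult[OF r])
    also have "\<dots> \<le> 2 / \<bar>v s\<bar> * ?W s {c}"
      using b trunc_norm_nonneg[OF r] by (intro mult_mono) auto
    finally show "trunc_norm (i - k) r (inverse (renorm_denom L v h A s) * walk_series L v h A s c) \<le>
        2 / \<bar>v s\<bar> * ?W s {c}" .
  qed
  also have "\<dots> \<le> ?W x {c} + \<rho> * ?W x ?E * (2 / \<bar>v s\<bar> * ?W s {c})"
    using K nonneg by (intro add_left_mono mult_right_mono mult_nonneg_nonneg sum_nonneg) auto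
  also have "\<rho> * ?W x ?E * (2 / \<bar>v s\<bar> * ?W s {c}) =
      (\<Sum>(u, w)\<in>?PQ. walk_weight v \<rho> (u @ s # w))"
    unfolding sum.cartesian_product[symmetric]
    by (simp add: sum_distrib_left sum_distrib_right mult_ac) (subst sum.swap, simp add: mult_ac)
  also have "\<dots> = (\<Sum>w\<in>?J. walk_weight v \<rho> w)"
  proof (subst sum.reindex)
    have notin: "s \<notin> set w" if "w \<in> walks_to S A y E" for w y E
      using that reduced_walks_subset[of w A] Cons.prems(1) by (auto simp: walks_to_def)
    show "inj_on (\<lambda>(u, w). u @ s # w) (?PQ)"
    proof (rule inj_onI, clarify)
      fix u w u' w'
      assume "u \<in> walks_to S A x ?E" "w \<in> walks_to S A s {c}" "u' \<in> walks_to S A x ?E" "w' \<in> walks_to S A s {c}"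
        and "u @ s # w = u' @ s # w'"
      then show "u = u' \<and> w = w'" using notin by (intro append_Cons_unique) auto
    qed
  qed (simp add: case_prod_beta)
  also have "?W x {c} + \<dots> = (\<Sum>w\<in>walks_to S A x {c} \<union>
      ?J. walk_weight v \<rho> w)"
  proof (rule sum.union_disjoint[symmetric])
    have "s \<notin> set w" if "w \<in> walks_to S A x {c}" for w
      using that reduced_walks_subset[of w A] Cons.prems(1) by (auto simp: walks_to_def)
    then show "walks_to S A x {c} \<inter> ?J = {}"
      by fastforce
  qed auto
  also have "\<dots> \<le> (\<Sum>w\<in>walks_to S (s # A) x {c}. walk_weight v \<rho> w)"
  proof (intro sum_mono2 nonneg)
    show "walks_to S A x {c} \<union> ?J \<subseteq>
        walks_to S (s # A) x {c}"
    proof -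
      have "u @ s # w \<in> walks_to S (s # A) x {c}"
        if u: "u \<in> walks_to S A x ?E" and w: "w \<in> walks_to S A s {c}" for u w
      proof -
        have "walk S x (u @ s # w)"
          using u w walk_append[of S x u s w] walk_snoc[of S x u s] unfolding walks_to_def by blast
        moreover have "u @ s # w \<in> reduced_walks (s # A)"
          using u w by (auto simp: walks_to_def)
        moreover have "last (x # u @ s # w) = c" using w by (simp add: walks_to_def)
        ultimately show ?thesis unfolding walks_to_def by simp
      qed
      then show ?thesis by (auto simp: walks_to_def)
    qed
  qed simp
  finally show ?case .
qed

text \<open>In a saturated list every site near \<open>p\<close> that is less resonant than \<open>p\<close> has been eliminated, in the right
  order, and no site more resonant than \<open>p\<close> has. Sites of equal resonance may be present or absent, so
  ties need no rule. Restricting the demand to the ball of radius \<open>j\<close> keeps the lists finite while the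
  self-energy at \<open>p\<close> is unaffected up to order \<open>j\<close>.\<close>
definition saturated :: "'a::ab_group_add set \<Rightarrow> ('a \<Rightarrow> real) \<Rightarrow> nat \<Rightarrow> 'a \<Rightarrow> 'a list \<Rightarrow> bool" where
  "saturated S v j p A \<longleftrightarrow>
     sorted_wrt (\<lambda>x y. \<bar>v x\<bar> \<le> \<bar>v y\<bar>) A \<and> distinct A \<and> p \<notin> set A \<and> (\<forall>x\<in>set A. \<bar>v p\<bar> \<le> \<bar>v x\<bar>) \<and>
     (\<forall>x. reach S j p x \<longrightarrow> \<bar>v p\<bar> < \<bar>v x\<bar> \<longrightarrow> x \<in> set A)"

text \<open>This drives the induction on the order: at the moment \<open>s\<close> is eliminated, the sites eliminated
  before form a saturated list for \<open>s\<close>, with the radius reduced by the distance from \<open>p\<close>.\<close>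
lemma saturated_suffix:
  assumes "saturated S v j p (pre @ s # B)" "reach S t p s" "t + i \<le> j"
  shows "saturated S v i s B"
  unfolding saturated_def
proof (intro conjI allI impI)
  fix y assume y: "reach S i s y" "\<bar>v s\<bar> < \<bar>v y\<bar>"
  have "reach S j p y" using reach_trans[OF assms(2) y(1)] reach_mono assms(3) by blast
  moreover have "\<bar>v p\<bar> < \<bar>v y\<bar>" using assms(1) y(2) by (auto simp: saturated_def)
  ultimately have "y \<in> set (pre @ s # B)" using assms(1) unfolding saturated_def by blast
  moreover have "\<bar>v y\<bar> \<le> \<bar>v s\<bar>" if "y \<in> set pre"
    using assms(1) that by (auto simp: saturated_def sorted_wrt_append)
  ultimately show "y \<in> set B" using y(2) by auto
qed (use assms(1) in \<open>auto simp: saturated_def sorted_wrt_append\<close>)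

lemma ex_sorted_list:
  fixes v :: "'a \<Rightarrow> real"
  assumes "finite F"
  obtains A where "set A = F" "distinct A" "sorted_wrt (\<lambda>x y. \<bar>v x\<bar> \<le> \<bar>v y\<bar>) A"
proof -
  obtain xs where xs: "set xs = F" "distinct xs" using finite_distinct_list[OF assms] by blast
  show ?thesis
  proof (rule that[of "sort_key (\<lambda>x. \<bar>v x\<bar>) xs"])
    show "sorted_wrt (\<lambda>x y. \<bar>v x\<bar> \<le> \<bar>v y\<bar>) (sort_key (\<lambda>x. \<bar>v x\<bar>) xs)"
      using sorted_sort_key[of "\<lambda>x. \<bar>v x\<bar>" xs] by (simp add: sorted_map)
  qed (use xs in auto)
qed

text \<open>The assumption \<open>shift\<close> expresses that the translation by a resonant site \<open>p\<close> changes the potential by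
  \<open>O(\<bar>v p\<bar>)\<close>. The two maxima compensate for the weights of the adjacent propagators: where the potential
  is large it is \<open>1 / v\<close> that varies slowly. The number \<open>\<eta>\<close> bounds the total weight per hop, and
  \<open>decay\<close> compares exponential with polynomial smallness.\<close>
locale resonance_estimates =
  fixes S :: "'a::ab_group_add set" and v :: "'a \<Rightarrow> real"
    and M c0 \<tau> C T r \<eta> :: real and L :: "complex fps"
  assumes finite_S: "finite S" and sym_S: "n \<in> S \<Longrightarrow> - n \<in> S"
    and v_0: "v 0 = 0" and v_nonzero: "n \<noteq> 0 \<Longrightarrow> v n \<noteq> 0"
    and M_nonneg: "0 \<le> M" and r_nonneg: "0 \<le> r" and c0_pos: "0 < c0" and tau_pos: "0 < \<tau>"
    and gap: "gap_condition S v c0 \<tau>"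
    and shift: "\<bar>v p\<bar> < 1 \<Longrightarrow> \<bar>v (p + e) - v e\<bar> \<le> C * \<bar>v p\<bar> * max 1 \<bar>v e\<bar> * max 1 \<bar>v (p + e)\<bar>"
    and C_nonneg: "0 \<le> C"
    and small: "(real (card S) + 1) * (2 * (r * M) * brjuno_const c0 \<tau>) \<le> \<eta>" "\<eta> \<le> 1 / 8" "16 * C * \<eta>\<^sup>2 \<le> 1"
    and decay: "\<And>l. l \<ge> 1 \<Longrightarrow> (1/2) ^ l \<le> T * real l powr (- \<tau>)" "16 * T * \<eta> \<le> c0"
    and L_0: "L $ 0 = 0"
begin

definition \<kappa> :: real where "\<kappa> = 2 * (r * M) * brjuno_const c0 \<tau>"

definition hops :: "('a \<Rightarrow> complex) \<Rightarrow> bool" where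
  "hops h \<longleftrightarrow> (\<forall>n. h n \<noteq> 0 \<longrightarrow> - n \<in> S) \<and> (\<forall>n. cmod (h n) \<le> M)"

definition denoms_controlled :: "('a \<Rightarrow> complex) \<Rightarrow> nat \<Rightarrow> bool" where
  "denoms_controlled h j \<longleftrightarrow>
     (\<forall>p A. p \<noteq> 0 \<longrightarrow> saturated S v j p A \<longrightarrow> trunc_norm j r (L - eff_hop L v h A p p) \<le> \<bar>v p\<bar> / 2)"

lemma rM_nonneg: "0 \<le> r * M"
  using r_nonneg M_nonneg by simp

lemma rM_le: "2 * (r * M) \<le> \<kappa>"
  unfolding \<kappa>_def using mult_left_mono[OF brjuno_const_ge_1[OF tau_pos, of c0], of "2 * (r * M)"] rM_nonneg by simp

lemma kappa_nonneg: "0 \<le> \<kappa>"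
  using rM_le rM_nonneg by linarith

lemma kappa_le: "real (card S) * \<kappa> \<le> \<eta>" "\<kappa> \<le> \<eta>" "0 \<le> \<eta>"
proof -
  have *: "real (card S) * \<kappa> + \<kappa> \<le> \<eta>" using small(1) by (simp add: \<kappa>_def algebra_simps)
  moreover have "0 \<le> real (card S) * \<kappa>" using kappa_nonneg by simp
  ultimately show "real (card S) * \<kappa> \<le> \<eta>" "\<kappa> \<le> \<eta>" "0 \<le> \<eta>" using kappa_nonneg by linarith+
qed

lemma hops_reflect: "hops h \<Longrightarrow> hops (\<lambda>n. h (- n))"
  unfolding hops_def using sym_S by force

lemma denoms_controlled_reflect: "denoms_controlled (\<lambda>n. h (- n)) j \<longleftrightarrow> denoms_controlled h j"
  by (simp add: denoms_controlled_def eff_hop_transpose)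

text \<open>The second estimate retains the small factor \<open>1 / \<bar>v\<bar>\<close> of the last site when the potential is large
  there; the comparison of self-energies spends it.\<close>
lemma walk_weight_le:
  assumes "saturated S v j p A" "0 \<notin> set A" "walk S p w" "w \<in> reduced_walks A"
  shows "walk_weight v (r * M) w \<le> \<kappa> ^ length w"
    and "w \<noteq> [] \<Longrightarrow> walk_weight v (r * M) w * max 1 \<bar>v (last w)\<bar> \<le> \<kappa> ^ length w"
proof -
  let ?u = "\<lambda>q. max 1 (1 / \<bar>v q\<bar>)"
  have sub: "set w \<subseteq> set A" by (rule reduced_walks_subset) fact
  have sh: "shielded v w" using assms by (intro reduced_walks_shielded) (auto simp: saturated_def)
  have prod: "prod_list (map ?u w) \<le> brjuno_const c0 \<tau> ^ length w"
  proof (rule small_denominators_product[OF gap c0_pos tau_pos assms(3) sh])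
    fix q assume "q \<in> set w"
    then have "q \<in> set A" using sub by auto
    then show "q \<noteq> p \<and> v q \<noteq> 0 \<and> \<bar>v p\<bar> \<le> \<bar>v q\<bar>"
      using assms(1,2) v_nonzero[of q] by (auto simp: saturated_def)
  qed
  have U: "(2 * (r * M)) ^ length w * prod_list (map ?u w) \<le> \<kappa> ^ length w"
    unfolding \<kappa>_def power_mult_distrib[of _ "brjuno_const c0 \<tau>"] using prod rM_nonneg by (intro mult_left_mono) auto
  have le: "walk_weight v (r * M) w \<le> (2 * (r * M)) ^ length w * prod_list (map ?u w)" for w
  proof (induction w)
    case (Cons q w)
    have "2 * (r * M) / \<bar>v q\<bar> * walk_weight v (r * M) w \<le>
        (2 * (r * M) * ?u q) * ((2 * (r * M)) ^ length w * prod_list (map ?u w))"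
    proof (rule mult_mono[OF _ Cons])
      show "2 * (r * M) / \<bar>v q\<bar> \<le> 2 * (r * M) * ?u q"
        using mult_left_mono[of "1 / \<bar>v q\<bar>" "?u q" "2 * (r * M)"] rM_nonneg by simp
    qed (use rM_nonneg walk_weight_nonneg[OF rM_nonneg] in auto)
    then show ?case by (simp add: mult_ac)
  qed auto
  show "walk_weight v (r * M) w \<le> \<kappa> ^ length w" using le[of w] U by linarith
  assume "w \<noteq> []"
  then obtain u q where w: "w = u @ [q]" by (metis rev_exhaust)
  then have "q \<noteq> 0" using sub assms(2) by auto
  then have q: "v q \<noteq> 0" by (rule v_nonzero)
  have "walk_weight v (r * M) w * max 1 \<bar>v (last w)\<bar> = walk_weight v (r * M) u * (2 * (r * M) * ?u q)"
    using q w by (auto simp: max_def field_simps)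
  also have "\<dots> \<le> (2 * (r * M)) ^ length u * prod_list (map ?u u) * (2 * (r * M) * ?u q)"
    using le[of u] rM_nonneg by (intro mult_right_mono) auto
  also have "\<dots> = (2 * (r * M)) ^ length w * prod_list (map ?u w)" using w by simp
  finally show "walk_weight v (r * M) w * max 1 \<bar>v (last w)\<bar> \<le> \<kappa> ^ length w" using U by linarith
qed

lemma sum_kappa_le:
  assumes "k = \<kappa> \<or> k = 2 * \<kappa>" "\<And>w. w \<in> F \<Longrightarrow> walk S x w \<and> l0 \<le> length w" "finite F"
  shows "(\<Sum>w\<in>F. k ^ length w) \<le> 2 * (k / \<kappa> * \<eta>) ^ l0"
proof (cases "\<kappa> = 0")
  case True
  have "(\<Sum>w\<in>F. 0 ^ length w) \<le> 2 * (0::real) ^ l0"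
    by (rule sum_walks_le[OF finite_S assms(3,2)]) auto
  then show ?thesis using True assms(1) by auto
next
  case False
  show ?thesis
    by (rule sum_walks_le[OF finite_S assms(3,2)])
       (use assms(1) kappa_le kappa_nonneg small(2) False in auto)
qed

lemma denominator_bound:
  assumes "denoms_controlled h i" "s \<noteq> 0" "saturated S v i s B"
  shows "trunc_norm i r (inverse (renorm_denom L v h B s)) \<le> 2 / \<bar>v s\<bar>"
proof -
  have "v s \<noteq> 0" using assms v_nonzero by auto
  have "(L - eff_hop L v h B s s - fps_const (of_real (v s))) * inverse (renorm_denom L v h B s) = 1"
    using renorm_denom_inverse[where L = L and v = v and s = s and h = h and A = B] L_0 \<open>v s \<noteq> 0\<close> by (simp add: renorm_denom_def mult.commute algebra_simps)
  from trunc_norm_inverse_le[OF r_nonneg _ _ this, of i] show ?thesis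
    using assms \<open>v s \<noteq> 0\<close> unfolding denoms_controlled_def by simp
qed

lemma walk_series_bound:
  assumes h: "hops h" and A: "saturated S v j p A" "0 \<notin> set A"
    and den: "\<And>i. i < j \<Longrightarrow> denoms_controlled h i"
  shows "trunc_norm j r (walk_series L v h A p c) \<le> (\<Sum>w\<in>walks_to S A p {c}. walk_weight v (r * M) w)"
proof (rule walk_series_majorant[OF r_nonneg, where t = 0 and p = p and j = j and M = M])
  fix pre s B t i assume *: "A = pre @ s # B" "reach S t p s" "t + i \<le> j"
  have "s \<noteq> p" "s \<noteq> 0" using A *(1) by (auto simp: saturated_def)
  then have "t \<noteq> 0" using *(2) by (metis reach_0)
  then have "i < j" using *(3) by simp
  show "trunc_norm i r (inverse (renorm_denom L v h B s)) \<le> 2 / \<bar>v s\<bar>"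
    using saturated_suffix[OF A(1)[unfolded *(1)] *(2,3)] den[OF \<open>i < j\<close>] \<open>s \<noteq> 0\<close> by (intro denominator_bound)
qed (use h A in \<open>auto simp: hops_def saturated_def\<close>)

lemma eff_hop_bound:
  assumes h: "hops h" and A: "saturated S v j p A" "0 \<notin> set A"
    and den: "\<And>i. i < j \<Longrightarrow> denoms_controlled h i"
  shows "trunc_norm j r (eff_hop L v h A p y) \<le> \<eta>"
proof -
  have "trunc_norm j r (eff_hop L v h A p y) \<le>
      r * M * (\<Sum>w\<in>walks_to S A p {e. y - e \<in> S}. walk_weight v (r * M) w)"
    by (rule eff_hop_majorant[OF r_nonneg _ _ walk_series_bound[OF assms]]) (use h in \<open>auto simp: hops_def\<close>)
  also have "\<dots> \<le> r * M * (\<Sum>w\<in>walks_to S A p {e. y - e \<in> S}. \<kappa> ^ length w)"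
    using walk_weight_le(1)[OF A] by (intro mult_left_mono sum_mono rM_nonneg) (auto simp: walks_to_def)
  also have "\<dots> \<le> r * M * 2"
    using sum_kappa_le[of \<kappa> "walks_to S A p {e. y - e \<in> S}" p 0]
    by (intro mult_left_mono rM_nonneg) (auto simp: walks_to_def)
  also have "\<dots> \<le> \<eta>" using rM_le kappa_le(2) by simp
  finally show ?thesis .
qed

lemma walk_series_sum_bound:
  assumes h: "hops h" and A: "saturated S v j p A" "0 \<notin> set A" and E: "finite E" "p \<notin> E"
  shows "(\<Sum>e\<in>E. \<Sum>w\<in>walks_to S A p {e}. \<kappa> ^ length w) \<le> 2 * \<eta>"
proof -
  have "(\<Sum>w\<in>walks_to S A p E. \<kappa> ^ length w) \<le> 2 * (\<kappa> / \<kappa> * \<eta>) ^ 1"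
  proof (rule sum_kappa_le)
    fix w assume "w \<in> walks_to S A p E"
    then show "walk S p w \<and> 1 \<le> length w" using E by (cases w) (auto simp: walks_to_def)
  qed auto
  also have "\<dots> \<le> 2 * \<eta>" using kappa_le by auto
  finally show ?thesis by (simp add: sum_walks_to[OF E(1)])
qed

end

section \<open>Control of the renormalised denominators\<close>

lemma eff_hop_split_base:
  assumes "p \<notin> set A"
  shows "eff_hop L v h A p y =
    fps_X * (fps_const (h (p - y)) + (\<Sum>e\<in>set A. walk_series L v h A p e * fps_const (h (e - y))))"
  using assms by (simp add: eff_hop_def walk_series_outside)

lemma sum_shift_set:
  fixes p :: "'a::ab_group_add"
  shows "(\<Sum>e\<in>set A. f e) = (\<Sum>e\<in>{c. p + c \<in> set A}. f (p + e))"
  by (rule sum.reindex_bij_witness[of _ "\<lambda>c. p + c" "\<lambda>e. e - p"]) auto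

text \<open>The self-energies at \<open>p\<close> and at \<open>0\<close> are compared after translating the environment of \<open>p\<close> by \<open>- p\<close>. The
  set \<open>B\<close> is the translated environment; the second sum collects the walks from \<open>0\<close> that leave it.\<close>
lemma self_energy_difference:
  assumes L: "L $ 0 = 0" and v: "\<And>n. n \<noteq> 0 \<Longrightarrow> v n \<noteq> 0"
    and A: "distinct A" "0 \<notin> set A" and A': "distinct A'" "0 \<notin> set A'" "p \<notin> set A'"
    and B: "B = {c. p + c \<in> set A'}" "B \<subseteq> set A"
  shows "eff_hop L v h A' p p - eff_hop L v h A 0 0 =
    (\<Sum>e\<in>B. walk_series L v h A 0 e * fps_const (of_real (v (p + e) - v e)) *
       walk_series L v (\<lambda>n. h (- n)) A' p (p + e)) -
    (\<Sum>c\<in>set A - B. walk_series L v h A 0 c * eff_hop L v (\<lambda>n. h (- n)) A' p (p + c))"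
proof -
  let ?h = "\<lambda>n. h (- n)"
  let ?x = "\<lambda>e. walk_series L v h A 0 e" and ?y = "\<lambda>e. walk_series L v ?h A' p (p + e)"
  have Kx: "eff_hop L v h A 0 e = fps_X * (fps_const (h (- e)) + (\<Sum>c\<in>set A. ?x c * fps_const (h (c - e))))" for e
    using eff_hop_split_base[OF A(2), of L v h e] by simp
  have Ky: "eff_hop L v ?h A' p (p + c) = fps_X * (fps_const (h c) + (\<Sum>e\<in>B. ?y e * fps_const (h (c - e))))" for c
    using eff_hop_split_base[OF A'(3), of L v ?h "p + c"]
    by (simp add: sum_shift_set[of _ A' p] B(1) algebra_simps)
  have eqx: "?x e * (L - fps_const (of_real (v e))) =
      fps_X * (fps_const (h (- e)) + (\<Sum>c\<in>set A. ?x c * fps_const (h (c - e))))" if "e \<in> set A" for e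
  proof -
    have "(?x e - of_bool (0 = e)) * (L - fps_const (of_real (v e))) = eff_hop L v h A 0 e"
      by (rule walk_series_equation[OF L _ A(1) that]) (use v A in metis)
    moreover have "e \<noteq> 0" using that A by metis
    ultimately show ?thesis by (simp add: Kx)
  qed
  have eqy: "?y c * (L - fps_const (of_real (v (p + c)))) =
      fps_X * (fps_const (h c) + (\<Sum>e\<in>B. ?y e * fps_const (h (c - e))))" if "c \<in> B" for c
  proof -
    have nz: "v s \<noteq> 0" if "s \<in> set A'" for s using v A'(2) that by metis
    have pc: "p + c \<in> set A'" using that B(1) by simp
    have "(?y c - of_bool (p = p + c)) * (L - fps_const (of_real (v (p + c)))) = eff_hop L v ?h A' p (p + c)"
      by (rule walk_series_equation[OF L nz A'(1) pc])
    moreover have "p \<noteq> p + c" using pc A'(3) by metis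
    ultimately show ?thesis by (simp add: Ky)
  qed
  have "fps_X * (\<Sum>e\<in>B. ?y e * fps_const (h (- e))) - fps_X * (\<Sum>c\<in>set A. ?x c * fps_const (h c)) =
    (\<Sum>e\<in>B. ?x e * (fps_const (of_real (v (p + e))) - fps_const (of_real (v e))) * ?y e) -
    (\<Sum>c\<in>set A - B. ?x c * (fps_X * (fps_const (h c) + (\<Sum>e\<in>B. ?y e * fps_const (h (c - e))))))"
    by (rule eliminated_difference[OF _ B(2) eqx eqy]) auto
  also have "fps_X * (\<Sum>e\<in>B. ?y e * fps_const (h (- e))) = eff_hop L v ?h A' p (p + 0) - fps_X * fps_const (h 0)"
    unfolding Ky by (simp add: algebra_simps)
  also have "fps_X * (\<Sum>c\<in>set A. ?x c * fps_const (h c)) = eff_hop L v h A 0 0 - fps_X * fps_const (h 0)"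
    unfolding Kx by (simp add: algebra_simps)
  finally show ?thesis unfolding Ky[symmetric] by (simp add: eff_hop_transpose)
qed

context resonance_estimates
begin

text \<open>If the translate of \<open>c\<close> is at least as resonant as \<open>p\<close>, the gap condition makes every walk from \<open>0\<close> to \<open>c\<close>
  long in terms of \<open>\<bar>v p\<bar>\<close>. A factor \<open>1/2\<close> of the weight of each hop pays for \<open>\<bar>v p\<bar>\<close>, and
  what remains is summed over all walks.\<close>
lemma far_walks_bound:
  assumes A: "saturated S v j 0 A" "0 \<notin> set A"
    and p: "p \<noteq> 0" and E: "finite E" "0 \<notin> E" "\<And>c. c \<in> E \<Longrightarrow> \<bar>v (p + c)\<bar> \<le> \<bar>v p\<bar>"
  shows "(\<Sum>c\<in>E. \<Sum>w\<in>walks_to S A 0 {c}. \<kappa> ^ length w) \<le> \<bar>v p\<bar> / 4"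
proof -
  have vp: "0 < \<bar>v p\<bar>" using v_nonzero[OF p] by simp
  have T: "0 < T" using decay(1)[of 1] by simp
  have len: "walk S 0 w \<and> 1 \<le> length w \<and> (1/2) ^ length w \<le> T * (\<bar>v p\<bar> / c0)" if "w \<in> walks_to S A 0 E" for w
  proof -
    define c where "c = last (0 # w)"
    have w: "walk S 0 w" "last (0 # w) = c" "c \<in> E" using that unfolding walks_to_def c_def by blast+
    have c: "c \<noteq> 0" using w(3) E(2) by metis
    then have "w \<noteq> []" using w(2) by (metis last_ConsL)
    then have l: "1 \<le> length w" by (cases w) auto
    have "reach S (length w) 0 c" unfolding reach_def using w by blast
    then have "reach S (length w) p (p + c)" using reach_shift[of S _ 0 c p] by simp
    moreover have "p \<noteq> p + c" using c by simp
    ultimately have "c0 * real (length w) powr (- \<tau>) \<le> max \<bar>v p\<bar> \<bar>v (p + c)\<bar>"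
      using gap unfolding gap_condition_def by blast
    then have "real (length w) powr (- \<tau>) \<le> \<bar>v p\<bar> / c0"
      using E(3)[OF w(3)] c0_pos by (simp add: field_simps)
    then have "T * real (length w) powr (- \<tau>) \<le> T * (\<bar>v p\<bar> / c0)" using T by (intro mult_left_mono) auto
    then show ?thesis using decay(1)[OF l] w l by linarith
  qed
  have "(\<Sum>w\<in>walks_to S A 0 E. \<kappa> ^ length w) = (\<Sum>w\<in>walks_to S A 0 E. (1/2) ^ length w * (2 * \<kappa>) ^ length w)"
    by (simp only: power_mult_distrib[symmetric]) simp
  also have "\<dots> \<le> (\<Sum>w\<in>walks_to S A 0 E. T * (\<bar>v p\<bar> / c0) * (2 * \<kappa>) ^ length w)"
    using len kappa_nonneg by (intro sum_mono mult_right_mono) auto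
  also have "\<dots> = T * (\<bar>v p\<bar> / c0) * (\<Sum>w\<in>walks_to S A 0 E. (2 * \<kappa>) ^ length w)"
    by (simp add: sum_distrib_left)
  also have "\<dots> \<le> T * (\<bar>v p\<bar> / c0) * (2 * (2 * \<kappa> / \<kappa> * \<eta>) ^ 1)"
    using len T c0_pos by (intro mult_left_mono sum_kappa_le) auto
  also have "\<dots> \<le> T * (\<bar>v p\<bar> / c0) * (4 * \<eta>)"
    using T c0_pos kappa_le by (intro mult_left_mono) auto
  also have "\<dots> = \<bar>v p\<bar> * (16 * T * \<eta> / c0) / 4" by simp
  also have "\<dots> \<le> \<bar>v p\<bar> * 1 / 4"
    using decay(2) c0_pos by (intro divide_right_mono mult_left_mono) auto
  finally show ?thesis by (simp add: sum_walks_to[OF E(1)])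
qed

text \<open>The cancellation. The assumption \<open>eigen\<close> says that \<open>L\<close> is the self-energy at \<open>0\<close>; hence the numerator
  \<open>L - K p p\<close> is a difference of self-energies. At non-resonant \<open>p\<close> each of them is small by itself; at
  resonant \<open>p\<close> the two sums of \<open>self_energy_difference\<close> contribute at most \<open>\<bar>v p\<bar> / 4\<close> each.\<close>
lemma denoms_controlled_all:
  assumes h: "hops h"
    and eigen: "\<And>j A i. saturated S v j 0 A \<Longrightarrow> i \<le> j \<Longrightarrow> L $ i = eff_hop L v h A 0 0 $ i"
  shows "denoms_controlled h j"
proof (induction j rule: less_induct)
  case (less j)
  let ?h = "\<lambda>n. h (- n)"
  note h' = hops_reflect[OF h]
  have less': "denoms_controlled ?h i" if "i < j" for i using less that denoms_controlled_reflect by blast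
  show ?case unfolding denoms_controlled_def
  proof (intro allI impI)
    fix p A' assume p: "p \<noteq> 0" and A': "saturated S v j p A'"
    define B where "B = {c. p + c \<in> set A'}"
    have vp: "0 < \<bar>v p\<bar>" using v_nonzero[OF p] by simp
    have A'0: "0 \<notin> set A'" "p \<notin> set A'" using A' vp v_0 by (fastforce simp: saturated_def)+
    have "B = (\<lambda>a. a - p) ` set A'" unfolding B_def by (force simp: image_iff algebra_simps)
    then have finB: "finite B" by simp
    have B0: "0 \<notin> B" using A'0 by (simp add: B_def)
    \<comment> \<open>The ball makes A saturated for 0; B is added since the comparison needs B to be part of A.\<close>
    obtain A where A: "set A = ({x. reach S j 0 x} \<union> B) - {0}" "distinct A"
        "sorted_wrt (\<lambda>x y. \<bar>v x\<bar> \<le> \<bar>v y\<bar>) A"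
      using ex_sorted_list[of "({x. reach S j 0 x} \<union> B) - {0}" v] finite_reach[OF finite_S] finB by blast
    have A0: "0 \<notin> set A" "B \<subseteq> set A" using A B0 by auto
    have sat: "saturated S v j 0 A" using A v_0 by (auto simp: saturated_def)
    note xb = walk_series_bound[OF h sat A0(1) less]
    note yb = walk_series_bound[OF h' A' A'0(1) less']
    let ?x = "\<lambda>e. walk_series L v h A 0 e" and ?y = "\<lambda>e. walk_series L v ?h A' p (p + e)"
    let ?N = "trunc_norm j r"
    \<comment> \<open>The list A contains the whole ball around 0, so eigen identifies L with the self-energy of A.\<close>
    have LK: "?N (L - eff_hop L v h A' p p) = ?N (eff_hop L v h A' p p - eff_hop L v h A 0 0)"
    proof -
      have "?N (L - eff_hop L v h A' p p) = ?N (eff_hop L v h A 0 0 - eff_hop L v h A' p p)"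
        using eigen[OF sat] by (intro trunc_norm_cong) auto
      also have "\<dots> = ?N (- (eff_hop L v h A 0 0 - eff_hop L v h A' p p))" by (simp only: trunc_norm_minus)
      finally show ?thesis by simp
    qed
    show "?N (L - eff_hop L v h A' p p) \<le> \<bar>v p\<bar> / 2"
    proof (cases "\<bar>v p\<bar> < 1")
      case False
      have "?N (L - eff_hop L v h A' p p) \<le> ?N (eff_hop L v h A' p p) + ?N (eff_hop L v h A 0 0)"
        unfolding LK by (rule trunc_norm_diff[OF r_nonneg])
      also have "\<dots> \<le> \<eta> + \<eta>"
        using eff_hop_bound[OF h A' A'0(1) less, of p] eff_hop_bound[OF h sat A0(1) less, of 0] by linarith
      finally show ?thesis using False small(2) by linarith
    next
      case True
      let ?X = "\<lambda>e. \<Sum>w\<in>walks_to S A 0 {e}. \<kappa> ^ length w" and ?Y = "\<lambda>e. \<Sum>w\<in>walks_to S A' p {p + e}. \<kappa> ^ length w"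
      \<comment> \<open>The gain at sites with a large potential is kept for the shift estimate below.\<close>
      have weighted: "?N (walk_series L v g A p c) * max 1 \<bar>v c\<bar> \<le> (\<Sum>w\<in>walks_to S A p {c}. \<kappa> ^ length w)"
        if b: "?N (walk_series L v g A p c) \<le> (\<Sum>w\<in>walks_to S A p {c}. walk_weight v (r * M) w)"
          and A: "saturated S v j p A" "0 \<notin> set A" and c: "c \<noteq> p" for g A p c
      proof -
        have "?N (walk_series L v g A p c) * max 1 \<bar>v c\<bar> \<le>
            (\<Sum>w\<in>walks_to S A p {c}. walk_weight v (r * M) w) * max 1 \<bar>v c\<bar>"
          by (intro mult_right_mono b) auto
        also have "\<dots> \<le> (\<Sum>w\<in>walks_to S A p {c}. \<kappa> ^ length w)"
          unfolding sum_distrib_right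
        proof (rule sum_mono)
          fix w assume w: "w \<in> walks_to S A p {c}"
          then have "w \<noteq> []" using c by (auto simp: walks_to_def)
          then have "last w = c" using w by (auto simp: walks_to_def)
          then show "walk_weight v (r * M) w * max 1 \<bar>v c\<bar> \<le> \<kappa> ^ length w"
            using walk_weight_le(2)[OF A, of w] w \<open>w \<noteq> []\<close> by (auto simp: walks_to_def)
        qed
        finally show ?thesis .
      qed
      have X: "?N (?x e) * max 1 \<bar>v e\<bar> \<le> ?X e" if "e \<noteq> 0" for e
        by (rule weighted[OF xb sat A0(1) that])
      have Y: "?N (?y e) * max 1 \<bar>v (p + e)\<bar> \<le> ?Y e" if "e \<noteq> 0" for e
        by (rule weighted[OF yb A' A'0(1)]) (use that in auto)
      have XY0: "0 \<le> ?X e" "0 \<le> ?Y e" for e using kappa_nonneg by (auto intro!: sum_nonneg)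
      have first: "(\<Sum>e\<in>B. ?N (?x e * fps_const (of_real (v (p + e) - v e)) * ?y e)) \<le> \<bar>v p\<bar> / 4"
      proof -
        have "(\<Sum>e\<in>B. ?N (?x e * fps_const (of_real (v (p + e) - v e)) * ?y e)) \<le> (\<Sum>e\<in>B. C * \<bar>v p\<bar> * (?X e * ?Y e))"
        proof (rule sum_mono)
          fix e assume "e \<in> B"
          then have e: "e \<noteq> 0" using B0 by auto
          have "?N (?x e * fps_const (of_real (v (p + e) - v e)) * ?y e) =
              ?N (fps_const (of_real (v (p + e) - v e)) * (?x e * ?y e))" by (simp only: mult_ac)
          also have "\<dots> = \<bar>v (p + e) - v e\<bar> * ?N (?x e * ?y e)"
            by (simp only: trunc_norm_const_mult norm_of_real)
          also have "\<dots> \<le> (C * \<bar>v p\<bar> * max 1 \<bar>v e\<bar> * max 1 \<bar>v (p + e)\<bar>) * (?N (?x e) * ?N (?y e))"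
            using C_nonneg r_nonneg
            by (intro mult_mono shift[OF True] trunc_norm_mult mult_nonneg_nonneg trunc_norm_nonneg) auto
          also have "\<dots> = C * \<bar>v p\<bar> * ((?N (?x e) * max 1 \<bar>v e\<bar>) * (?N (?y e) * max 1 \<bar>v (p + e)\<bar>))"
            by (simp only: mult_ac)
          also have "\<dots> \<le> C * \<bar>v p\<bar> * (?X e * ?Y e)"
            using C_nonneg X[OF e] Y[OF e] XY0 trunc_norm_nonneg[OF r_nonneg]
            by (intro mult_left_mono mult_mono mult_nonneg_nonneg) auto
          finally show "?N (?x e * fps_const (of_real (v (p + e) - v e)) * ?y e) \<le> C * \<bar>v p\<bar> * (?X e * ?Y e)" .
        qed
        also have "\<dots> = C * \<bar>v p\<bar> * (\<Sum>e\<in>B. ?X e * ?Y e)" by (simp add: sum_distrib_left)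
        also have "\<dots> \<le> C * \<bar>v p\<bar> * ((2 * \<eta>) * (2 * \<eta>))"
        proof (intro mult_left_mono)
          have sY: "(\<Sum>e\<in>B. ?Y e) \<le> 2 * \<eta>"
          proof -
            have "(\<Sum>e\<in>B. ?Y e) = (\<Sum>c\<in>set A'. \<Sum>w\<in>walks_to S A' p {c}. \<kappa> ^ length w)"
              unfolding B_def by (rule sum_shift_set[symmetric])
            then show ?thesis using walk_series_sum_bound[OF h' A' A'0(1)] A'0(2) by simp
          qed
          have "(\<Sum>e\<in>B. ?X e * ?Y e) \<le> (\<Sum>e\<in>B. ?X e * (2 * \<eta>))"
            using XY0 sY finB by (intro sum_mono mult_left_mono order_trans[OF member_le_sum sY]) auto
          also have "\<dots> = (\<Sum>e\<in>B. ?X e) * (2 * \<eta>)" by (simp add: sum_distrib_right)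
          also have "\<dots> \<le> (2 * \<eta>) * (2 * \<eta>)"
            using walk_series_sum_bound[OF h sat A0(1) finB B0] kappa_le by (intro mult_right_mono) auto
          finally show "(\<Sum>e\<in>B. ?X e * ?Y e) \<le> (2 * \<eta>) * (2 * \<eta>)" .
        qed (use C_nonneg in auto)
        also have "\<dots> = \<bar>v p\<bar> * (16 * C * \<eta>\<^sup>2) / 4" by (simp add: power2_eq_square)
        also have "\<dots> \<le> \<bar>v p\<bar> * 1 / 4" using small(3) by (intro divide_right_mono mult_left_mono) auto
        finally show ?thesis by simp
      qed
      have second: "(\<Sum>c\<in>set A - B. ?N (?x c * eff_hop L v ?h A' p (p + c))) \<le> \<bar>v p\<bar> / 4"
      proof -
        have "(\<Sum>c\<in>set A - B. ?N (?x c * eff_hop L v ?h A' p (p + c))) \<le> (\<Sum>c\<in>set A - B. ?X c)"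
        proof (rule sum_mono)
          fix c assume "c \<in> set A - B"
          then have c: "c \<noteq> 0" using A0 by auto
          have "?N (?x c * eff_hop L v ?h A' p (p + c)) \<le> ?N (?x c) * ?N (eff_hop L v ?h A' p (p + c))"
            by (rule trunc_norm_mult[OF r_nonneg])
          also have "\<dots> \<le> ?N (?x c) * max 1 \<bar>v c\<bar>"
            using eff_hop_bound[OF h' A' A'0(1) less', of "p + c"] small(2)
            by (intro mult_left_mono trunc_norm_nonneg r_nonneg) auto
          also have "\<dots> \<le> ?X c" by (rule X[OF c])
          finally show "?N (?x c * eff_hop L v ?h A' p (p + c)) \<le> ?X c" .
        qed
        also have "\<dots> \<le> \<bar>v p\<bar> / 4"
        proof (rule far_walks_bound[OF sat A0(1) p])
          fix c assume c: "c \<in> set A - B"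
          then have "reach S j p (p + c)" using A reach_shift[of S j 0 c p] by auto
          moreover have "p + c \<notin> set A'" using c by (auto simp: B_def)
          ultimately show "\<bar>v (p + c)\<bar> \<le> \<bar>v p\<bar>" using A' unfolding saturated_def by force
        qed (use A0 in auto)
        finally show ?thesis .
      qed
      have "?N (L - eff_hop L v h A' p p) \<le>
          ?N (\<Sum>e\<in>B. ?x e * fps_const (of_real (v (p + e) - v e)) * ?y e) +
          ?N (\<Sum>c\<in>set A - B. ?x c * eff_hop L v ?h A' p (p + c))"
        unfolding LK
        by (subst self_energy_difference[OF L_0 v_nonzero A(2) A0(1) _ A'0 B_def A0(2)])
           (use A' r_nonneg in \<open>auto simp: saturated_def intro: trunc_norm_diff\<close>)
      also have "\<dots> \<le> \<bar>v p\<bar> / 4 + \<bar>v p\<bar> / 4"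
        by (intro add_mono order_trans[OF trunc_norm_sum[OF r_nonneg] first]
              order_trans[OF trunc_norm_sum[OF r_nonneg] second])
      finally show ?thesis by simp
    qed
  qed
qed

end

section \<open>The Rayleigh-Schroedinger series\<close>

text \<open>The coefficients of the eigenvector, solved from the equation at each order. The eigenvalue coefficient
  of order \<open>j + 1\<close> is the inner sum, because the eigenvector is normalised to have entry \<open>1\<close> at \<open>0\<close>.\<close>
fun rs_vec :: "('a::ab_group_add \<Rightarrow> real) \<Rightarrow> ('a \<Rightarrow> complex) \<Rightarrow> nat \<Rightarrow> 'a \<Rightarrow> complex" where
  "rs_vec v h 0 n = of_bool (n = 0)"
| "rs_vec v h (Suc s) n = (if n = 0 then 0 else
     ((\<Sum>j<s. (\<Sum>m | h m \<noteq> 0. h m * rs_vec v h j (- m)) * rs_vec v h (s - j) n) -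
      (\<Sum>m | h m \<noteq> 0. h m * rs_vec v h s (n - m))) / of_real (v n))"

definition rs_val :: "('a::ab_group_add \<Rightarrow> real) \<Rightarrow> ('a \<Rightarrow> complex) \<Rightarrow> nat \<Rightarrow> complex" where
  "rs_val v h s = (if s = 0 then 0 else \<Sum>m | h m \<noteq> 0. h m * rs_vec v h (s - 1) (- m))"

definition rs_vec_fps :: "('a::ab_group_add \<Rightarrow> real) \<Rightarrow> ('a \<Rightarrow> complex) \<Rightarrow> 'a \<Rightarrow> complex fps" where
  "rs_vec_fps v h n = Abs_fps (\<lambda>s. rs_vec v h s n)"

definition rs_val_fps :: "('a::ab_group_add \<Rightarrow> real) \<Rightarrow> ('a \<Rightarrow> complex) \<Rightarrow> complex fps" where
  "rs_val_fps v h = Abs_fps (rs_val v h)"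

lemma rs_vec_at_0: "rs_vec v h s 0 = of_bool (s = 0)"
  by (cases s) auto

lemma rs_vec_fps_0 [simp]: "rs_vec_fps v h 0 = 1"
  by (rule fps_ext) (simp add: rs_vec_fps_def rs_vec_at_0)

lemma rs_val_fps_nth_0 [simp]: "rs_val_fps v h $ 0 = 0"
  by (simp add: rs_val_fps_def rs_val_def)

lemma rs_val_fps_eq:
  "rs_val_fps v h = fps_X * (\<Sum>m | h m \<noteq> 0. fps_const (h m) * rs_vec_fps v h (- m))"
  by (rule fps_ext) (auto simp: rs_val_fps_def rs_val_def rs_vec_fps_def fps_sum_nth)

lemma rs_equation:
  assumes v: "v 0 = 0" "n \<noteq> 0 \<Longrightarrow> v n \<noteq> 0"
  shows "(rs_val_fps v h - fps_const (of_real (v n))) * rs_vec_fps v h n =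
    fps_X * (\<Sum>m | h m \<noteq> 0. fps_const (h m) * rs_vec_fps v h (n - m))"
proof (cases "n = 0")
  case True
  then show ?thesis using v(1) rs_val_fps_eq[of v h] by simp
next
  case False
  show ?thesis
  proof (rule fps_ext)
    fix i
    show "((rs_val_fps v h - fps_const (of_real (v n))) * rs_vec_fps v h n) $ i =
      (fps_X * (\<Sum>m | h m \<noteq> 0. fps_const (h m) * rs_vec_fps v h (n - m))) $ i"
    proof (cases i)
      case 0
      then show ?thesis using False by (simp add: rs_vec_fps_def)
    next
      case (Suc s)
      have "(rs_val_fps v h * rs_vec_fps v h n) $ Suc s = (\<Sum>j\<le>Suc s. rs_val v h j * rs_vec v h (Suc s - j) n)"
        by (simp add: fps_mult_nth rs_val_fps_def rs_vec_fps_def atLeast0AtMost)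
      also have "\<dots> = (\<Sum>j<s. rs_val v h (Suc j) * rs_vec v h (s - j) n)"
      proof -
        have "{..s} = insert s {..<s}" by auto
        then show ?thesis using False
          by (subst sum.atMost_Suc_shift) (simp add: rs_val_def)
      qed
      finally have "(rs_val_fps v h * rs_vec_fps v h n) $ Suc s = (\<Sum>j<s. rs_val v h (Suc j) * rs_vec v h (s - j) n)" .
      moreover have "of_real (v n) * rs_vec v h (Suc s) n = (\<Sum>j<s. rs_val v h (Suc j) * rs_vec v h (s - j) n) -
          (\<Sum>m | h m \<noteq> 0. h m * rs_vec v h s (n - m))"
        using False v(2) by (simp add: rs_val_def)
      ultimately show ?thesis
        unfolding Suc by (simp add: left_diff_distrib fps_sum_nth rs_vec_fps_def del: rs_vec.simps(2))
    qed
  qed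
qed

lemma rs_vec_reach:
  assumes S: "\<And>n. h n \<noteq> 0 \<Longrightarrow> n \<in> S"
  shows "rs_vec v h s n \<noteq> 0 \<Longrightarrow> reach S s 0 n"
proof (induction s arbitrary: n rule: less_induct)
  case (less s)
  show ?case
  proof (cases s)
    case 0
    then show ?thesis using less.prems by (auto split: if_splits)
  next
    case (Suc s')
    consider j where "j < s'" "rs_vec v h (s' - j) n \<noteq> 0" | m where "h m \<noteq> 0" "rs_vec v h s' (n - m) \<noteq> 0"
    proof -
      have "(\<Sum>j<s'. (\<Sum>m | h m \<noteq> 0. h m * rs_vec v h j (- m)) * rs_vec v h (s' - j) n) \<noteq> 0 \<or>
          (\<Sum>m | h m \<noteq> 0. h m * rs_vec v h s' (n - m)) \<noteq> 0"
        using less.prems Suc by (auto split: if_splits)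
      then show ?thesis using that
        by (smt (verit) lessThan_iff mem_Collect_eq mult_eq_0_iff sum.neutral)
    qed
    then show ?thesis
    proof cases
      case 1
      then show ?thesis using less.IH[of "s' - j" n] reach_mono[of S "s' - j" 0 n s] Suc by simp
    next
      case 2
      have "reach S s' 0 (n - m)" using less.IH[of s' "n - m"] 2 Suc by simp
      moreover have "reach S 1 (n - m) n" using reach_step[of n "n - m" S 0] S[OF 2(1)] by simp
      ultimately show ?thesis using reach_trans[of S s' 0 "n - m" 1 n] Suc by simp
    qed
  qed
qed

text \<open>Up to order \<open>j\<close> the eigenvector lives on the ball of radius \<open>j\<close>, so hopping may be restricted to any
  finite set that contains the ball.\<close>
lemma hopping_truncate:
  assumes S: "\<And>n. h n \<noteq> 0 \<Longrightarrow> n \<in> S" and fin: "finite S" "finite F"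
    and F: "\<And>x. reach S j 0 x \<Longrightarrow> x \<in> F" and "i \<le> j"
  shows "(\<Sum>m | h m \<noteq> 0. h m * rs_vec v h i (n - m)) = (\<Sum>e\<in>F. h (n - e) * rs_vec v h i e)"
proof -
  have fh: "finite {m. h m \<noteq> 0}" using S fin(1) by (auto intro: finite_subset[of _ S])
  have "(\<Sum>m | h m \<noteq> 0. h m * rs_vec v h i (n - m)) = (\<Sum>e\<in>(\<lambda>m. n - m) ` {m. h m \<noteq> 0}. h (n - e) * rs_vec v h i e)"
    by (subst sum.reindex) (auto simp: inj_on_def)
  also have "\<dots> = (\<Sum>e\<in>F \<union> (\<lambda>m. n - m) ` {m. h m \<noteq> 0}. h (n - e) * rs_vec v h i e)"
    by (rule sum.mono_neutral_left) (use fh fin in \<open>auto simp: image_iff, metis diff_diff_eq2 add_diff_cancel_left'\<close>)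
  also have "\<dots> = (\<Sum>e\<in>F. h (n - e) * rs_vec v h i e)"
  proof (rule sum.mono_neutral_right)
    show "\<forall>e\<in>F \<union> (\<lambda>m. n - m) ` {m. h m \<noteq> 0} - F. h (n - e) * rs_vec v h i e = 0"
    proof
      fix e assume "e \<in> F \<union> (\<lambda>m. n - m) ` {m. h m \<noteq> 0} - F"
      then have "\<not> reach S i 0 e" using F reach_mono[OF _ \<open>i \<le> j\<close>] by blast
      then have "rs_vec v h i e = 0" using rs_vec_reach[of h S v i e] S by blast
      then show "h (n - e) * rs_vec v h i e = 0" by simp
    qed
  qed (use fh fin in auto)
  finally show ?thesis .
qed

lemma fps_low_coeffs_mult_0:
  fixes a :: "complex fps"
  assumes "\<And>i. i \<le> j \<Longrightarrow> (a * b) $ i = 0" "b $ 0 \<noteq> 0" "i \<le> j"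
  shows "a $ i = 0"
proof -
  have "a = (a * b) * inverse b" using assms(2) by (simp add: mult.assoc inverse_mult_eq_1')
  also have "\<dots> $ i = 0" unfolding fps_mult_nth using assms(1,3)
    by (intro sum.neutral ballI) (simp add: fps_mult_nth)
  finally show ?thesis .
qed

text \<open>Up to order \<open>j\<close> the eigenvector satisfies the column equation of the walk series started at \<open>0\<close>, and
  that equation determines its solution order by order. Evaluating the equation at \<open>0\<close> identifies the
  eigenvalue series with the self-energy.\<close>
lemma rs_vec_eq_walk_series:
  fixes h :: "'a::ab_group_add \<Rightarrow> complex" and v :: "'a \<Rightarrow> real"
  defines "L \<equiv> rs_val_fps v h"
  assumes S: "\<And>n. h n \<noteq> 0 \<Longrightarrow> n \<in> S" and fin: "finite S"
    and v: "v 0 = 0" "\<And>n. n \<noteq> 0 \<Longrightarrow> v n \<noteq> 0" and A: "saturated S v j 0 A"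
    and "i \<le> j"
  shows "n \<in> set A \<Longrightarrow> rs_vec v h i n = walk_series L v (\<lambda>n. h (- n)) A 0 n $ i"
    and "L $ i = eff_hop L v h A 0 0 $ i"
proof -
  let ?h = "\<lambda>n. h (- n)" and ?T = "\<lambda>n. walk_series L v (\<lambda>n. h (- n)) A 0 n"
  have A0: "0 \<notin> set A" "distinct A" using A by (auto simp: saturated_def)
  have F: "x \<in> insert 0 (set A)" if "reach S j 0 x" for x
    using that A v by (cases "x = 0") (auto simp: saturated_def)
  have trunc: "(\<Sum>m | h m \<noteq> 0. h m * rs_vec v h i (n - m)) =
      h n * rs_vec v h i 0 + (\<Sum>e\<in>set A. h (n - e) * rs_vec v h i e)" if "i \<le> j" for i n
    using hopping_truncate[OF S fin _ F that, where v = v and n = n] A0 by simp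
  have L0: "L $ 0 = 0" by (simp add: L_def)
  have T: "?T n * (L - fps_const (of_real (v n))) =
      fps_X * (fps_const (h n) + (\<Sum>e\<in>set A. ?T e * fps_const (h (n - e))))" if "n \<in> set A" for n
  proof -
    have "(?T n - of_bool (0 = n)) * (L - fps_const (of_real (v n))) = eff_hop L v ?h A 0 n"
      by (rule walk_series_equation[OF L0 _ A0(2) that]) (use v A0 in metis)
    moreover have "n \<noteq> 0" using that A0 by metis
    ultimately show ?thesis using eff_hop_split_base[OF A0(1), of L v ?h n] by simp
  qed
  have eq: "\<forall>n\<in>set A. rs_vec v h i n = ?T n $ i" if "i \<le> j" for i
    using that
  proof (induction i rule: less_induct)
    case (less i)
    show ?case
    proof
      fix n assume n: "n \<in> set A"
      then have "n \<noteq> 0" using A0 by metis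
      define D where "D = rs_vec_fps v h n - ?T n"
      have D: "D * (L - fps_const (of_real (v n))) =
          fps_X * ((\<Sum>m | h m \<noteq> 0. fps_const (h m) * rs_vec_fps v h (n - m)) -
            (fps_const (h n) + (\<Sum>e\<in>set A. ?T e * fps_const (h (n - e)))))" (is "_ = fps_X * ?R")
        unfolding D_def left_diff_distrib T[OF n] using rs_equation[of v n h] v
        by (simp add: L_def right_diff_distrib mult.commute)
      have "(D * (L - fps_const (of_real (v n)))) $ i' = 0" if "i' \<le> i" for i'
      proof (cases i')
        case (Suc k)
        then have k: "k \<le> j" "k < i" using that less.prems by auto
        have "?R $ k = (\<Sum>m | h m \<noteq> 0. h m * rs_vec v h k (n - m)) -
            (h n * rs_vec v h k 0 + (\<Sum>e\<in>set A. ?T e $ k * h (n - e)))"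
          by (simp add: fps_sum_nth rs_vec_fps_def rs_vec_at_0)
        also have "\<dots> = 0" unfolding trunc[OF k(1)] using less.IH[OF k(2) k(1)]
          by (simp add: mult.commute)
        finally show ?thesis unfolding D Suc by simp
      qed (simp add: D)
      then have "D $ i = 0"
        by (rule fps_low_coeffs_mult_0) (use v \<open>n \<noteq> 0\<close> L0 in auto)
      then show "rs_vec v h i n = ?T n $ i" by (simp add: D_def rs_vec_fps_def)
    qed
  qed
  show "n \<in> set A \<Longrightarrow> rs_vec v h i n = walk_series L v (\<lambda>n. h (- n)) A 0 n $ i"
    using eq \<open>i \<le> j\<close> by blast
  show "L $ i = eff_hop L v h A 0 0 $ i"
  proof (cases i)
    case (Suc k)
    then have k: "k \<le> j" using \<open>i \<le> j\<close> by simp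
    have "L $ i = (\<Sum>m | h m \<noteq> 0. h m * rs_vec v h k (0 - m))"
      by (simp add: Suc L_def rs_val_fps_def rs_val_def)
    also have "\<dots> = h 0 * rs_vec v h k 0 + (\<Sum>e\<in>set A. h (0 - e) * ?T e $ k)"
      unfolding trunc[OF k] using eq[OF k] by simp
    also have "\<dots> = eff_hop L v ?h A 0 0 $ i"
      unfolding eff_hop_split_base[OF A0(1)] Suc by (simp add: fps_sum_nth rs_vec_at_0 mult.commute)
    finally show ?thesis by (simp add: eff_hop_transpose)
  qed (simp add: L_def)
qed

definition fps_cnj :: "complex fps \<Rightarrow> complex fps" where
  "fps_cnj a = Abs_fps (\<lambda>i. cnj (a $ i))"

lemma fps_cnj_nth [simp]: "fps_cnj a $ i = cnj (a $ i)"
  by (simp add: fps_cnj_def)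

lemma fps_cnj_simps:
  "fps_cnj (a * b) = fps_cnj a * fps_cnj b" "fps_cnj (fps_cnj a) = a"
  "fps_cnj (fps_const c) = fps_const (cnj c)" "fps_cnj (sum f F) = (\<Sum>x\<in>F. fps_cnj (f x))"
  "fps_cnj (a - b) = fps_cnj a - fps_cnj b"
  by (rule fps_ext, simp add: fps_mult_nth fps_sum_nth)+

text \<open>As for any self-adjoint operator, \<open>\<langle>\<psi>, H \<psi>\<rangle> = \<lambda> * \<langle>\<psi>, \<psi>\<rangle>\<close> with both inner products real and the second
  one invertible. The identity is used for formal power series up to order \<open>j\<close>, where all sums are
  finite.\<close>
lemma rs_val_real:
  assumes S: "\<And>n. h n \<noteq> 0 \<Longrightarrow> n \<in> S" and fin: "finite S"
    and v: "v 0 = 0" "\<And>n. n \<noteq> 0 \<Longrightarrow> v n \<noteq> 0" and herm: "\<And>n. h (- n) = cnj (h n)"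
  shows "rs_val v h j \<in> \<real>"
proof -
  define F where "F = {x. reach S j 0 x}"
  have finF: "finite F" using finite_reach[OF fin] by (simp add: F_def)
  let ?P = "rs_vec_fps v h" and ?L = "rs_val_fps v h"
  let ?H = "\<lambda>n. \<Sum>m | h m \<noteq> 0. fps_const (h m) * ?P (n - m)"
  define N where "N = (\<Sum>n\<in>F. fps_cnj (?P n) * ?P n)"
  define W where "W = (\<Sum>n\<in>F. fps_const (of_real (v n)) * (fps_cnj (?P n) * ?P n))"
  define G where "G = (\<Sum>n\<in>F. \<Sum>e\<in>F. fps_cnj (?P n) * (fps_const (h (n - e)) * ?P e))"
  \<comment> \<open>N, W and G are the formal inner products of the eigenvector with itself, with the potential
    applied to it, and with the hopping applied to it.\<close>
  have N: "fps_cnj N = N" unfolding N_def by (simp add: fps_cnj_simps mult.commute)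
  have W: "fps_cnj W = W" unfolding W_def by (simp add: fps_cnj_simps mult.commute)
  have G: "fps_cnj G = G"
    unfolding G_def by (subst sum.swap) (simp add: fps_cnj_simps mult_ac flip: herm)
  have N0: "N $ 0 \<noteq> 0"
  proof -
    have "0 \<in> F" by (simp add: F_def)
    then show ?thesis using finF by (simp add: N_def fps_sum_nth rs_vec_fps_def if_distrib of_bool_def cong: if_cong)
  qed
  have eq: "(?L * N - W) $ i = (fps_X * G) $ i" if "i \<le> j" for i
  proof -
    have "?L * N - W = (\<Sum>n\<in>F. fps_cnj (?P n) * ((?L - fps_const (of_real (v n))) * ?P n))"
      unfolding N_def W_def by (simp add: sum_distrib_left sum_subtractf[symmetric] algebra_simps)
    also have "\<dots> = fps_X * (\<Sum>n\<in>F. fps_cnj (?P n) * ?H n)"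
      using rs_equation[of v _ h] v by (simp add: sum_distrib_left mult.left_commute)
    finally have 1: "?L * N - W = fps_X * (\<Sum>n\<in>F. fps_cnj (?P n) * ?H n)" .
    have 2: "?H n $ i = (\<Sum>e\<in>F. fps_const (h (n - e)) * ?P e) $ i"
      if "i \<le> j" for i n
      using hopping_truncate[OF S fin finF _ that, where v = v and n = n] by (simp add: F_def fps_sum_nth rs_vec_fps_def)
    have 3: "(fps_cnj (?P n) * ?H n) $ k =
        (fps_cnj (?P n) * (\<Sum>e\<in>F. fps_const (h (n - e)) * ?P e)) $ k" if "k \<le> j" for k n
      unfolding fps_mult_nth[of "fps_cnj _"]
      using that by (intro sum.cong refl arg_cong2[where f = "(*)"] 2) auto
    have 4: "(\<Sum>n\<in>F. fps_cnj (?P n) * ?H n) $ k = G $ k"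
      if "k \<le> j" for k
      unfolding G_def sum_distrib_left[symmetric]
      by (subst (1 2) fps_sum_nth) (intro sum.cong refl 3 that)
    show ?thesis unfolding 1 using 4 that by (cases i) auto
  qed
  have "((?L - fps_cnj ?L) * N) $ i = 0" if "i \<le> j" for i
  proof -
    have "(fps_cnj ?L * N - W) $ i = cnj ((?L * N - W) $ i)"
      by (metis N W fps_cnj_nth fps_cnj_simps(1,5))
    also have "\<dots> = cnj ((fps_X * G) $ i)" using eq[OF that] by simp
    also have "\<dots> = (fps_X * G) $ i" using G by (cases i) (auto, metis fps_cnj_nth)
    also have "\<dots> = (?L * N - W) $ i" using eq[OF that] by simp
    finally show ?thesis by (simp add: left_diff_distrib)
  qed
  then have "(?L - fps_cnj ?L) $ j = 0" by (rule fps_low_coeffs_mult_0[OF _ N0]) auto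
  then have "cnj (rs_val v h j) = rs_val v h j" by (simp add: rs_val_fps_def)
  then show ?thesis by (simp add: Reals_cnj_iff)
qed

lemma (in resonance_estimates) rs_bounds:
  assumes L: "L = rs_val_fps v h" and h: "hops (\<lambda>n. h (- n))" and F: "finite F" "0 \<notin> F"
  shows "(\<Sum>n\<in>F. trunc_norm j r (rs_vec_fps v h n)) \<le> 2 * \<eta>" and "trunc_norm j r L \<le> \<eta>"
proof -
  have S: "h n \<noteq> 0 \<Longrightarrow> n \<in> S" for n using h[unfolded hops_def] by (metis minus_minus)
  have h': "hops h" using hops_reflect[OF h] by simp
  have rs: "saturated S v j 0 A \<Longrightarrow> i \<le> j \<Longrightarrow> n \<in> set A \<Longrightarrow>
        rs_vec v h i n = walk_series L v (\<lambda>n. h (- n)) A 0 n $ i"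
      "saturated S v j 0 A \<Longrightarrow> i \<le> j \<Longrightarrow> L $ i = eff_hop L v h A 0 0 $ i" for j A i n
    unfolding L
    by (rule rs_vec_eq_walk_series[where S = S and j = j]; use S finite_S v_0 v_nonzero in blast)+
  have den: "denoms_controlled h j" for j by (rule denoms_controlled_all[OF h' rs(2)])
  then have den': "denoms_controlled (\<lambda>n. h (- n)) j" for j by (simp add: denoms_controlled_reflect)
  \<comment> \<open>The ball makes A saturated; F is added so that the walk series gives the eigenvector on F.\<close>
  obtain A where A: "set A = ({x. reach S j 0 x} \<union> F) - {0}" "distinct A"
      "sorted_wrt (\<lambda>x y. \<bar>v x\<bar> \<le> \<bar>v y\<bar>) A"
    using ex_sorted_list[of "({x. reach S j 0 x} \<union> F) - {0}" v] finite_reach[OF finite_S] F by blast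
  have A0: "0 \<notin> set A" "F \<subseteq> set A" using A F by auto
  have sat: "saturated S v j 0 A" using A v_0 by (auto simp: saturated_def)
  have "(\<Sum>n\<in>F. trunc_norm j r (rs_vec_fps v h n)) = (\<Sum>n\<in>F. trunc_norm j r (walk_series L v (\<lambda>n. h (- n)) A 0 n))"
    using rs(1)[OF sat] A0 by (intro sum.cong refl trunc_norm_cong) (auto simp: rs_vec_fps_def)
  also have "\<dots> \<le> (\<Sum>n\<in>F. \<Sum>w\<in>walks_to S A 0 {n}. \<kappa> ^ length w)"
    by (intro sum_mono order_trans[OF walk_series_bound[OF h sat A0(1) den']] walk_weight_le(1)[OF sat A0(1)])
       (auto simp: walks_to_def)
  also have "\<dots> \<le> 2 * \<eta>" by (rule walk_series_sum_bound[OF h sat A0(1) F])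
  finally show "(\<Sum>n\<in>F. trunc_norm j r (rs_vec_fps v h n)) \<le> 2 * \<eta>" .
  have "trunc_norm j r L = trunc_norm j r (eff_hop L v h A 0 0)"
    using rs(2)[OF sat] by (intro trunc_norm_cong) auto
  also have "\<dots> \<le> \<eta>" by (rule eff_hop_bound[OF h' sat A0(1) den])
  finally show "trunc_norm j r L \<le> \<eta>" .
qed

section \<open>Derivative numbers and the monotone potential\<close>

text \<open>Take a slope \<open>K'\<close> strictly between \<open>K\<close> and the slope of the chord. At the last point where \<open>h x - K' * x\<close>
  does not exceed its initial value, all difference quotients to the right exceed \<open>K'\<close>, and
  compactness of the extended reals turns them into a derivative number of size at least \<open>K'\<close>.\<close>
lemma mean_value_derivative_number:
  fixes h :: "real \<Rightarrow> real"
  assumes "c < d" and cont: "continuous_on {c..d} h"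
    and up: "\<And>x D. x \<in> {c..<d} \<Longrightarrow> derivative_number h x D \<Longrightarrow> D \<le> ereal K"
  shows "h d - h c \<le> K * (d - c)"
proof (rule ccontr)
  assume "\<not> h d - h c \<le> K * (d - c)"
  then have gt: "K < (h d - h c) / (d - c)" using \<open>c < d\<close> by (simp add: field_simps)
  then obtain K' where K': "K < K'" "K' < (h d - h c) / (d - c)" using dense by blast
  define u where "u x = h x - K' * x" for x
  have cu: "continuous_on {c..d} u" unfolding u_def by (intro continuous_intros cont)
  have ud: "u c < u d" using K'(2) \<open>c < d\<close> by (simp add: u_def field_simps)
  define Z where "Z = {x\<in>{c..d}. u x \<le> u c}"
  have "closed Z" unfolding Z_def
    using continuous_closed_preimage[OF cu closed_real_atLeastAtMost closed_atMost, of "u c"]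
    by (simp add: vimage_def Int_def atMost_def)
  then have "compact Z" by (intro compact_eq_bounded_closed[THEN iffD2] conjI)
    (auto simp: Z_def intro: bounded_subset[OF bounded_closed_interval[of c d]])
  moreover have "Z \<noteq> {}" using \<open>c < d\<close> by (auto simp: Z_def intro!: exI[of _ c])
  ultimately obtain s where s: "s \<in> Z" "\<forall>t\<in>Z. t \<le> s" using compact_attains_sup by blast
  have sd: "c \<le> s" "s < d" "u s \<le> u c"
    using s(1) ud by (auto simp: Z_def less_le)
  have above: "K' < (h y - h s) / (y - s)" if "s < y" "y \<le> d" for y
  proof -
    have "y \<notin> Z" using s(2) that by auto
    then have "u s < u y" using that sd by (auto simp: Z_def)
    then show ?thesis using that by (simp add: u_def field_simps)
  qed
  \<comment> \<open>Any sequence decreasing to s inside (s, d] would do.\<close>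
  define y where "y k = s + (d - s) / real (Suc k)" for k
  have y: "s < y k" "y k \<le> d" for k
    using sd mult_right_mono[of s d "real k"] by (auto simp: y_def field_simps)
  have ylim: "y \<longlonglongrightarrow> s"
    unfolding y_def using tendsto_add[OF tendsto_const LIMSEQ_Suc[OF lim_const_over_n[of "d - s"]], of s] by simp
  define q where "q k = ereal ((h (y k) - h s) / (y k - s))" for k
  obtain D \<sigma> where D: "strict_mono \<sigma>" "(q \<circ> \<sigma>) \<longlonglongrightarrow> D"
    using compact_complete_linorder[of q] by blast
  have "derivative_number h s D"
    unfolding derivative_number_def
  proof (intro exI[of _ "y \<circ> \<sigma>"] conjI allI)
    show "(y \<circ> \<sigma>) k \<noteq> s" for k using y(1)[of "\<sigma> k"] by simp
    show "(y \<circ> \<sigma>) \<longlonglongrightarrow> s" using LIMSEQ_subseq_LIMSEQ[OF ylim D(1)] .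
    show "(\<lambda>k. ereal ((h ((y \<circ> \<sigma>) k) - h s) / ((y \<circ> \<sigma>) k - s))) \<longlonglongrightarrow> D"
      using D(2) by (simp add: q_def o_def)
  qed
  then have "D \<le> ereal K" using up sd by auto
  moreover have "ereal K' \<le> D"
  proof (rule LIMSEQ_le_const[OF D(2)], intro exI allI impI)
    fix k show "ereal K' \<le> (q \<circ> \<sigma>) k" using above[OF y(1)[of "\<sigma> k"] y(2)] by (simp add: q_def less_imp_le)
  qed
  ultimately show False using K'(1) by (metis ereal_less_eq(3) not_le order_trans)
qed

lemma derivative_number_uminus:
  assumes "derivative_number (\<lambda>x. - h x) x D" shows "derivative_number h x (- D)"
proof -
  obtain y where y: "\<forall>k::nat. y k \<noteq> x" "y \<longlonglongrightarrow> x"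
    "(\<lambda>k. ereal ((- h (y k) - - h x) / (y k - x))) \<longlonglongrightarrow> D"
    using assms unfolding derivative_number_def by blast
  have "(\<lambda>k. - ereal ((- h (y k) - - h x) / (y k - x))) \<longlonglongrightarrow> - D"
    using y(3) by (rule tendsto_uminus_ereal)
  moreover have "- ereal ((- h (y k) - - h x) / (y k - x)) = ereal ((h (y k) - h x) / (y k - x))" for k
    by (simp only: minus_diff_minus minus_divide_left[symmetric] minus_minus uminus_ereal.simps)
  ultimately show ?thesis using y unfolding derivative_number_def by auto
qed

lemma mean_value_derivative_number_lower:
  fixes h :: "real \<Rightarrow> real"
  assumes "c < d" and cont: "continuous_on {c..d} h"
    and low: "\<And>x D. x \<in> {c..<d} \<Longrightarrow> derivative_number h x D \<Longrightarrow> ereal K \<le> D"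
  shows "K * (d - c) \<le> h d - h c"
proof -
  have "- h d - - h c \<le> (- K) * (d - c)"
  proof (rule mean_value_derivative_number[OF \<open>c < d\<close>])
    fix x D assume "x \<in> {c..<d}" "derivative_number (\<lambda>x. - h x) x D"
    then have "ereal K \<le> - D" using derivative_number_uminus low by blast
    then show "D \<le> ereal (- K)" by (cases D) auto
  qed (intro continuous_intros cont)
  then show ?thesis by simp
qed

lemma sawtooth_period:
  assumes "sawtooth_potential f" "x - 1/2 \<notin> \<int>"
  shows "f (x + of_int k) = f x"
proof (induction k rule: int_induct[where k = 0])
  case (step1 i)
  have "x + of_int i - 1/2 \<notin> \<int>"
    using assms(2) Ints_diff[OF _ Ints_of_int, of "x + of_int i - 1/2" i] by (auto simp: algebra_simps)
  then have "f (x + of_int i + 1) = f (x + of_int i)"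
    using assms(1) by (auto simp: sawtooth_potential_def)
  then show ?case using step1 by (simp add: algebra_simps)
next
  case (step2 i)
  have "x + of_int (i - 1) - 1/2 \<notin> \<int>"
    using assms(2) Ints_diff[OF _ Ints_of_int, of "x + of_int (i - 1) - 1/2" "i - 1"] by (auto simp: algebra_simps)
  then have "f (x + of_int (i - 1) + 1) = f (x + of_int (i - 1))"
    using assms(1) unfolding sawtooth_potential_def by blast
  then show ?case using step2 by (simp add: algebra_simps)
qed simp

lemma half_not_Ints: "-1/2 < x \<Longrightarrow> x < 1/2 \<Longrightarrow> x - 1/2 \<notin> (\<int>::real set)"
proof
  assume x: "-1/2 < x" "x < 1/2" "x - 1/2 \<in> \<int>"
  then obtain k where "x - 1/2 = of_int k" by (auto elim: Ints_cases)
  then have "real_of_int (-1) < of_int k" "real_of_int k < of_int 0" using x by simp_all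
  then have "-1 < k" "k < 0" by (simp_all only: of_int_less_iff)
  then show False by simp
qed

text \<open>Regularity in integrated form: \<open>f\<close> is bi-Lipschitz with constants \<open>D\<close> and \<open>\<kappa>\<close> where it is within \<open>2\<close> of
  \<open>f x0\<close>, and the reciprocal gap is \<open>\<kappa>\<close>-Lipschitz where \<open>f\<close> is more than \<open>1\<close> away from \<open>f x0\<close>. The overlap
  of the two regions is what makes a translation estimate uniform on the whole circle.\<close>
locale potential_well =
  fixes f :: "real \<Rightarrow> real" and x0 a b a1 b1 D \<kappa> :: real
  assumes saw: "sawtooth_potential f"
    and wells: "level_nbhd f x0 2 = {a<..<b}" "level_nbhd f x0 1 = {a1<..<b1}"
    and x0: "x0 \<in> {-1/2<..<1/2}"
    and bij: "bij_betw f {a<..<b} {f x0 - 2<..<f x0 + 2}"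
    and D: "1 \<le> D"
    and slope_ge: "\<And>x y. a < x \<Longrightarrow> x < y \<Longrightarrow> y < b \<Longrightarrow> D * (y - x) \<le> f y - f x"
    and slope_le: "\<And>x y. a < x \<Longrightarrow> x < y \<Longrightarrow> y < b \<Longrightarrow> f y - f x \<le> \<kappa> * (y - x)"
    and recip: "\<And>x y. b1 < x \<Longrightarrow> x < y \<Longrightarrow> y < a1 + 1 \<Longrightarrow>
        \<bar>recip_gap f x0 y - recip_gap f x0 x\<bar> \<le> \<kappa> * (y - x)"
begin

lemma wells_subset: "a < x0" "x0 < b" "a1 < x0" "x0 < b1" "-1/2 \<le> a" "b \<le> 1/2"
proof -
  have "x0 \<in> level_nbhd f x0 2" "x0 \<in> level_nbhd f x0 1" using x0 by (auto simp: level_nbhd_def)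
  then show *: "a < x0" "x0 < b" "a1 < x0" "x0 < b1" unfolding wells by auto
  have "{a<..<b} \<subseteq> {-1/2<..<1/2}" unfolding wells(1)[symmetric] by (auto simp: level_nbhd_def)
  then have "-1/2 \<le> a \<and> b \<le> 1/2"
    using * by (subst (asm) greaterThanLessThan_subseteq_greaterThanLessThan) linarith
  then show "-1/2 \<le> a" "b \<le> 1/2" by auto
qed

lemma kappa_ge_D: "D \<le> \<kappa>"
proof -
  define t where "t = (x0 + b) / 2"
  have t: "x0 < t" "t < b" using wells_subset by (auto simp: t_def)
  have "D * (t - x0) \<le> \<kappa> * (t - x0)"
    using slope_ge[of x0 t] slope_le[of x0 t] wells_subset(1) t by linarith
  then show ?thesis using t by (simp add: mult_le_cancel_right)
qed

lemma strict_mono_f: "a < x \<Longrightarrow> x < y \<Longrightarrow> y < b \<Longrightarrow> f x < f y"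
  using slope_ge[of x y] D mult_pos_pos[of D "y - x"] by linarith

lemma inner_well: "a < a1" "b1 < b" "f a1 = f x0 - 1" "f b1 = f x0 + 1"
proof -
  have "f x0 - 1 \<in> f ` {a<..<b}" "f x0 + 1 \<in> f ` {a<..<b}"
    using bij by (auto simp: bij_betw_def)
  then obtain \<alpha> \<beta> where \<alpha>: "a < \<alpha>" "\<alpha> < b" "f \<alpha> = f x0 - 1" and \<beta>: "a < \<beta>" "\<beta> < b" "f \<beta> = f x0 + 1"
    by (auto simp del: bij_betw_def) 
  have less: "x < y" if "f x < f y" "a < x" "x < b" "a < y" "y < b" for x y
    using strict_mono_f[of y x] that by (metis linorder_less_linear order_less_asym)
  have "{a1<..<b1} = {\<alpha><..<\<beta>}"
  proof (intro equalityI subsetI)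
    fix x assume "x \<in> {a1<..<b1}"
    then have l1: "x \<in> level_nbhd f x0 1" using wells by simp
    then have "x \<in> level_nbhd f x0 2" by (auto simp: level_nbhd_def)
    then have "a < x" "x < b" using wells by auto
    then show "x \<in> {\<alpha><..<\<beta>}" using l1 less[of \<alpha> x] less[of x \<beta>] \<alpha> \<beta> by (auto simp: level_nbhd_def)
  next
    fix x assume x: "x \<in> {\<alpha><..<\<beta>}"
    then have "f \<alpha> < f x" "f x < f \<beta>" using strict_mono_f[of \<alpha> x] strict_mono_f[of x \<beta>] \<alpha> \<beta> by auto
    moreover have "x \<in> {-1/2<..<1/2}" using x \<alpha> \<beta> wells_subset by auto
    ultimately have "x \<in> level_nbhd f x0 1" using \<alpha> \<beta> by (auto simp: level_nbhd_def)
    then show "x \<in> {a1<..<b1}" using wells by simp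
  qed
  moreover have "a1 < b1" using wells_subset by linarith
  ultimately have "a1 = \<alpha> \<and> b1 = \<beta>"
    by (metis cInf_greaterThanLessThan cSup_greaterThanLessThan greaterThanLessThan_empty_iff not_le)
  then show "a < a1" "b1 < b" "f a1 = f x0 - 1" "f b1 = f x0 + 1" using \<alpha> \<beta> by auto
qed

text \<open>Between levels \<open>1\<close> and \<open>2\<close> the potential grows by \<open>1\<close> with slope at most \<open>\<kappa>\<close>, so a step shorter than
  \<open>1 / \<kappa>\<close> cannot cross from one to the other.\<close>
lemma step_stays_below:
  assumes "a < y" "y \<le> b1" "0 < \<theta>" "\<kappa> * \<theta> < 1"
  shows "y + \<theta> < b"
proof (rule ccontr)
  assume "\<not> y + \<theta> < b"
  have k: "0 < \<kappa>" using kappa_ge_D D by linarith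
  then have kt: "0 < \<kappa> * \<theta>" using assms by simp
  have "f x0 + 1 + \<kappa> * \<theta> \<in> f ` {a<..<b}" using bij kt assms by (auto simp: bij_betw_def)
  then obtain \<beta> where \<beta>: "a < \<beta>" "\<beta> < b" "f \<beta> = f x0 + 1 + \<kappa> * \<theta>" by auto
  have "f y \<le> f x0 + 1" using strict_mono_f[of y b1] inner_well assms by (cases "y = b1") auto
  then have gt: "\<kappa> * \<theta> \<le> f \<beta> - f y" using \<beta> by simp
  then have "\<not> \<beta> \<le> y" using strict_mono_f[of \<beta> y] kt \<beta>(1) inner_well(2) assms(2) by (cases "\<beta> = y") auto
  then have "f \<beta> - f y \<le> \<kappa> * (\<beta> - y)" by (intro slope_le assms \<beta>) simp
  also have "\<dots> < \<kappa> * \<theta>" using \<open>\<not> y + \<theta> < b\<close> \<beta> k by (intro mult_strict_left_mono) auto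
  finally show False using gt by simp
qed

lemma step_stays_above:
  assumes "a1 \<le> y" "y < b" "0 < \<theta>" "\<kappa> * \<theta> < 1"
  shows "a < y - \<theta>"
proof (rule ccontr)
  assume "\<not> a < y - \<theta>"
  have k: "0 < \<kappa>" using kappa_ge_D D by linarith
  then have kt: "0 < \<kappa> * \<theta>" using assms by simp
  have "f x0 - 1 - \<kappa> * \<theta> \<in> f ` {a<..<b}" using bij kt assms by (auto simp: bij_betw_def)
  then obtain \<alpha> where \<alpha>: "a < \<alpha>" "\<alpha> < b" "f \<alpha> = f x0 - 1 - \<kappa> * \<theta>" by auto
  have "f x0 - 1 \<le> f y" using strict_mono_f[of a1 y] inner_well assms by (cases "y = a1") auto
  then have gt: "\<kappa> * \<theta> \<le> f y - f \<alpha>" using \<alpha> by simp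
  then have "\<not> y \<le> \<alpha>" using strict_mono_f[of y \<alpha>] kt \<alpha>(2) inner_well(1) assms(1) by (cases "\<alpha> = y") auto
  then have "f y - f \<alpha> \<le> \<kappa> * (y - \<alpha>)" by (intro slope_le assms \<alpha>) simp
  also have "\<dots> < \<kappa> * \<theta>" using \<open>\<not> a < y - \<theta>\<close> \<alpha> k by (intro mult_strict_left_mono) auto
  finally show False using gt by simp
qed

lemma outside_level:
  assumes "y \<in> {-1/2<..<1/2}" "y \<notin> {a1<..<b1}" shows "1 \<le> \<bar>f y - f x0\<bar>"
proof -
  have "y \<notin> level_nbhd f x0 1" using assms wells by simp
  then show ?thesis using assms by (auto simp: level_nbhd_def)
qed

text \<open>Lipschitz continuity of \<open>1 / (f x0 - f)\<close>, multiplied by the two denominators.\<close>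
lemma recip_gap_step:
  assumes "b1 < y" "y < z" "z < a1 + 1" "y \<noteq> 1/2" "z \<noteq> 1/2" "f y = u" "f z = w"
    and uw: "1 \<le> \<bar>u - f x0\<bar>" "1 \<le> \<bar>w - f x0\<bar>"
  shows "\<bar>w - u\<bar> \<le> \<kappa> * (z - y) * max 1 \<bar>u - f x0\<bar> * max 1 \<bar>w - f x0\<bar>"
proof -
  have "\<bar>1 / (f x0 - w) - 1 / (f x0 - u)\<bar> \<le> \<kappa> * (z - y)"
    using recip[OF assms(1-3)] assms(4-7) by (simp add: recip_gap_def)
  moreover have "1 / (f x0 - w) - 1 / (f x0 - u) = (w - u) / ((f x0 - w) * (f x0 - u))"
    using uw by (subst diff_frac_eq) auto
  ultimately have "\<bar>w - u\<bar> \<le> \<kappa> * (z - y) * (\<bar>f x0 - w\<bar> * \<bar>f x0 - u\<bar>)"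
    using uw by (simp add: abs_mult divide_le_eq)
  then show ?thesis using uw by (simp add: abs_minus_commute mult_ac max_def)
qed

text \<open>A short step stays within level \<open>2\<close>, where \<open>f\<close> is Lipschitz, or outside level \<open>1\<close>, where its
  reciprocal gap is. The second alternative includes the passage through the pole at \<open>1/2\<close>.\<close>
lemma potential_shift_pos:
  assumes y: "y \<in> {-1/2<..<1/2}" "y' \<in> {-1/2<..<1/2}" and \<theta>: "0 < \<theta>" "\<kappa> * \<theta> < 1"
    and y': "y' = y + \<theta> \<or> y' = y + \<theta> - 1"
  shows "\<bar>f y' - f y\<bar> \<le> \<kappa> * \<theta> * max 1 \<bar>f y - f x0\<bar> * max 1 \<bar>f y' - f x0\<bar>"
proof -
  have inside: ?thesis if "a < y" "y + \<theta> < b"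
  proof -
    have "y' = y + \<theta>" using y' y that wells_subset by auto
    then have d: "\<bar>f y' - f y\<bar> \<le> \<kappa> * \<theta>"
      using slope_le[of y y'] strict_mono_f[of y y'] that \<theta> by auto
    have "\<kappa> * \<theta> * 1 * 1 \<le> \<kappa> * \<theta> * max 1 \<bar>f y - f x0\<bar> * max 1 \<bar>f y' - f x0\<bar>"
      using kappa_ge_D D \<theta> by (intro mult_mono) auto
    then show ?thesis using d by simp
  qed
  \<comment> \<open>In the second and third case the step stays outside level 1; in the third case it lies left of
    the well and is moved by one period into the domain of the reciprocal gap.\<close>
  consider "a1 \<le> y" "y \<le> b1" | "b1 < y" | "y < a1" "y + \<theta> < a1" | "y < a1" "a1 \<le> y + \<theta>" by linarith
  then show ?thesis
  proof cases
    case 1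
    then show ?thesis using step_stays_below[of y \<theta>] \<theta> inner_well inside by auto
  next
    case 2
    have z: "y + \<theta> < a1 + 1"
    proof -
      have "a < a1 - \<theta>" using step_stays_above[of a1 \<theta>] \<theta> inner_well wells_subset by auto
      then show ?thesis using y wells_subset by auto
    qed
    have "y' \<notin> {a1<..<b1}" using y' z 2 \<theta> by auto
    moreover have "f (y + \<theta>) = f y'"
      using y' sawtooth_period[OF saw half_not_Ints[of y'], of 1] y by auto
    ultimately show ?thesis
      using recip_gap_step[of y "y + \<theta>" "f y" "f y'"] 2 z \<theta> y y' outside_level[of y] outside_level[of y']
      by auto
  next
    case 3
    then have y'': "y' = y + \<theta>" using y' y wells_subset by auto
    have "f (y + 1) = f y" "f (y' + 1) = f y'"
      using sawtooth_period[OF saw half_not_Ints, of y 1] sawtooth_period[OF saw half_not_Ints, of y' 1] y by auto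
    moreover have "y \<notin> {a1<..<b1}" "y' \<notin> {a1<..<b1}" using 3 y'' by auto
    ultimately show ?thesis
      using recip_gap_step[of "y + 1" "y' + 1" "f y" "f y'"] 3 y'' \<theta> y outside_level[of y] outside_level[of y']
        wells_subset inner_well by auto
  next
    case 4
    have "a < a1 - \<theta>" using step_stays_above[of a1 \<theta>] \<theta> inner_well wells_subset by auto
    moreover have "a1 + \<theta> < b" using step_stays_below[of a1 \<theta>] \<theta> inner_well wells_subset by auto
    ultimately show ?thesis using inside 4 by auto
  qed
qed

lemma level_distance:
  assumes "x \<in> {-1/2<..<1/2}" "\<bar>f x - f x0\<bar> < 1"
  shows "D * \<bar>x - x0\<bar> \<le> \<bar>f x - f x0\<bar>"
proof -
  have "x \<in> level_nbhd f x0 2" using assms by (auto simp: level_nbhd_def)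
  then have "a < x" "x < b" using wells by auto
  then show ?thesis
    using slope_ge[of x x0] slope_ge[of x0 x] wells_subset by (cases x x0 rule: linorder_cases) auto
qed

text \<open>If the translation is not shorter than \<open>1 / \<kappa>\<close>, the estimate is trivial: the right-hand side is
  then at least \<open>\<bar>f y - f x0\<bar> + \<bar>f y' - f x0\<bar>\<close>.\<close>
lemma potential_shift:
  assumes x: "x \<in> {-1/2<..<1/2}" "\<bar>f x - f x0\<bar> < 1"
    and y: "y \<in> {-1/2<..<1/2}" "y' \<in> {-1/2<..<1/2}" "y' - y - (x - x0) \<in> \<int>"
  shows "\<bar>f y' - f y\<bar> \<le> 2 * (\<kappa> / D) * \<bar>f x - f x0\<bar> * max 1 \<bar>f y - f x0\<bar> * max 1 \<bar>f y' - f x0\<bar>"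
proof -
  let ?m = "max 1 \<bar>f y - f x0\<bar> * max 1 \<bar>f y' - f x0\<bar>"
  let ?\<theta> = "\<bar>x - x0\<bar>"
  have m: "1 \<le> ?m" by (smt (verit) mult_le_cancel_left1 max.cobounded1)
  have k: "0 < \<kappa>" using kappa_ge_D D by linarith
  have "\<bar>f y' - f y\<bar> \<le> 2 * (\<kappa> * ?\<theta>) * ?m"
  proof (cases "\<kappa> * ?\<theta> < 1")
    case False
    have "\<bar>f y' - f y\<bar> \<le> max 1 \<bar>f y - f x0\<bar> + max 1 \<bar>f y' - f x0\<bar>" by linarith
    also have "\<dots> \<le> 2 * 1 * ?m"
    proof -
      have "p + q \<le> 2 * 1 * (p * q)" if "1 \<le> p" "1 \<le> q" for p q :: real
      proof -
        have "1 * q \<le> p * q" "p * 1 \<le> p * q" using that by (auto intro!: mult_mono)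
        then show ?thesis by linarith
      qed
      then show ?thesis by simp
    qed
    also have "\<dots> \<le> 2 * (\<kappa> * ?\<theta>) * ?m" using False m by (intro mult_right_mono mult_left_mono) auto
    finally show ?thesis .
  next
    case True
    have "?\<theta> \<le> \<kappa> * ?\<theta>" using mult_right_mono[of 1 \<kappa> ?\<theta>] kappa_ge_D D by auto
    then have "?\<theta> < 1" using True by linarith
    obtain k where k': "y' - y - (x - x0) = of_int k" using y(3) by (auto elim: Ints_cases)
    have "\<bar>f y' - f y\<bar> \<le> \<kappa> * ?\<theta> * ?m"
    proof (cases x x0 rule: linorder_cases)
      case equal
      then have "-1 < real_of_int k" "real_of_int k < 1" using k' y by auto
      then have "k = 0" by linarith
      then show ?thesis using equal k' by simp
    next
      case greater
      then have "-2 < real_of_int k" "real_of_int k < 1" using k' y \<open>?\<theta> < 1\<close> by auto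
      then have "k = 0 \<or> k = -1" by linarith
      then have "y' = y + ?\<theta> \<or> y' = y + ?\<theta> - 1" using k' greater by auto
      then show ?thesis using potential_shift_pos[of y y' ?\<theta>] y greater True by (auto simp: mult_ac)
    next
      case less
      then have "-1 < real_of_int k" "real_of_int k < 2" using k' y \<open>?\<theta> < 1\<close> by auto
      then have "k = 0 \<or> k = 1" by linarith
      then have "y = y' + ?\<theta> \<or> y = y' + ?\<theta> - 1" using k' less by auto
      then show ?thesis using potential_shift_pos[of y' y ?\<theta>] y less True
        by (auto simp: mult_ac abs_minus_commute)
    qed
    also have "\<dots> \<le> 2 * (\<kappa> * ?\<theta>) * ?m" using k m by simp
    finally show ?thesis .
  qed
  also have "\<dots> \<le> 2 * (\<kappa> / D * \<bar>f x - f x0\<bar>) * ?m"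
  proof (intro mult_right_mono mult_left_mono)
    have "?\<theta> \<le> \<bar>f x - f x0\<bar> / D" using level_distance[OF x] D by (simp add: field_simps)
    then have "\<kappa> * ?\<theta> \<le> \<kappa> * (\<bar>f x - f x0\<bar> / D)" using k by (intro mult_left_mono) auto
    then show "\<kappa> * ?\<theta> \<le> \<kappa> / D * \<bar>f x - f x0\<bar>" by simp
  qed (use m in auto)
  finally show ?thesis by (simp add: mult_ac)
qed

end

text \<open>At \<open>1/2\<close> the potential tends to \<open>\<infinity>\<close> from the left and, by periodicity, to \<open>-\<infinity>\<close> from the right; both
  give the limit \<open>0\<close>.\<close>
lemma continuous_recip_gap:
  assumes saw: "sawtooth_potential f" and x0: "x0 \<in> {-1/2<..<1/2}"
    and well: "level_nbhd f x0 1 = {a1<..<b1}"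
  shows "continuous_on {b1<..<a1 + 1} (recip_gap f x0)"
proof -
  have cont: "continuous_on {-1/2<..<1/2} f" and lims: "filterlim f at_bot (at_right (-1/2))" "filterlim f at_top (at_left (1/2))"
    using saw by (auto simp: sawtooth_potential_def)
  have "x0 \<in> level_nbhd f x0 1" using x0 by (auto simp: level_nbhd_def)
  then have ab: "a1 < x0" "x0 < b1" unfolding well by auto
  have off: "f y \<noteq> f x0" if "y \<in> {-1/2<..<1/2}" "y \<notin> {a1<..<b1}" for y
    using that unfolding well[symmetric] by (auto simp: level_nbhd_def)
  have per: "f y = f (y - 1)" if "1/2 < y" "y < 3/2" for y
    using sawtooth_period[OF saw half_not_Ints, of "y - 1" 1] that by simp
  have left: "continuous_on {b1<..<1/2} (recip_gap f x0)"
  proof -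
    have "f x0 - f x \<noteq> 0" if "x \<in> {b1<..<1/2}" for x using off[of x] that x0 ab by auto
    then have "continuous_on {b1<..<1/2} (\<lambda>x. 1 / (f x0 - f x))"
      using x0 ab by (intro continuous_intros continuous_on_subset[OF cont]) auto
    then show ?thesis by (rule continuous_on_eq) (auto simp: recip_gap_def)
  qed
  have right: "continuous_on {1/2<..<a1 + 1} (recip_gap f x0)"
  proof -
    have "continuous_on {1/2<..<a1 + 1} (\<lambda>x. f (x - 1))"
      by (rule continuous_on_compose2[OF cont]) (use x0 ab in \<open>auto intro!: continuous_intros\<close>)
    moreover have "f x0 - f (x - 1) \<noteq> 0" if "x \<in> {1/2<..<a1 + 1}" for x
      using off[of "x - 1"] that x0 ab by auto
    ultimately have "continuous_on {1/2<..<a1 + 1} (\<lambda>x. 1 / (f x0 - f (x - 1)))"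
      by (intro continuous_intros) auto
    then show ?thesis by (rule continuous_on_eq) (use per x0 ab in \<open>auto simp: recip_gap_def\<close>)
  qed
  have mid: "isCont (recip_gap f x0) (1/2)"
  proof -
    have "((\<lambda>x. 1 / (f x0 - f x)) \<longlongrightarrow> 0) (at_left (1/2))"
    proof -
      have "filterlim (\<lambda>x. - f x0 + f x) at_top (at_left (1/2))"
        by (rule filterlim_tendsto_add_at_top[OF tendsto_const lims(2)])
      then have "((\<lambda>x. inverse (- f x0 + f x)) \<longlongrightarrow> 0) (at_left (1/2))"
        by (rule tendsto_inverse_0_at_top)
      then have "((\<lambda>x. - inverse (- f x0 + f x)) \<longlongrightarrow> 0) (at_left (1/2))" using tendsto_minus by fastforce
      moreover have "- inverse (- f x0 + f x) = 1 / (f x0 - f x)" for x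
        by (simp add: inverse_eq_divide) (metis minus_diff_eq minus_divide_right)
      ultimately show ?thesis by simp
    qed
    then have l: "(recip_gap f x0 \<longlongrightarrow> 0) (at_left (1/2))"
      by (rule Lim_transform_eventually) (auto simp: recip_gap_def eventually_at_filter)
    have "filterlim (\<lambda>x. f (x - 1)) at_bot (at_right (1/2))"
      using lims(1) filterlim_at_right_to_0[of f at_bot "-1/2"] filterlim_at_right_to_0[of "\<lambda>x. f (x - 1)" at_bot "1/2"]
      by (simp add: algebra_simps)
    then have "filterlim (\<lambda>x. f x0 + - f (x - 1)) at_top (at_right (1/2))"
      by (intro filterlim_tendsto_add_at_top[OF tendsto_const]) (simp add: filterlim_uminus_at_top)
    then have "((\<lambda>x. inverse (f x0 + - f (x - 1))) \<longlongrightarrow> 0) (at_right (1/2))"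
      by (rule tendsto_inverse_0_at_top)
    moreover have "eventually (\<lambda>x. inverse (f x0 + - f (x - 1)) = recip_gap f x0 x) (at_right (1/2))"
      unfolding eventually_at_right_field
      by (intro exI[of _ "3/2"]) (auto simp: recip_gap_def per inverse_eq_divide)
    ultimately have r: "(recip_gap f x0 \<longlongrightarrow> 0) (at_right (1/2))"
      by (rule Lim_transform_eventually)
    show ?thesis unfolding isCont_def using filterlim_split_at[OF l r] by (simp add: recip_gap_def)
  qed
  show ?thesis
  proof (rule continuous_at_imp_continuous_on, rule ballI)
    fix x assume x: "x \<in> {b1<..<a1 + 1}"
    consider "x \<in> {b1<..<1/2}" | "x = 1/2" | "x \<in> {1/2<..<a1 + 1}" using x by fastforce
    then show "isCont (recip_gap f x0) x"
    proof cases
      case 2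
      show ?thesis unfolding 2 by (rule mid)
    qed (use left right in \<open>auto simp: continuous_on_eq_continuous_at\<close>)
  qed
qed

text \<open>The minimal slope is finite, since otherwise chords would be arbitrarily steep. Hence the bounds on
  derivative numbers integrate to Lipschitz bounds, and \<open>1 \<le> C\<close> follows by comparing them.\<close>
lemma regular_potential_well:
  assumes saw: "sawtooth_potential f" and x0: "x0 \<in> {-1/2<..<1/2}"
    and reg: "regular_at C f x0" and D: "D_min f x0 \<ge> 1"
  obtains a b a1 b1 D where "potential_well f x0 a b a1 b1 D (C * D)" "1 \<le> C"
proof -
  obtain a b a1 b1 where r: "level_nbhd f x0 2 = {a<..<b}" "bij_betw f {a<..<b} {f x0 - 2<..<f x0 + 2}"
    "\<And>x D. x \<in> {a<..<b} \<Longrightarrow> derivative_number f x D \<Longrightarrow> D_min f x0 \<le> D \<and> D \<le> ereal C * D_min f x0"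
    "level_nbhd f x0 1 = {a1<..<b1}"
    "\<And>x D. x \<in> {b1<..<a1 + 1} \<Longrightarrow> derivative_number (recip_gap f x0) x D \<Longrightarrow> \<bar>D\<bar> \<le> ereal C * D_min f x0"
    using reg unfolding regular_at_def by blast
  have cont: "continuous_on {-1/2<..<1/2} f" using saw by (simp add: sawtooth_potential_def)
  have "{a<..<b} \<subseteq> {-1/2<..<1/2}" unfolding r(1)[symmetric] by (auto simp: level_nbhd_def)
  then have contab: "continuous_on {x..y} f" if "a < x" "y < b" for x y
    using that by (intro continuous_on_subset[OF cont]) (auto simp: subset_iff)
  have "x0 \<in> level_nbhd f x0 2" using x0 by (auto simp: level_nbhd_def)
  then have ab: "a < x0" "x0 < b" unfolding r(1) by auto
  have low: "K * (y - x) \<le> f y - f x" if "a < x" "x < y" "y < b" "ereal K \<le> D_min f x0" for K x y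
  proof (rule mean_value_derivative_number_lower[OF that(2) contab[OF that(1,3)]])
    fix t E assume "t \<in> {x..<y}" "derivative_number f t E"
    then have "D_min f x0 \<le> E" using r(3)[of t E] that by auto
    then show "ereal K \<le> E" using that(4) by (rule order_trans[rotated])
  qed
  have "D_min f x0 \<noteq> \<infinity>"
  proof
    assume "D_min f x0 = \<infinity>"
    define t where "t = (x0 + b) / 2"
    have t: "x0 < t" "t < b" using ab by (auto simp: t_def)
    have "K * (t - x0) \<le> f t - f x0" for K
      using low[of x0 t K] ab t \<open>D_min f x0 = \<infinity>\<close> by auto
    from this[of "(f t - f x0 + 1) / (t - x0)"] show False using t by simp
  qed
  then obtain d where d: "D_min f x0 = ereal d" "1 \<le> d"
    using D by (cases "D_min f x0") auto
  have well: "potential_well f x0 a b a1 b1 d (C * d)"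
  proof
    show "f y - f x \<le> C * d * (y - x)" if "a < x" "x < y" "y < b" for x y
    proof (rule mean_value_derivative_number[OF that(2) contab[OF that(1,3)]])
      fix t E assume "t \<in> {x..<y}" "derivative_number f t E"
      then show "E \<le> ereal (C * d)" using r(3)[of t E] that d by auto
    qed
    show "\<bar>recip_gap f x0 y - recip_gap f x0 x\<bar> \<le> C * d * (y - x)" if xy: "b1 < x" "x < y" "y < a1 + 1" for x y
    proof -
      have c: "continuous_on {x..y} (recip_gap f x0)"
        using xy by (intro continuous_on_subset[OF continuous_recip_gap[OF saw x0 r(4)]]) auto
      have bd: "\<bar>E\<bar> \<le> ereal (C * d)" if "t \<in> {x..<y}" "derivative_number (recip_gap f x0) t E" for t E
        using r(5)[of t E] that xy d by auto
      have "recip_gap f x0 y - recip_gap f x0 x \<le> C * d * (y - x)"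
      proof (rule mean_value_derivative_number[OF xy(2) c])
        fix t E assume "t \<in> {x..<y}" "derivative_number (recip_gap f x0) t E"
        from bd[OF this] show "E \<le> ereal (C * d)" by (cases E) auto
      qed
      moreover have "(- (C * d)) * (y - x) \<le> recip_gap f x0 y - recip_gap f x0 x"
      proof (rule mean_value_derivative_number_lower[OF xy(2) c])
        fix t E assume "t \<in> {x..<y}" "derivative_number (recip_gap f x0) t E"
        from bd[OF this] show "ereal (- (C * d)) \<le> E" by (cases E) auto
      qed
      ultimately show ?thesis by (auto simp: abs_le_iff)
    qed
  qed (use saw x0 r d low in auto)
  moreover have "1 \<le> C"
    using potential_well.kappa_ge_D[OF well] d(2) by (simp add: mult_le_cancel_right1)
  ultimately show ?thesis by (rule that)
qed

section \<open>The quasiperiodic lattice potential\<close>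

text \<open>This is \<open>y \<le> exp y\<close> for \<open>y = l * ln 2 / \<tau>\<close>, raised to the power \<open>\<tau>\<close>.\<close>
lemma half_power_le_powr:
  fixes l :: nat
  assumes "1 \<le> l" "0 < \<tau>"
  shows "(1/2) ^ l \<le> (ln 2 / \<tau>) powr (- \<tau>) * real l powr (- \<tau>)"
proof -
  let ?y = "real l * ln 2 / \<tau>"
  have "?y \<le> exp ?y" by (rule order_trans[OF _ exp_ge_add_one_self]) simp
  then have "?y powr \<tau> \<le> exp ?y powr \<tau>"
    using assms by (intro powr_mono2) auto
  also have "\<dots> = 2 ^ l" using assms by (simp add: powr_def exp_of_nat_mult)
  finally have "inverse (2 ^ l) \<le> inverse (?y powr \<tau>)"
    using assms by (intro le_imp_inverse_le) auto
  also have "inverse (?y powr \<tau>) = (ln 2 / \<tau>) powr (- \<tau>) * real l powr (- \<tau>)"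
    using assms by (simp add: powr_minus powr_mult powr_divide field_simps)
  finally show ?thesis by (simp add: power_divide field_simps)
qed

lemma lattice_dot_add: "lattice_dot (m + n) \<omega> = lattice_dot m \<omega> + lattice_dot n \<omega>"
  by (simp add: lattice_dot_def real_vec_def inner_vec_def algebra_simps sum.distrib)

lemma lattice_dot_diff: "lattice_dot (m - n) \<omega> = lattice_dot m \<omega> - lattice_dot n \<omega>"
  using lattice_dot_add[of "m - n" n \<omega>] by simp

lemma lattice_dot_0 [simp]: "lattice_dot 0 \<omega> = 0"
  using lattice_dot_add[of 0 0 \<omega>] by simp

lemma real_vec_add: "real_vec (m + n) = real_vec m + real_vec n"
  by (vector real_vec_def)

lemma real_vec_0 [simp]: "real_vec 0 = 0"
  using real_vec_add[of 0 0] by simp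

lemma real_vec_eq_0_iff [simp]: "real_vec n = 0 \<longleftrightarrow> n = 0"
  by (simp add: real_vec_def vec_eq_iff)

lemma walk_norm_le:
  fixes S :: "(int ^ 'd::finite) set"
  assumes "\<And>h. h \<in> S \<Longrightarrow> norm (real_vec h) \<le> R" "walk S x w"
  shows "norm (real_vec (last (x # w) - x)) \<le> R * real (length w)"
  using assms(2)
proof (induction w arbitrary: x)
  case (Cons y w)
  have "real_vec (last (y # w) - x) = real_vec (last (y # w) - y) + real_vec (y - x)"
    by (simp flip: real_vec_add)
  then have "norm (real_vec (last (y # w) - x)) \<le> R * real (length w) + R"
    using Cons.IH[of y] assms(1)[of "y - x"] Cons.prems norm_triangle_ineq[of "real_vec (last (y # w) - y)" "real_vec (y - x)"]
    by auto
  then show ?case by (simp add: algebra_simps)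
qed simp

lemma walk_nth: "walk S x w \<Longrightarrow> j < length w \<Longrightarrow> w ! j - (x # w) ! j \<in> S"
proof (induction w arbitrary: x j)
  case (Cons y w)
  then show ?case by (cases j) auto
qed simp

lemma walk_reflect: "(\<And>n. n \<in> S \<Longrightarrow> - n \<in> S) \<Longrightarrow> walk S x w \<Longrightarrow> walk S (- x) (map uminus w)"
proof (induction w arbitrary: x)
  case (Cons y w)
  have "- (y - x) \<in> S" using Cons.prems(2) by (intro Cons.prems(1)) simp
  then show ?case using Cons by simp
qed simp

lemma reach_reverse:
  assumes "\<And>n. n \<in> S \<Longrightarrow> - n \<in> S" "reach S l 0 n"
  shows "reach S l n 0"
proof -
  obtain w where w: "walk S 0 w" "length w \<le> l" "last (0 # w) = n" using assms(2) unfolding reach_def by blast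
  have "walk S 0 (map uminus w)" using walk_reflect[OF assms(1) w(1)] by simp
  moreover have "last (0 # map uminus w) = - n" using w(3) by (cases "w = []") (auto simp: last_map)
  ultimately have "reach S l 0 (- n)" unfolding reach_def using w(2) by (intro exI[of _ "map uminus w"]) simp
  then show ?thesis using reach_shift[of S l 0 "- n" n] by simp
qed

lemma hop_dist_le:
  assumes "reach {n. \<phi> n \<noteq> 0} l x y"
  shows "hop_dist \<phi> x y \<le> enat l"
proof -
  obtain w where w: "walk {n. \<phi> n \<noteq> 0} x w" "length w \<le> l" "last (x # w) = y"
    using assms unfolding reach_def by blast
  have "(x # w) ! length w = y" using w(3) last_conv_nth[of "x # w"] by simp
  then have "hop_dist \<phi> x y \<le> enat (length w)"
    unfolding hop_dist_def using walk_nth[OF w(1)]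
    by (intro Inf_lower CollectI exI[of _ "length w"] conjI refl exI[of _ "\<lambda>j. (x # w) ! j"]) auto
  then show ?thesis using w(2) by (meson enat_ord_simps(1) order_trans)
qed

lemma hop_dist_attained:
  assumes "hop_dist \<phi> k k' = enat l"
  obtains p where "p 0 = k" "p l = k'" "\<forall>j<l. \<phi> (p (Suc j) - p j) \<noteq> 0"
proof -
  let ?A = "{enat l | l. \<exists>p. p 0 = k \<and> p l = k' \<and> (\<forall>j<l. \<phi> (p (Suc j) - p j) \<noteq> 0)}"
  have "?A \<noteq> {}"
  proof
    assume "?A = {}"
    then have "hop_dist \<phi> k k' = \<infinity>" unfolding hop_dist_def by (simp only: Inf_enat_def) simp
    then show False using assms by simp
  qed
  then have "Inf ?A \<in> ?A" unfolding Inf_enat_def using LeastI_ex[of "\<lambda>x. x \<in> ?A"] by auto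
  then show ?thesis using assms that unfolding hop_dist_def by auto
qed

text \<open>The distance function determines the support of the hopping, so constants that depend on the support
  only are functions of the distance.\<close>
lemma support_from_hop_dist:
  assumes "\<phi> 0 = 0"
  shows "{n. \<phi> n \<noteq> 0} = {n. hop_dist \<phi> 0 n = 1}"
proof (intro equalityI subsetI CollectI)
  fix n assume "n \<in> {n. \<phi> n \<noteq> 0}"
  then have n: "\<phi> n \<noteq> 0" "n \<noteq> 0" using assms by auto
  have "hop_dist \<phi> 0 n \<le> enat 1"
    by (rule hop_dist_le) (use n reach_step[of n 0 "{n. \<phi> n \<noteq> 0}" 0] in auto)
  then have "hop_dist \<phi> 0 n \<le> 1" by (simp add: one_enat_def)
  moreover have "hop_dist \<phi> 0 n \<noteq> 0"
  proof
    assume "hop_dist \<phi> 0 n = 0"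
    then have "hop_dist \<phi> 0 n = enat 0" by (simp add: zero_enat_def)
    then show False by (rule hop_dist_attained) (use n in auto)
  qed
  ultimately show "hop_dist \<phi> 0 n = 1"
    by (metis ileI1 iless_Suc_eq order_antisym one_eSuc not_gr_zero)
next
  fix n assume "n \<in> {n. hop_dist \<phi> 0 n = 1}"
  then have "hop_dist \<phi> 0 n = enat 1" by (simp add: one_enat_def)
  then obtain p where "p 0 = 0" "p 1 = n" "\<phi> (p (Suc 0) - p 0) \<noteq> 0"
    by (rule hop_dist_attained) auto
  then show "\<phi> n \<noteq> 0" by simp
qed

text \<open>If both sites are resonant, their phases are within \<open>2 * max \<bar>v m\<bar> \<bar>v n\<bar>\<close>, and the Diophantine condition
  bounds this below by the Euclidean distance, which is at most \<open>R\<close> times the number of hops. The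
  minimum with \<open>1\<close> covers the case of a non-resonant site.\<close>
lemma gap_condition_lattice:
  fixes S :: "(int ^ 'd::finite) set" and \<omega> :: "real ^ 'd"
  assumes dio: "diophantine Cd \<tau> \<omega>" "0 < Cd" "0 < \<tau>"
    and R: "\<And>h. h \<in> S \<Longrightarrow> norm (real_vec h) \<le> R" "1 \<le> R"
    and pos: "\<And>m n. \<bar>v m\<bar> < 1 \<Longrightarrow> \<bar>v n\<bar> < 1 \<Longrightarrow> infdist (lattice_dot (n - m) \<omega>) \<int> \<le> \<bar>v m\<bar> + \<bar>v n\<bar>"
  shows "gap_condition S v (min 1 (Cd * R powr (- \<tau>) / 2)) \<tau>"
  unfolding gap_condition_def
proof (intro allI impI)
  fix l and m n :: "int ^ 'd" assume reach: "reach S l m n" and "m \<noteq> n"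
  let ?c = "min 1 (Cd * R powr (- \<tau>) / 2)"
  have "l \<noteq> 0" using reach \<open>m \<noteq> n\<close> by (metis reach_0)
  then have l: "1 \<le> real l" by simp
  then have l1: "real l powr (- \<tau>) \<le> 1" using dio powr_mono[of "- \<tau>" 0 "real l"] by simp
  show "?c * real l powr (- \<tau>) \<le> max \<bar>v m\<bar> \<bar>v n\<bar>"
  proof (cases "\<bar>v m\<bar> < 1 \<and> \<bar>v n\<bar> < 1")
    case False
    have "?c * real l powr (- \<tau>) \<le> 1 * 1" using l1 R dio by (intro mult_mono) auto
    then show ?thesis using False by auto
  next
    case True
    obtain w where w: "walk S m w" "length w \<le> l" "last (m # w) = n" using reach unfolding reach_def by blast
    have nm: "n - m \<noteq> 0" using \<open>m \<noteq> n\<close> by simp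
    then have pos_norm: "0 < norm (real_vec (n - m))" by simp
    have "norm (real_vec (n - m)) \<le> R * real (length w)"
      using walk_norm_le[OF R(1) w(1)] w(3) by simp
    also have "\<dots> \<le> R * real l" using R w(2) by (intro mult_left_mono) auto
    finally have le: "norm (real_vec (n - m)) \<le> R * real l" .
    have "(R * real l) powr (- \<tau>) \<le> norm (real_vec (n - m)) powr (- \<tau>)"
      using le pos_norm dio by (intro powr_mono2') auto
    then have "Cd * (R powr (- \<tau>) * real l powr (- \<tau>)) \<le> Cd * norm (real_vec (n - m)) powr (- \<tau>)"
      using dio R by (simp add: powr_mult)
    also have "\<dots> \<le> infdist (lattice_dot (n - m) \<omega>) \<int>" using dio(1) nm unfolding diophantine_def by blast
    also have "\<dots> \<le> 2 * max \<bar>v m\<bar> \<bar>v n\<bar>" using pos[of m n] True by linarith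
    finally have "Cd * R powr (- \<tau>) / 2 * real l powr (- \<tau>) \<le> max \<bar>v m\<bar> \<bar>v n\<bar>" by simp
    moreover have "?c * real l powr (- \<tau>) \<le> Cd * R powr (- \<tau>) / 2 * real l powr (- \<tau>)"
      by (intro mult_right_mono) auto
    ultimately show ?thesis by linarith
  qed
qed

definition rel_pot :: "(real \<Rightarrow> real) \<Rightarrow> real ^ 'd::finite \<Rightarrow> real \<Rightarrow> int ^ 'd \<Rightarrow> real" where
  "rel_pot f \<omega> x0 n = f (x0 + lattice_dot n \<omega>) - f x0"

text \<open>Reducing the phases \<open>x0 + n \<bullet> \<omega>\<close> modulo \<open>1\<close> transfers the estimates from the circle to the lattice. The
  slope of the potential is at least \<open>1\<close> near \<open>x0\<close>, so resonance of \<open>n\<close> bounds the distance of its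
  phase from \<open>x0\<close>.\<close>
lemma lattice_potential:
  fixes \<omega> :: "real ^ 'd::finite"
  assumes dio: "diophantine Cd \<tau> \<omega>" "0 < Cd"
    and saw: "sawtooth_potential f" and x0: "x0 \<in> {-1/2<..<1/2}"
    and orbit: "\<And>(k::int) n. x0 \<noteq> of_int k + 1/2 + lattice_dot n \<omega>"
    and reg: "regular_at C f x0" "D_min f x0 \<ge> 1"
  shows "1 \<le> C" and "\<And>n. n \<noteq> 0 \<Longrightarrow> rel_pot f \<omega> x0 n \<noteq> 0"
    and "\<And>m n. \<bar>rel_pot f \<omega> x0 m\<bar> < 1 \<Longrightarrow> \<bar>rel_pot f \<omega> x0 n\<bar> < 1 \<Longrightarrow>
      infdist (lattice_dot (n - m) \<omega>) \<int> \<le> \<bar>rel_pot f \<omega> x0 m\<bar> + \<bar>rel_pot f \<omega> x0 n\<bar>"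
    and "\<And>p e. \<bar>rel_pot f \<omega> x0 p\<bar> < 1 \<Longrightarrow> \<bar>rel_pot f \<omega> x0 (p + e) - rel_pot f \<omega> x0 e\<bar> \<le>
      2 * C * \<bar>rel_pot f \<omega> x0 p\<bar> * max 1 \<bar>rel_pot f \<omega> x0 e\<bar> * max 1 \<bar>rel_pot f \<omega> x0 (p + e)\<bar>"
proof -
  let ?v = "rel_pot f \<omega> x0"
  obtain a b a1 b1 D where well: "potential_well f x0 a b a1 b1 D (C * D)" and C: "1 \<le> C"
    by (rule regular_potential_well[OF saw x0 reg])
  interpret potential_well f x0 a b a1 b1 D "C * D" by (rule well)
  show "1 \<le> C" by (rule C)
  \<comment> \<open>The representative of the phase in (-1/2, 1/2).\<close>
  define y where "y n = frac (x0 + lattice_dot n \<omega> + 1/2) - 1/2" for n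
  have yk: "\<exists>k::int. x0 + lattice_dot n \<omega> = y n + of_int k" for n
    by (intro exI[of _ "\<lfloor>x0 + lattice_dot n \<omega> + 1/2\<rfloor>"]) (simp add: y_def frac_def)
  have y: "y n \<in> {-1/2<..<1/2}" for n
  proof -
    have "x0 + lattice_dot n \<omega> + 1/2 \<notin> \<int>"
    proof
      assume "x0 + lattice_dot n \<omega> + 1/2 \<in> \<int>"
      then obtain k :: int where "x0 + lattice_dot n \<omega> + 1/2 = of_int k" by (auto elim: Ints_cases)
      then have "x0 = of_int (k - 1) + 1/2 + lattice_dot (0 - n) \<omega>" by (simp only: lattice_dot_diff) simp
      then show False using orbit by blast
    qed
    then have "0 < frac (x0 + lattice_dot n \<omega> + 1/2)" by (simp add: frac_gt_0_iff)
    moreover have "frac (x0 + lattice_dot n \<omega> + 1/2) < 1" by (rule frac_lt_1)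
    ultimately show ?thesis by (simp add: y_def)
  qed
  have vy: "?v n = f (y n) - f x0" for n
  proof -
    obtain k :: int where "x0 + lattice_dot n \<omega> = y n + of_int k" using yk by blast
    then show ?thesis using sawtooth_period[OF saw half_not_Ints, of "y n" k] y[of n] by (simp add: rel_pot_def)
  qed
  have near: "\<bar>y n - x0\<bar> \<le> \<bar>?v n\<bar>" if "\<bar>?v n\<bar> < 1" for n
  proof -
    have "1 * \<bar>y n - x0\<bar> \<le> D * \<bar>y n - x0\<bar>" using D by (intro mult_right_mono) auto
    also have "\<dots> \<le> \<bar>?v n\<bar>" using level_distance[OF y, of n] that by (simp add: vy)
    finally show ?thesis by simp
  qed
  have id: "infdist (lattice_dot (n - m) \<omega>) \<int> \<le> \<bar>y n - y m\<bar>" for m n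
  proof -
    obtain k l :: int where "x0 + lattice_dot n \<omega> = y n + of_int k" "x0 + lattice_dot m \<omega> = y m + of_int l" using yk by metis
    then have "dist (lattice_dot (n - m) \<omega>) (of_int (k - l)) = \<bar>y n - y m\<bar>"
      by (simp add: lattice_dot_diff dist_real_def)
    then show ?thesis by (metis Ints_of_int infdist_le)
  qed
  show 2: "infdist (lattice_dot (n - m) \<omega>) \<int> \<le> \<bar>?v m\<bar> + \<bar>?v n\<bar>"
    if "\<bar>?v m\<bar> < 1" "\<bar>?v n\<bar> < 1" for m n
    using id[of n m] near[OF that(1)] near[OF that(2)] by linarith
  show "?v n \<noteq> 0" if "n \<noteq> 0" for n
  proof
    assume "?v n = 0"
    then have "infdist (lattice_dot n \<omega>) \<int> \<le> 0" using 2[of 0 n] by (simp add: rel_pot_def)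
    moreover have "Cd * norm (real_vec n) powr (- \<tau>) \<le> infdist (lattice_dot n \<omega>) \<int>"
      using dio(1) that unfolding diophantine_def by blast
    moreover have "0 < Cd * norm (real_vec n) powr (- \<tau>)" using dio(2) that by simp
    ultimately show False by linarith
  qed
  show "\<bar>?v (p + e) - ?v e\<bar> \<le> 2 * C * \<bar>?v p\<bar> * max 1 \<bar>?v e\<bar> * max 1 \<bar>?v (p + e)\<bar>"
    if "\<bar>?v p\<bar> < 1" for p e
  proof -
    have "y (p + e) - y e - (y p - x0) \<in> \<int>"
    proof -
      obtain k l m :: int where "x0 + lattice_dot (p + e) \<omega> = y (p + e) + of_int k"
        "x0 + lattice_dot e \<omega> = y e + of_int l" "x0 + lattice_dot p \<omega> = y p + of_int m" using yk by metis
      then have "y (p + e) - y e - (y p - x0) = of_int (l + m - k)" by (simp add: lattice_dot_add)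
      then show ?thesis by (metis Ints_of_int)
    qed
    from potential_shift[OF y _ y y this] that D show ?thesis by (simp add: vy)
  qed
qed

section \<open>Convergence of the series\<close>

lemma hop_op_eq:
  assumes "finite {m. \<phi> m \<noteq> 0}"
  shows "hop_op \<phi> \<psi> n = (\<Sum>m | \<phi> m \<noteq> 0. \<phi> m * \<psi> (n - m))"
proof -
  have "hop_op \<phi> \<psi> n = (\<Sum>\<^sub>\<infinity>m\<in>(\<lambda>m. n - m) ` {m. \<phi> m \<noteq> 0}. \<phi> (n - m) * \<psi> m)"
    unfolding hop_op_def
  proof (rule infsum_cong_neutral)
    fix m assume m: "m \<in> UNIV - (\<lambda>m. n - m) ` {m. \<phi> m \<noteq> 0}"
    have "\<phi> (n - m) = 0"
    proof (rule ccontr)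
      assume "\<phi> (n - m) \<noteq> 0"
      then have "n - (n - m) \<in> (\<lambda>m. n - m) ` {m. \<phi> m \<noteq> 0}" by blast
      then show False using m by simp
    qed
    then show "\<phi> (n - m) * \<psi> m = 0" by simp
  qed auto
  also have "\<dots> = (\<Sum>m\<in>(\<lambda>m. n - m) ` {m. \<phi> m \<noteq> 0}. \<phi> (n - m) * \<psi> m)"
    using assms by (intro infsum_finite) auto
  also have "\<dots> = (\<Sum>m | \<phi> m \<noteq> 0. \<phi> m * \<psi> (n - m))"
    by (subst sum.reindex) (auto simp: inj_on_def)
  finally show ?thesis .
qed

lemma ell2_inner_basis: "ell2_inner (basis_vec k) \<psi> = \<psi> k"
proof -
  have "ell2_inner (basis_vec k) \<psi> = (\<Sum>\<^sub>\<infinity>n\<in>{k}. cnj (basis_vec k n) * \<psi> n)"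
    unfolding ell2_inner_def by (rule infsum_cong_neutral) (auto simp: basis_vec_def)
  then show ?thesis by (simp add: basis_vec_def)
qed

lemma ell2_finite_support: "finite {n. \<psi> n \<noteq> 0} \<Longrightarrow> ell2 \<psi>"
  unfolding ell2_def
  by (subst summable_on_cong_neutral[of "{n. \<psi> n \<noteq> 0}" UNIV "\<lambda>n. (cmod (\<psi> n))\<^sup>2" "\<lambda>n. (cmod (\<psi> n))\<^sup>2"])
     (auto intro: summable_on_finite)

lemma ell2_if_l1_bounded:
  fixes \<psi> :: "'a::zero \<Rightarrow> complex"
  assumes bd: "\<And>F. finite F \<Longrightarrow> 0 \<notin> F \<Longrightarrow> (\<Sum>n\<in>F. cmod (\<psi> n)) \<le> 1"
  shows "ell2 \<psi>"
  unfolding ell2_def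
proof (rule nonneg_bdd_above_summable_on)
  show "bdd_above (sum (\<lambda>n. (cmod (\<psi> n))\<^sup>2) ` {F. F \<subseteq> UNIV \<and> finite F})"
  proof (rule bdd_aboveI2)
    fix F :: "'a set" assume "F \<in> {F. F \<subseteq> UNIV \<and> finite F}"
    then have F: "finite F" by simp
    have "(\<Sum>n\<in>F. (cmod (\<psi> n))\<^sup>2) \<le> (\<Sum>n\<in>insert 0 F. (cmod (\<psi> n))\<^sup>2)"
      using F by (intro sum_mono2) auto
    also have "\<dots> = (cmod (\<psi> 0))\<^sup>2 + (\<Sum>n\<in>F - {0}. (cmod (\<psi> n))\<^sup>2)"
      using F by (subst sum.insert_remove) auto
    also have "(\<Sum>n\<in>F - {0}. (cmod (\<psi> n))\<^sup>2) \<le> (\<Sum>n\<in>F - {0}. cmod (\<psi> n))"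
    proof (rule sum_mono)
      fix n assume "n \<in> F - {0}"
      then have "cmod (\<psi> n) \<le> 1" using bd[of "{n}"] by simp
      then show "(cmod (\<psi> n))\<^sup>2 \<le> cmod (\<psi> n)"
        using mult_left_mono[of "cmod (\<psi> n)" 1 "cmod (\<psi> n)"] by (simp add: power2_eq_square)
    qed
    also have "(\<Sum>n\<in>F - {0}. cmod (\<psi> n)) \<le> 1" using F by (intro bd) auto
    finally show "(\<Sum>n\<in>F. (cmod (\<psi> n))\<^sup>2) \<le> (cmod (\<psi> 0))\<^sup>2 + 1" by simp
  qed
qed auto

lemma RS_series_step:
  assumes rs: "RS_series f \<omega> \<phi> x0 lam psi" and "0 < s"
  shows "pot_op f \<omega> x0 (psi s) n + hop_op \<phi> (psi (s - 1)) n =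
    of_real (f x0) * psi s n + ((\<Sum>j\<in>{0<..<s}. of_real (lam j) * psi (s - j) n) + of_real (lam s) * basis_vec 0 n)"
proof -
  have "{..s} = insert 0 (insert s {0<..<s})" using \<open>0 < s\<close> by auto
  then have "(\<Sum>j\<le>s. g j) = g 0 + ((\<Sum>j\<in>{0<..<s}. g j) + g s)" for g :: "nat \<Rightarrow> complex"
    using \<open>0 < s\<close> by (simp add: add.commute)
  moreover have "pot_op f \<omega> x0 (psi s) n + (if s = 0 then 0 else hop_op \<phi> (psi (s - 1)) n) =
      (\<Sum>j\<le>s. complex_of_real (lam j) * psi (s - j) n)" "lam 0 = f x0" "psi 0 = basis_vec 0"
    using rs unfolding RS_series_def by blast+
  ultimately show ?thesis using \<open>0 < s\<close> by simp
qed

lemma RS_series_at_0: "RS_series f \<omega> \<phi> x0 lam psi \<Longrightarrow> psi s 0 = of_bool (s = 0)"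
  unfolding RS_series_def ell2_inner_basis by (cases "s = 0") (auto simp: basis_vec_def)

text \<open>At order \<open>s\<close> the entry at \<open>0\<close> determines the eigenvalue coefficient, and the entry at \<open>n \<noteq> 0\<close>
  determines \<open>\<psi>\<^sub>s\<close> there, because \<open>f (x0 + n \<bullet> \<omega>) \<noteq> f x0\<close>.\<close>
lemma RS_series_unique:
  assumes orbit: "\<And>n. n \<noteq> 0 \<Longrightarrow> f (x0 + lattice_dot n \<omega>) \<noteq> f x0"
    and rs: "RS_series f \<omega> \<phi> x0 lam psi" "RS_series f \<omega> \<phi> x0 lam' psi'"
  shows "lam' = lam \<and> psi' = psi"
proof -
  note at0 = rs[THEN RS_series_at_0] and eq = rs[THEN RS_series_step]
  have "lam' s = lam s \<and> psi' s = psi s" for s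
  proof (induction s rule: less_induct)
    case (less s)
    show ?case
    proof (cases "s = 0")
      case True
      then show ?thesis using rs by (simp add: RS_series_def)
    next
      case False
      then have s: "0 < s" by simp
      have hop: "hop_op \<phi> (psi' (s - 1)) = hop_op \<phi> (psi (s - 1))" using less[of "s - 1"] s by simp
      have mid: "(\<Sum>j\<in>{0<..<s}. of_real (lam' j) * psi' (s - j) n) = (\<Sum>j\<in>{0<..<s}. of_real (lam j) * psi (s - j) n)" for n
        using less by (intro sum.cong) auto
      have "complex_of_real (lam' s) = of_real (lam s)"
        using eq[OF s, of 0] hop mid[of 0] by (simp add: at0 s pot_op_def basis_vec_def)
      then have lam: "lam' s = lam s" by simp
      have "psi' s n = psi s n" for n
      proof (cases "n = 0")
        case False
        let ?V = "complex_of_real (f (x0 + lattice_dot n \<omega>))" and ?E = "complex_of_real (f x0)"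
        define R where "R = (\<Sum>j\<in>{0<..<s}. of_real (lam j) * psi (s - j) n) - hop_op \<phi> (psi (s - 1)) n"
        have "?V * psi s n - ?E * psi s n = R" "?V * psi' s n - ?E * psi' s n = R"
          using eq[OF s, of n] hop mid[of n] False by (simp_all add: R_def pot_op_def basis_vec_def algebra_simps)
        then have "of_real (f (x0 + lattice_dot n \<omega>) - f x0) * (psi' s n - psi s n) = (0::complex)"
          by (simp add: left_diff_distrib right_diff_distrib)
        then show ?thesis using orbit[OF False] by (simp del: of_real_diff)
      qed (simp add: at0)
      then show ?thesis using lam by auto
    qed
  qed
  then show ?thesis by auto
qed

definition rs_lam :: "real \<Rightarrow> ('a::ab_group_add \<Rightarrow> real) \<Rightarrow> ('a \<Rightarrow> complex) \<Rightarrow> nat \<Rightarrow> real" where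
  "rs_lam E v h s = (if s = 0 then E else Re (rs_val v h s))"

lemma RS_series_rs_vec:
  fixes \<omega> :: "real ^ 'd::finite"
  assumes hop: "hopping \<phi>" and v': "\<And>n. n \<noteq> 0 \<Longrightarrow> rel_pot f \<omega> x0 n \<noteq> 0"
  shows "RS_series f \<omega> \<phi> x0 (rs_lam (f x0) (rel_pot f \<omega> x0) \<phi>) (rs_vec (rel_pot f \<omega> x0) \<phi>)"
proof -
  define v where "v = rel_pot f \<omega> x0"
  have v: "v n \<noteq> 0" if "n \<noteq> 0" for n using v' that by (simp add: v_def)
  have fin: "finite {n. \<phi> n \<noteq> 0}" and herm: "\<phi> (- n) = cnj (\<phi> n)" for n
    using hop by (auto simp: hopping_def)
  have v0: "v 0 = 0" by (simp add: v_def rel_pot_def)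
  have real: "of_real (Re (rs_val v \<phi> s)) = rs_val v \<phi> s" for s
    using rs_val_real[of \<phi> "{n. \<phi> n \<noteq> 0}" v s] fin v0 v herm by (simp add: of_real_Re)
  show ?thesis
    unfolding RS_series_def v_def[symmetric]
  proof (intro conjI allI impI)
    show "rs_lam (f x0) v \<phi> 0 = f x0" by (simp add: rs_lam_def)
    show "rs_vec v \<phi> 0 = basis_vec 0" by (rule ext) (simp add: basis_vec_def)
    show "ell2 (rs_vec v \<phi> s)" for s
    proof (rule ell2_finite_support, rule finite_subset)
      show "{n. rs_vec v \<phi> s n \<noteq> 0} \<subseteq> {n. reach {n. \<phi> n \<noteq> 0} s 0 n}"
        using rs_vec_reach[of \<phi> "{n. \<phi> n \<noteq> 0}" v s] by blast
    qed (rule finite_reach[OF fin])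
    show "ell2_inner (basis_vec 0) (rs_vec v \<phi> s) = 0" if "0 < s" for s
      using that by (simp add: ell2_inner_basis rs_vec_at_0)
    fix s n
    have "((rs_val_fps v \<phi> - fps_const (of_real (v n))) * rs_vec_fps v \<phi> n) $ s =
        (fps_X * (\<Sum>m | \<phi> m \<noteq> 0. fps_const (\<phi> m) * rs_vec_fps v \<phi> (n - m))) $ s"
      using rs_equation[of v n \<phi>] v0 v by simp
    moreover have "(rs_val_fps v \<phi> * rs_vec_fps v \<phi> n) $ s = (\<Sum>j\<le>s. rs_val v \<phi> j * rs_vec v \<phi> (s - j) n)"
      by (simp add: fps_mult_nth rs_val_fps_def rs_vec_fps_def atLeast0AtMost)
    moreover have "(fps_X * (\<Sum>m | \<phi> m \<noteq> 0. fps_const (\<phi> m) * rs_vec_fps v \<phi> (n - m))) $ s =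
        (if s = 0 then 0 else hop_op \<phi> (rs_vec v \<phi> (s - 1)) n)"
      by (cases s) (simp_all add: fps_sum_nth rs_vec_fps_def hop_op_eq[OF fin])
    moreover have "rs_vec_fps v \<phi> n $ s = rs_vec v \<phi> s n" by (simp add: rs_vec_fps_def)
    ultimately have "(\<Sum>j\<le>s. rs_val v \<phi> j * rs_vec v \<phi> (s - j) n) - of_real (v n) * rs_vec v \<phi> s n =
        (if s = 0 then 0 else hop_op \<phi> (rs_vec v \<phi> (s - 1)) n)"
      by (simp only: left_diff_distrib fps_sub_nth fps_mult_left_const_nth)
    moreover have "(\<Sum>j\<le>s. of_real (rs_lam (f x0) v \<phi> j) * rs_vec v \<phi> (s - j) n) =
        of_real (f x0) * rs_vec v \<phi> s n + (\<Sum>j\<le>s. rs_val v \<phi> j * rs_vec v \<phi> (s - j) n)"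
    proof -
      have "of_real (rs_lam (f x0) v \<phi> j) * rs_vec v \<phi> (s - j) n =
          (if j = 0 then of_real (f x0) * rs_vec v \<phi> s n else 0) + rs_val v \<phi> j * rs_vec v \<phi> (s - j) n" for j
        using real[of j] by (auto simp: rs_lam_def rs_val_def)
      then show ?thesis by (simp add: sum.distrib)
    qed
    ultimately show "pot_op f \<omega> x0 (rs_vec v \<phi> s) n + (if s = 0 then 0 else hop_op \<phi> (rs_vec v \<phi> (s - 1)) n) =
        (\<Sum>j\<le>s. complex_of_real (rs_lam (f x0) v \<phi> j) * rs_vec v \<phi> (s - j) n)"
      by (simp add: pot_op_def v_def rel_pot_def algebra_simps)
  qed
qed

text \<open>Evaluated at the largest admissible radius \<open>c / A\<close>. For \<open>A = 0\<close> all radii are admissible and \<open>x\<close> must be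
  non-positive; this covers vanishing hopping.\<close>
lemma le_power_if_bounded_at_radii:
  fixes A c x :: real
  assumes bd: "\<And>r. 0 < r \<Longrightarrow> r * A \<le> c \<Longrightarrow> x * r ^ k \<le> 1" and "0 \<le> A" "0 < c" "k \<noteq> 0"
  shows "x \<le> (A / c) ^ k"
proof (cases "A = 0")
  case False
  then have "0 < A" using assms(2) by linarith
  then have "x * (c / A) ^ k \<le> 1" using assms(3) by (intro bd) auto
  then show ?thesis using False assms by (simp add: field_simps power_divide)
next
  case True
  have "x \<le> 0"
  proof (rule ccontr)
    assume "\<not> x \<le> 0"
    define r where "r = max 1 (2 / x)"
    have "2 \<le> x * r" using \<open>\<not> x \<le> 0\<close> by (simp add: r_def max_def field_simps)
    also have "x * r \<le> x * r ^ k"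
      using \<open>\<not> x \<le> 0\<close> self_le_power[of r k] \<open>k \<noteq> 0\<close> by (intro mult_left_mono) (auto simp: r_def)
    also have "\<dots> \<le> 1" using True assms by (intro bd) (auto simp: r_def)
    finally show False by simp
  qed
  then show ?thesis using True assms by (simp add: power_0_left)
qed

text \<open>The hypotheses bound the coefficients at radius \<open>2 * \<epsilon>\<close>, so both series converge absolutely at \<open>\<epsilon>\<close>. The
  bound on the eigenvector is summed over the lattice and makes it even absolutely summable. The
  eigenvalue equation is the order-by-order equation summed with the Cauchy product.\<close>
lemma perturbation_series_converges:
  fixes \<omega> :: "real ^ 'd::finite"
  assumes rs: "RS_series f \<omega> \<phi> x0 lam psi" and fin: "finite {n. \<phi> n \<noteq> 0}" and eps: "0 < \<epsilon>"
    and lam: "\<And>s. s \<noteq> 0 \<Longrightarrow> \<bar>lam s\<bar> * (2 * \<epsilon>) ^ s \<le> 1"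
    and psi: "\<And>F j. finite F \<Longrightarrow> 0 \<notin> F \<Longrightarrow> (\<Sum>n\<in>F. \<Sum>s\<le>j. cmod (psi s n) * (2 * \<epsilon>) ^ s) \<le> 1"
  defines "\<Lambda> \<equiv> \<Sum>s. \<epsilon> ^ s * lam s" and "\<Psi> \<equiv> \<lambda>n. \<Sum>s. complex_of_real (\<epsilon> ^ s) * psi s n"
  shows "summable (\<lambda>s. \<epsilon> ^ s * lam s)"
    and "summable (\<lambda>s. cmod (complex_of_real (\<epsilon> ^ s) * psi s n))"
    and "ell2 \<Psi>" and "hamiltonian f \<omega> \<phi> \<epsilon> x0 \<Psi> n = complex_of_real \<Lambda> * \<Psi> n"
proof -
  let ?a = "\<lambda>s n. complex_of_real (\<epsilon> ^ s) * psi s n"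
  let ?c = "\<lambda>s j n. complex_of_real (\<epsilon> ^ j * lam j) * (complex_of_real (\<epsilon> ^ (s - j)) * psi (s - j) n)"
  have half: "x * \<epsilon> ^ s \<le> (1/2) ^ s" if "x * (2 * \<epsilon>) ^ s \<le> 1" for x s
    using that by (simp add: power_mult_distrib power_divide field_simps)
  have geo: "summable (\<lambda>s. (1/2::real) ^ s)" by (rule summable_geometric) simp
  have abs_lam: "summable (\<lambda>s. \<bar>\<epsilon> ^ s * lam s\<bar>)"
  proof (rule summable_comparison_test'[OF geo])
    fix s :: nat assume "1 \<le> s"
    then show "norm \<bar>\<epsilon> ^ s * lam s\<bar> \<le> (1/2) ^ s" using half[OF lam[of s]] eps by (simp add: abs_mult mult.commute)
  qed
  then show sum_lam: "summable (\<lambda>s. \<epsilon> ^ s * lam s)" by (rule summable_rabs_cancel)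
  have abs_psi: "summable (\<lambda>s. cmod (?a s n))" for n
  proof (cases "n = 0")
    case False
    show ?thesis
    proof (rule summable_comparison_test'[OF geo, of 0])
      fix s :: nat
      have "cmod (psi s n) * (2 * \<epsilon>) ^ s \<le> (\<Sum>s\<le>s. cmod (psi s n) * (2 * \<epsilon>) ^ s)"
        using eps by (intro member_le_sum) auto
      also have "\<dots> \<le> 1" using psi[of "{n}" s] False by simp
      finally show "norm (cmod (?a s n)) \<le> (1/2) ^ s"
        using half[of "cmod (psi s n)" s] eps by (simp add: norm_mult norm_power mult.commute)
    qed
  next
    case True
    then show ?thesis by (intro summable_finite[of "{0}"]) (auto simp: RS_series_at_0[OF rs])
  qed
  show "summable (\<lambda>s. cmod (?a s n))" by (rule abs_psi)
  have sum_psi: "summable (\<lambda>s. ?a s n)" for n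
    by (rule summable_norm_cancel[OF abs_psi])
  have Psi: "(\<lambda>s. ?a s n) sums \<Psi> n" for n
    unfolding \<Psi>_def by (rule summable_sums[OF sum_psi])
  show "ell2 \<Psi>"
  proof (rule ell2_if_l1_bounded)
    fix F :: "(int ^ 'd) set" assume F: "finite F" "0 \<notin> F"
    have "(\<Sum>n\<in>F. cmod (\<Psi> n)) \<le> (\<Sum>n\<in>F. \<Sum>s. cmod (?a s n))"
      unfolding \<Psi>_def by (intro sum_mono summable_norm abs_psi)
    also have "\<dots> = (\<Sum>s. \<Sum>n\<in>F. cmod (?a s n))"
      by (rule suminf_sum[symmetric]) (rule abs_psi)
    also have "\<dots> \<le> 1"
    proof (rule suminf_le_const)
      show "summable (\<lambda>s. \<Sum>n\<in>F. cmod (?a s n))"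
        by (intro summable_sum abs_psi)
      fix j
      have "(\<Sum>s<j. \<Sum>n\<in>F. cmod (?a s n)) \<le>
          (\<Sum>s\<le>j. \<Sum>n\<in>F. cmod (?a s n))"
        by (intro sum_mono2 sum_nonneg) auto
      also have "\<dots> \<le> (\<Sum>s\<le>j. \<Sum>n\<in>F. cmod (psi s n) * (2 * \<epsilon>) ^ s)"
      proof (intro sum_mono)
        fix s n
        have "\<epsilon> ^ s \<le> (2 * \<epsilon>) ^ s" using eps by (intro power_mono) auto
        then have "\<epsilon> ^ s * cmod (psi s n) \<le> (2 * \<epsilon>) ^ s * cmod (psi s n)" by (intro mult_right_mono) auto
        then show "cmod (?a s n) \<le> cmod (psi s n) * (2 * \<epsilon>) ^ s"
          using eps by (simp add: norm_mult norm_power mult.commute)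
      qed
      also have "\<dots> \<le> 1" using psi[OF F, of j] by (subst sum.swap)
      finally show "(\<Sum>s<j. \<Sum>n\<in>F. cmod (?a s n)) \<le> 1" .
    qed
    finally show "(\<Sum>n\<in>F. cmod (\<Psi> n)) \<le> 1" .
  qed
  show "hamiltonian f \<omega> \<phi> \<epsilon> x0 \<Psi> n = complex_of_real \<Lambda> * \<Psi> n"
  proof -
    let ?V = "complex_of_real (f (x0 + lattice_dot n \<omega>))"
    have Lam: "(\<Sum>s. complex_of_real (\<epsilon> ^ s * lam s)) = complex_of_real \<Lambda>"
      unfolding \<Lambda>_def by (rule suminf_of_real[OF sum_lam, symmetric])
    have cauchy: "(\<lambda>s. \<Sum>j\<le>s. ?c s j n) sums
        (complex_of_real \<Lambda> * \<Psi> n)"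
      unfolding Lam[symmetric] \<Psi>_def
      by (rule Cauchy_product_sums) (use abs_lam abs_psi in \<open>simp_all only: norm_of_real\<close>)
    have pot: "(\<lambda>s. ?V * (?a s n)) sums (?V * \<Psi> n)"
      by (rule sums_mult[OF Psi])
    have "(\<lambda>s. complex_of_real \<epsilon> * (\<Sum>m | \<phi> m \<noteq> 0. \<phi> m * (complex_of_real (\<epsilon> ^ s) * psi s (n - m)))) sums
        (complex_of_real \<epsilon> * (\<Sum>m | \<phi> m \<noteq> 0. \<phi> m * \<Psi> (n - m)))"
      by (intro sums_mult sums_sum Psi)
    then have "(\<lambda>s. complex_of_real (\<epsilon> ^ Suc s) * hop_op \<phi> (psi s) n) sums (complex_of_real \<epsilon> * hop_op \<phi> \<Psi> n)"
      by (simp add: hop_op_eq[OF fin] sum_distrib_left mult_ac)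
    then have "(\<lambda>s. if s = 0 then 0 else complex_of_real (\<epsilon> ^ s) * hop_op \<phi> (psi (s - 1)) n) sums
        (complex_of_real \<epsilon> * hop_op \<phi> \<Psi> n)"
      using sums_Suc[of "\<lambda>s. if s = 0 then 0 else complex_of_real (\<epsilon> ^ s) * hop_op \<phi> (psi (s - 1)) n"] by simp
    from sums_add[OF this pot]
    have "(\<lambda>s. (if s = 0 then 0 else complex_of_real (\<epsilon> ^ s) * hop_op \<phi> (psi (s - 1)) n) +
        ?V * (?a s n)) sums hamiltonian f \<omega> \<phi> \<epsilon> x0 \<Psi> n"
      by (simp only: hamiltonian_def pot_op_def)
    moreover have "(if s = 0 then 0 else complex_of_real (\<epsilon> ^ s) * hop_op \<phi> (psi (s - 1)) n) +
        ?V * (?a s n) =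
        (\<Sum>j\<le>s. ?c s j n)" for s
    proof -
      have "pot_op f \<omega> x0 (psi s) n + (if s = 0 then 0 else hop_op \<phi> (psi (s - 1)) n) =
          (\<Sum>j\<le>s. complex_of_real (lam j) * psi (s - j) n)"
        using rs unfolding RS_series_def by blast
      then have "complex_of_real (\<epsilon> ^ s) * (pot_op f \<omega> x0 (psi s) n + (if s = 0 then 0 else hop_op \<phi> (psi (s - 1)) n)) =
          (\<Sum>j\<le>s. complex_of_real (\<epsilon> ^ s) * (complex_of_real (lam j) * psi (s - j) n))"
        by (simp add: sum_distrib_left)
      also have "\<dots> = (\<Sum>j\<le>s. ?c s j n)"
      proof (intro sum.cong refl)
        fix j assume "j \<in> {..s}"
        then have "\<epsilon> ^ s = \<epsilon> ^ j * \<epsilon> ^ (s - j)" by (simp flip: power_add)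
        then show "complex_of_real (\<epsilon> ^ s) * (complex_of_real (lam j) * psi (s - j) n) =
            ?c s j n"
          by simp
      qed
      finally show ?thesis by (cases "s = 0") (auto simp: pot_op_def algebra_simps)
    qed
    ultimately have "(\<lambda>s. \<Sum>j\<le>s. ?c s j n) sums
        hamiltonian f \<omega> \<phi> \<epsilon> x0 \<Psi> n" by simp
    then show ?thesis using cauchy by (rule sums_unique2)
  qed
qed

lemma suminf_tail_bound:
  fixes a :: "nat \<Rightarrow> complex"
  assumes "\<And>s. s < l \<Longrightarrow> a s = 0" "\<And>s. cmod (a s) \<le> q ^ s" "0 \<le> q" "q \<le> 1/2"
  shows "cmod (suminf a) \<le> 2 * q ^ l"
proof -
  have geo: "summable (\<lambda>s. q ^ s)" using assms by (intro summable_geometric) auto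
  have sa: "summable a" by (rule summable_comparison_test'[OF geo, of 0]) (use assms in auto)
  have geo': "summable (\<lambda>s. q ^ (s + l))" using geo by (simp add: summable_iff_shift)
  have "suminf a = (\<Sum>s. a (s + l)) + sum a {..<l}" by (rule suminf_split_initial_segment[OF sa])
  then have "suminf a = (\<Sum>s. a (s + l))" using assms(1) by simp
  also have "cmod \<dots> \<le> (\<Sum>s. q ^ (s + l))"
    by (rule norm_suminf_le[OF _ geo']) (use assms in auto)
  also have "\<dots> = q ^ l * (1 / (1 - q))"
    using suminf_mult[OF geo, of "q ^ l"] suminf_geometric[of q] assms by (simp add: power_add mult.commute)
  also have "\<dots> \<le> q ^ l * 2" using assms by (intro mult_left_mono) (auto simp: field_simps)
  finally show ?thesis by simp
qed

section \<open>The perturbation theorem\<close>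

text \<open>Chosen such that the total weight \<open>\<eta>\<close> per hop meets the three smallness conditions of
  \<open>resonance_estimates\<close> at the radius \<open>series_radius c \<tau> T N / (sqrt C_reg * \<parallel>\<phi>\<parallel>)\<close>, where \<open>N\<close> is the number
  of hopping vectors.\<close>
definition series_radius :: "real \<Rightarrow> real \<Rightarrow> real \<Rightarrow> nat \<Rightarrow> real" where
  "series_radius c \<tau> T N = min (1/8) (c / (16 * T)) / ((real N + 1) * 2 * brjuno_const c \<tau>)"

lemma series_radius_pos: "0 < c \<Longrightarrow> 0 < T \<Longrightarrow> 0 < \<tau> \<Longrightarrow> 0 < series_radius c \<tau> T N"
  unfolding series_radius_def using brjuno_const_ge_1[of \<tau> c] by (intro divide_pos_pos mult_pos_pos) auto

text \<open>The conclusion of the theorem for a given constant \<open>g\<close>; the factors \<open>1\<close> are the value chosen for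
  \<open>C_dist\<close>.\<close>
definition perturbation_bounds ::
  "(real \<Rightarrow> real) \<Rightarrow> real ^ 'd::finite \<Rightarrow> (int ^ 'd \<Rightarrow> complex) \<Rightarrow> real \<Rightarrow> real \<Rightarrow> real \<Rightarrow> bool" where
  "perturbation_bounds f \<omega> \<phi> C_reg x0 g \<longleftrightarrow>
      (\<exists>lam psi.
        RS_series f \<omega> \<phi> x0 lam psi \<and>
        (\<forall>lam' psi'. RS_series f \<omega> \<phi> x0 lam' psi' \<longrightarrow> lam' = lam \<and> psi' = psi) \<and>
          (\<forall>k\<ge>1. \<bar>lam k\<bar> \<le> C_reg powr (real k / 2) * (1 * sup_norm \<phi>) ^ k / g ^ k) \<and>
          (\<forall>\<epsilon>::real. 0 < \<epsilon> \<longrightarrow> \<epsilon> * (sqrt C_reg * (1 * sup_norm \<phi>)) < g \<longrightarrow>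
            summable (\<lambda>s. \<epsilon> ^ s * lam s) \<and>
            (\<forall>n. summable (\<lambda>s. complex_of_real (\<epsilon> ^ s) * psi s n)) \<and>
            (let \<Lambda> = (\<Sum>s. \<epsilon> ^ s * lam s);
                 \<Psi> = (\<lambda>n. \<Sum>s. complex_of_real (\<epsilon> ^ s) * psi s n) in
              (\<forall>n. case hop_dist \<phi> n 0 of
                     enat l \<Rightarrow> cmod (\<Psi> n) \<le> (1 * sup_norm \<phi> * sqrt C_reg / g) ^ l * \<epsilon> ^ l
                   | \<infinity> \<Rightarrow> \<Psi> n = 0) \<and>
              ell2 \<Psi> \<and>
              (\<forall>n. hamiltonian f \<omega> \<phi> \<epsilon> x0 \<Psi> n = complex_of_real \<Lambda> * \<Psi> n))))"

text \<open>The constant is half of the radius at which the coefficients are bounded by \<open>1\<close>. The factor \<open>2\<close> gained in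
  this way makes the tail of the eigenvector series from order \<open>l \<ge> 1\<close> at most its leading bound, so the
  decay estimate has prefactor \<open>1\<close>.\<close>
lemma perturbation_bounds_hold:
  fixes \<omega> :: "real ^ 'd::finite" and \<phi> :: "int ^ 'd \<Rightarrow> complex"
  assumes Cd: "0 < C_dio" and tau: "0 < \<tau>" and dio: "diophantine C_dio \<tau> \<omega>"
    and hop: "hopping \<phi>" and saw: "sawtooth_potential f" and x0: "x0 \<in> {-1/2<..<1/2}"
    and orbit: "\<And>(k::int) n. x0 \<noteq> of_int k + 1/2 + lattice_dot n \<omega>"
    and reg: "regular_at C_reg f x0" "D_min f x0 \<ge> 1"
  defines "S \<equiv> {n. \<phi> n \<noteq> 0}"
  defines "R \<equiv> 1 + (\<Sum>h\<in>S. norm (real_vec h))"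
  defines "c0 \<equiv> min 1 (C_dio * R powr (- \<tau>) / 2)" and "T \<equiv> (ln 2 / \<tau>) powr (- \<tau>)"
  shows "perturbation_bounds f \<omega> \<phi> C_reg x0 (series_radius c0 \<tau> T (card S) / 2)"
proof -
  define v where "v = rel_pot f \<omega> x0"
  define M where "M = sup_norm \<phi>"
  define g where "g = series_radius c0 \<tau> T (card S)"
  note pot = lattice_potential[OF dio Cd saw x0 orbit reg, folded v_def]
  have fin: "finite S" and herm: "\<phi> (- n) = cnj (\<phi> n)" for n
    using hop by (auto simp: hopping_def S_def)
  have symS: "- n \<in> S" if "n \<in> S" for n using that herm by (simp add: S_def)
  have v0: "v 0 = 0" by (simp add: v_def rel_pot_def)
  have R1: "1 \<le> R" unfolding R_def by (simp add: sum_nonneg)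
  have R: "norm (real_vec h) \<le> R" if "h \<in> S" for h
    unfolding R_def using member_le_sum[OF that, of "\<lambda>h. norm (real_vec h)"] fin by simp
  have c0: "0 < c0" unfolding c0_def using Cd R1 by simp
  have T: "0 < T" unfolding T_def using tau by simp
  have g: "0 < g" unfolding g_def by (rule series_radius_pos[OF c0 T tau])
  have M: "cmod (\<phi> n) \<le> M" for n
  proof -
    have "range (\<lambda>n. cmod (\<phi> n)) \<subseteq> insert 0 ((\<lambda>n. cmod (\<phi> n)) ` S)" by (auto simp: S_def)
    then have "finite (range (\<lambda>n. cmod (\<phi> n)))" by (rule finite_subset) (use fin in simp)
    then show ?thesis unfolding M_def sup_norm_def by (intro cSUP_upper bdd_above_finite) auto
  qed
  have M0: "0 \<le> M" using M[of 0] norm_ge_zero order_trans by blast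
  have C: "1 \<le> C_reg" by (rule pot(1))
  have gap: "gap_condition S v c0 \<tau>"
    unfolding c0_def by (rule gap_condition_lattice[OF dio Cd tau R R1 pot(3)])
  define A where "A = sqrt C_reg * M"
  have A0: "0 \<le> A" using C M0 by (simp add: A_def)
  have bounds: "(\<Sum>n\<in>F. \<Sum>s\<le>j. cmod (rs_vec v \<phi> s n) * r ^ s) \<le> 1 \<and> (\<Sum>s\<le>j. cmod (rs_val v \<phi> s) * r ^ s) \<le> 1"
    if r: "0 < r" "r * A \<le> g" and F: "finite F" "0 \<notin> F" for r F j
  proof -
    define \<eta> where "\<eta> = (real (card S) + 1) * (2 * (r * M) * brjuno_const c0 \<tau>)"
    have Q: "1 \<le> brjuno_const c0 \<tau>" by (rule brjuno_const_ge_1[OF tau])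
    have eta0: "0 \<le> \<eta>" unfolding \<eta>_def using r M0 Q by simp
    have "sqrt C_reg * \<eta> = (r * A) * ((real (card S) + 1) * 2 * brjuno_const c0 \<tau>)"
      by (simp add: \<eta>_def A_def)
    also have "\<dots> \<le> g * ((real (card S) + 1) * 2 * brjuno_const c0 \<tau>)"
      using r(2) Q by (intro mult_right_mono) auto
    also have "\<dots> = min (1/8) (c0 / (16 * T))" using Q by (simp add: g_def series_radius_def)
    finally have small: "sqrt C_reg * \<eta> \<le> min (1/8) (c0 / (16 * T))" .
    have "1 \<le> sqrt C_reg" using C by simp
    then have "1 * \<eta> \<le> sqrt C_reg * \<eta>" using eta0 by (intro mult_right_mono)
    then have e1: "\<eta> \<le> 1/8" "\<eta> \<le> c0 / (16 * T)" using small by auto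
    have e2: "16 * T * \<eta> \<le> c0" using e1(2) T by (simp add: field_simps)
    have "(sqrt C_reg * \<eta>)\<^sup>2 \<le> (1/8)\<^sup>2" using small eta0 C by (intro power_mono) auto
    moreover have "(sqrt C_reg * \<eta>)\<^sup>2 = C_reg * \<eta>\<^sup>2" using C by (simp add: power_mult_distrib)
    ultimately have "C_reg * \<eta>\<^sup>2 \<le> (1/8)\<^sup>2" by (simp only:)
    then have e3: "16 * (2 * C_reg) * \<eta>\<^sup>2 \<le> 1" by (simp add: power_divide)
    interpret resonance_estimates S v M c0 \<tau> "2 * C_reg" T r \<eta> "rs_val_fps v \<phi>"
    proof
      show "\<bar>v (p + e) - v e\<bar> \<le> 2 * C_reg * \<bar>v p\<bar> * max 1 \<bar>v e\<bar> * max 1 \<bar>v (p + e)\<bar>" if "\<bar>v p\<bar> < 1" for p e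
        by (rule pot(4)[OF that])
      show "(1/2) ^ l \<le> T * real l powr (- \<tau>)" if "l \<ge> 1" for l
        unfolding T_def by (rule half_power_le_powr[OF that tau])
    qed (use fin symS v0 pot(2) M0 r c0 tau gap C e1 e2 e3 in \<open>auto simp: \<eta>_def\<close>)
    have h: "hops (\<lambda>n. \<phi> (- n))" unfolding hops_def using M herm by (auto simp: S_def)
    note b = rs_bounds[OF refl h F, of j]
    have "(\<Sum>n\<in>F. \<Sum>s\<le>j. cmod (rs_vec v \<phi> s n) * r ^ s) \<le> 2 * \<eta>"
      using b(1) by (simp add: trunc_norm_def rs_vec_fps_def)
    moreover have "(\<Sum>s\<le>j. cmod (rs_val v \<phi> s) * r ^ s) \<le> \<eta>"
      using b(2) by (simp add: trunc_norm_def rs_val_fps_def)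
    ultimately show ?thesis using e1 by linarith
  qed
  define lam where "lam = rs_lam (f x0) v \<phi>"
  define psi where "psi = rs_vec v \<phi>"
  have rs: "RS_series f \<omega> \<phi> x0 lam psi"
    unfolding lam_def psi_def v_def by (rule RS_series_rs_vec[OF hop]) (use pot(2) in \<open>simp add: v_def\<close>)
  have unique: "lam' = lam \<and> psi' = psi" if "RS_series f \<omega> \<phi> x0 lam' psi'" for lam' psi'
    by (rule RS_series_unique[OF _ rs that]) (use pot(2) in \<open>simp add: v_def rel_pot_def\<close>)
  have lam_bd: "\<bar>lam s\<bar> * r ^ s \<le> 1" if r: "0 < r" "r * A \<le> g" and "s \<noteq> 0" for r s
  proof -
    have "\<bar>lam s\<bar> * r ^ s \<le> cmod (rs_val v \<phi> s) * r ^ s"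
      using r \<open>s \<noteq> 0\<close> by (intro mult_right_mono) (auto simp: lam_def rs_lam_def abs_Re_le_cmod)
    also have "\<dots> \<le> (\<Sum>s\<le>s. cmod (rs_val v \<phi> s) * r ^ s)" using r by (intro member_le_sum) auto
    also have "\<dots> \<le> 1" using bounds[OF r, of "{}" s] by simp
    finally show ?thesis .
  qed
  have psi_bd: "cmod (psi s n) * r ^ s \<le> 1" if r: "0 < r" "r * A \<le> g" and "n \<noteq> 0" for r s n
  proof -
    have "cmod (psi s n) * r ^ s \<le> (\<Sum>s\<le>s. cmod (psi s n) * r ^ s)" using r by (intro member_le_sum) auto
    also have "\<dots> \<le> 1" using bounds[OF r, of "{n}" s] \<open>n \<noteq> 0\<close> by (simp add: psi_def)
    finally show ?thesis .
  qed
  have psi_reach: "hop_dist \<phi> n 0 \<le> enat s" if "psi s n \<noteq> 0" for s n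
  proof -
    have "reach S s 0 n" using rs_vec_reach[of \<phi> S v s n] that by (simp add: S_def psi_def)
    then show ?thesis using reach_reverse[OF symS] by (intro hop_dist_le) (simp add: S_def)
  qed
  show ?thesis
    unfolding perturbation_bounds_def Let_def M_def[symmetric] g_def[symmetric] mult_1
  proof (rule exI[of _ lam], rule exI[of _ psi], intro conjI allI impI)
    show "RS_series f \<omega> \<phi> x0 lam psi" by (rule rs)
    show "lam' = lam" "psi' = psi" if "RS_series f \<omega> \<phi> x0 lam' psi'" for lam' psi'
      using unique[OF that] by auto
    show "\<bar>lam k\<bar> \<le> C_reg powr (real k / 2) * M ^ k / (g / 2) ^ k" if "1 \<le> k" for k
    proof -
      have "\<bar>lam k\<bar> \<le> (A / g) ^ k"
        by (rule le_power_if_bounded_at_radii[OF lam_bd A0 g]) (use that in auto)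
      also have "\<dots> \<le> (A / (g / 2)) ^ k" using A0 g by (intro power_mono divide_left_mono) auto
      finally have "\<bar>lam k\<bar> \<le> A ^ k / (g / 2) ^ k" by (simp only: power_divide)
      moreover have "A ^ k = C_reg powr (real k / 2) * M ^ k"
        using C by (simp add: A_def power_mult_distrib powr_half_sqrt[symmetric] powr_powr flip: powr_realpow)
      ultimately show ?thesis by simp
    qed
  next
    fix \<epsilon> :: real assume eps: "0 < \<epsilon>" "\<epsilon> * (sqrt C_reg * M) < g / 2"
    let ?a = "\<lambda>s n. complex_of_real (\<epsilon> ^ s) * psi s n"
    have r: "0 < 2 * \<epsilon>" "2 * \<epsilon> * A \<le> g" using eps by (auto simp: A_def)
    note conv = perturbation_series_converges[OF rs fin[unfolded S_def] eps(1) lam_bd[OF r] bounds[OF r, THEN conjunct1, folded psi_def]]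
    show "summable (\<lambda>s. \<epsilon> ^ s * lam s)" by (rule conv(1))
    show "summable (\<lambda>s. ?a s n)" for n
      by (rule summable_norm_cancel[OF conv(2)])
    show "ell2 (\<lambda>n. \<Sum>s. ?a s n)" by (rule conv(3))
    show "hamiltonian f \<omega> \<phi> \<epsilon> x0 (\<lambda>n. \<Sum>s. ?a s n) n =
        complex_of_real (\<Sum>s. \<epsilon> ^ s * lam s) * (\<Sum>s. ?a s n)" for n by (rule conv(4))
    fix n
    show "case hop_dist \<phi> n 0 of
        enat l \<Rightarrow> cmod (\<Sum>s. ?a s n) \<le> (M * sqrt C_reg / (g / 2)) ^ l * \<epsilon> ^ l
      | \<infinity> \<Rightarrow> (\<Sum>s. ?a s n) = 0"
    proof (cases "hop_dist \<phi> n 0")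
      case infinity
      have "psi s n = 0" for s using psi_reach[of s n] infinity by auto
      then show ?thesis using infinity by simp
    next
      case (enat l)
      have q: "\<epsilon> * A / g \<le> 1/2" "0 \<le> \<epsilon> * A / g"
        using r A0 g eps(1) by (auto simp: field_simps intro!: divide_nonneg_pos mult_nonneg_nonneg)
      show ?thesis
      proof (cases "n = 0")
        case True
        have "psi s 0 = of_bool (s = 0)" for s by (simp add: psi_def rs_vec_at_0)
        then have "(\<Sum>s. complex_of_real (\<epsilon> ^ s) * psi s 0) = 1"
          by (subst suminf_finite[of "{0}"]) auto
        moreover have "l = 0"
          using psi_reach[of 0 0] enat True by (simp add: psi_def)
        ultimately show ?thesis using True enat by simp
      next
        case False
        have "l \<noteq> 0"
        proof
          assume "l = 0"
          then show False using hop_dist_attained[of \<phi> n 0 0] enat False by (metis)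
        qed
        have "cmod (\<Sum>s. ?a s n) \<le> 2 * (\<epsilon> * A / g) ^ l"
        proof (rule suminf_tail_bound[OF _ _ q(2,1)])
          fix s assume "s < l"
          then have "psi s n = 0" using psi_reach[of s n] enat by auto
          then show "?a s n = 0" by simp
        next
          fix s
          have "cmod (psi s n) \<le> (A / g) ^ s"
          proof (cases "s = 0")
            case True
            then show ?thesis using False by (simp add: psi_def)
          next
            case s: False
            show ?thesis by (rule le_power_if_bounded_at_radii[OF psi_bd A0 g s]) (use False in auto)
          qed
          then have "\<epsilon> ^ s * cmod (psi s n) \<le> \<epsilon> ^ s * (A / g) ^ s" using eps by (intro mult_left_mono) auto
          then show "cmod (?a s n) \<le> (\<epsilon> * A / g) ^ s"
            using eps by (simp add: norm_mult norm_power power_mult_distrib power_divide)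
        qed
        also have "\<dots> \<le> 2 ^ l * (\<epsilon> * A / g) ^ l"
          using q(2) self_le_power[of "2::real" l] \<open>l \<noteq> 0\<close> by (intro mult_right_mono) auto
        also have "\<dots> = (M * sqrt C_reg / (g / 2)) ^ l * \<epsilon> ^ l"
          by (simp add: A_def mult_ac flip: power_mult_distrib)
        finally show ?thesis using enat by simp
      qed
    qed
  qed
qed

theorem theorem5p11:
  shows "\<exists>(C_dist :: (int ^ 'd::finite \<Rightarrow> int ^ 'd \<Rightarrow> enat) \<Rightarrow> real)
          (\<gamma> :: real \<Rightarrow> real \<Rightarrow> (int ^ 'd \<Rightarrow> int ^ 'd \<Rightarrow> enat) \<Rightarrow> real).
    (\<forall>\<Delta>. C_dist \<Delta> > 0) \<and> (\<forall>\<tau> C_dio \<Delta>. \<gamma> \<tau> C_dio \<Delta> > 0) \<and>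
    (\<forall>(\<omega> :: real ^ 'd) C_dio \<tau> (\<phi> :: int ^ 'd \<Rightarrow> complex) f C_reg x0.
      C_dio > 0 \<longrightarrow> \<tau> > 1 \<longrightarrow> diophantine C_dio \<tau> \<omega> \<longrightarrow>
      hopping \<phi> \<longrightarrow> sawtooth_potential f \<longrightarrow>
      x0 \<in> {-1/2<..<1/2} \<longrightarrow>
      (\<forall>(k::int) n. x0 \<noteq> of_int k + 1/2 + lattice_dot n \<omega>) \<longrightarrow>
      regular_at C_reg f x0 \<longrightarrow> D_min f x0 \<ge> 1 \<longrightarrow>
      (\<exists>lam psi.
        RS_series f \<omega> \<phi> x0 lam psi \<and>
        (\<forall>lam' psi'. RS_series f \<omega> \<phi> x0 lam' psi' \<longrightarrow> lam' = lam \<and> psi' = psi) \<and>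
        (let C = C_dist (hop_dist \<phi>); g = \<gamma> \<tau> C_dio (hop_dist \<phi>) in
          (\<forall>k\<ge>1. \<bar>lam k\<bar> \<le> C_reg powr (real k / 2) * (C * sup_norm \<phi>) ^ k / g ^ k) \<and>
          (\<forall>\<epsilon>::real. 0 < \<epsilon> \<longrightarrow> \<epsilon> * (sqrt C_reg * (C * sup_norm \<phi>)) < g \<longrightarrow>
            summable (\<lambda>s. \<epsilon> ^ s * lam s) \<and>
            (\<forall>n. summable (\<lambda>s. complex_of_real (\<epsilon> ^ s) * psi s n)) \<and>
            (let \<Lambda> = (\<Sum>s. \<epsilon> ^ s * lam s);
                 \<Psi> = (\<lambda>n. \<Sum>s. complex_of_real (\<epsilon> ^ s) * psi s n) in
              (\<forall>n. case hop_dist \<phi> n 0 of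
                     enat l \<Rightarrow> cmod (\<Psi> n) \<le> (C * sup_norm \<phi> * sqrt C_reg / g) ^ l * \<epsilon> ^ l
                   | \<infinity> \<Rightarrow> \<Psi> n = 0) \<and>
              ell2 \<Psi> \<and>
              (\<forall>n. hamiltonian f \<omega> \<phi> \<epsilon> x0 \<Psi> n = complex_of_real \<Lambda> * \<Psi> n))))))"
proof -
  \<comment> \<open>The number and the size of the hopping vectors are absorbed into gamma, so C_dist is 1. The
    value outside the parameter range is arbitrary but positive.\<close>
  define \<gamma> :: "real \<Rightarrow> real \<Rightarrow> (int ^ 'd \<Rightarrow> int ^ 'd \<Rightarrow> enat) \<Rightarrow> real" where
    "\<gamma> \<tau> C \<Delta> = (if 0 < C \<and> 0 < \<tau> then
       (let S = {n. \<Delta> 0 n = 1}; R = 1 + (\<Sum>h\<in>S. norm (real_vec h)) in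
         series_radius (min 1 (C * R powr (- \<tau>) / 2)) \<tau> ((ln 2 / \<tau>) powr (- \<tau>)) (card S) / 2)
       else 1)" for \<tau> C \<Delta>
  have pos: "0 < \<gamma> \<tau> C \<Delta>" for \<tau> C \<Delta>
  proof -
    have "0 < 1 + (\<Sum>h | \<Delta> 0 h = 1. norm (real_vec h))" by (simp add: add_pos_nonneg sum_nonneg)
    then show ?thesis by (auto simp: \<gamma>_def Let_def intro!: series_radius_pos)
  qed
  have main: "perturbation_bounds f \<omega> \<phi> C_reg x0 (\<gamma> \<tau> C_dio (hop_dist \<phi>))"
    if "C_dio > 0" "\<tau> > 1" "diophantine C_dio \<tau> \<omega>" "hopping \<phi>" "sawtooth_potential f"
      "x0 \<in> {-1/2<..<1/2}" "\<forall>(k::int) n. x0 \<noteq> of_int k + 1/2 + lattice_dot n \<omega>"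
      "regular_at C_reg f x0" "D_min f x0 \<ge> 1"
    for \<omega> :: "real ^ 'd" and C_dio \<tau> \<phi> f C_reg x0
  proof -
    have "\<phi> 0 = 0" using that by (simp add: hopping_def)
    then have S: "{n. hop_dist \<phi> 0 n = 1} = {n. \<phi> n \<noteq> 0}" by (rule support_from_hop_dist[symmetric])
    have "\<tau> > 0" using that by simp
    have eq: "\<gamma> \<tau> C_dio (hop_dist \<phi>) = series_radius
        (min 1 (C_dio * (1 + (\<Sum>h | \<phi> h \<noteq> 0. norm (real_vec h))) powr (- \<tau>) / 2)) \<tau>
        ((ln 2 / \<tau>) powr (- \<tau>)) (card {n. \<phi> n \<noteq> 0}) / 2"
      using \<open>\<tau> > 0\<close> that(1) by (simp add: \<gamma>_def Let_def S)
    show ?thesis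
      unfolding eq by (rule perturbation_bounds_hold[OF that(1) \<open>\<tau> > 0\<close> that(3-6) _ that(8,9)]) (use that(7) in blast)
  qed
  show ?thesis
    by (rule exI[of _ "\<lambda>_. 1"], rule exI[of _ \<gamma>])
       (use pos main[unfolded perturbation_bounds_def] in \<open>simp add: Let_def\<close>)
qed

end
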